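(* Let $\mathcal{Z},\mathcal{X}$ be Polish and assume: (1) $\frac1n\sum_{i=1}^n\delta_{z_{n,i}}\to\mu$ in $\mathcal{P}(\mathcal{Z})$; (2) for each $k\ge1$, $(P^k_z;z\in\mathcal{Z})$ is a Feller system on $\mathcal{X}$; (3) for each $z$, $(P^k_z)_{k\ge1}$ obeys the $k$-LDP in $\mathcal{X}$ with good rate function $J_z$. For each $k,n$ let $X^k_{n,1},\dots,X^k_{n,n}$ be independent with $X^k_{n,i}\sim P^k_{z_{n,i}}$, $L^k_n=\frac1n\sum_{i=1}^n\delta_{X^k_{n,i}}$, and $P^k=\int_{\mathcal{Z}}P^k_z\,\mu(dz)$. Then: (a) $\{L^k_n\}_{k,n\ge1}$ obeys the $(k,n)$-LDP in $\mathcal{P}(\mathcal{X})$ with good rate function $$I(Q)=\inf\Big\{\int_{\mathcal{Z}\times\mathcal{X}}J_z(x)\,\mu(dz)\Pi_z(dx):\ (\Pi_z)_{z\in\mathcal{Z}}\text{ measurable kernels},\ \int_{\mathcal{Z}}\Pi_z\,\mu(dz)=Q\Big\}.$$ (b) $I(Q)=\sup_{f\in C_b(\mathcal{X})}\big\{\int_{\mathcal{Z}}\mathcal{S}f(z)\,\mu(dz)-\int_{\mathcal{X}}f\,dQ\big\}$ for $Q\in\mathcal{P}(\mathcal{X})$, where $\mathcal{S}f(z)=\inf_{x\in\mathcal{X}}\{J_z(x)+f(x)\}$. (c) If $I(Q)<\infty$, there exists a (possibly non-unique) kernel $(\Pi^*_z)$ attaining the infimum in (a). (d) If for each $k$, $P^k_z=P^k(\cdot\mid\beta(X)=z)$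 for $\mu$-a.e. $z$, for some continuous $\beta:\mathcal{X}\to\mathcal{Z}$, then $I(Q)=\int_{\mathcal{X}}J_{\beta(x)}(x)\,Q(dx)$ if $\beta\diamond Q=\mu$ and $I(Q)=+\infty$ otherwise.
   Context: $\mathcal{P}(E)$: Borel probability measures on Polish $E$ with narrow topology; $C_b(E)$ bounded continuous functions. Feller system: $z\mapsto\int f\,dP^k_z$ continuous for all $f\in C_b(\mathcal{X})$. $k$-LDP with good rate function $J$: compact level sets and $-\inf_{\mathrm{int}A}J\le\liminf_k\frac1k\log P^k_z(A)\le\limsup_k\frac1k\log P^k_z(A)\le-\inf_{\mathrm{cl}A}J$. $(k,n)$-LDP with rate $I$: for all measurable $B\subset\mathcal{P}(\mathcal{X})$, $-\inf_{\mathrm{int}B}I\le\liminf_k\liminf_n\frac1{kn}\log\mathbb{P}(L^k_n\in B)\le\limsup_k\limsup_n\frac1{kn}\log\mathbb{P}(L^k_n\in B)\le-\inf_{\mathrm{cl}B}I$. $\beta\diamond Q$ is the image of $Q$ under $\beta$; $X$ denotes the identity map of $\mathcal{X}$. *)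

theory Defs
  imports "HOL-Probability.Probability"
begin

definition Cb :: "('a::topological_space \<Rightarrow> real) set" where
  "Cb = {f. continuous_on UNIV f \<and> bounded (range f)}"

definition PM :: "('a::topological_space) measure set" where
  "PM = space (prob_algebra (borel :: 'a measure))"

definition narrow_topology :: "('a::topological_space) measure topology" where
  "narrow_topology = topology_generated_by
     {{Q \<in> PM. (\<integral>x. f x \<partial>Q) \<in> U} | f U. f \<in> Cb \<and> open U}"

definition elog :: "real \<Rightarrow> ereal" where
  "elog p = (if p \<le> 0 then -\<infinity> else ereal (ln p))"

definition good_rate :: "('a::topological_space \<Rightarrow> ennreal) \<Rightarrow> bool" where
  "good_rate J \<longleftrightarrow> (\<forall>a::real. compact {x. J x \<le> ennreal a})"

definition good_rate_on :: "'a topology \<Rightarrow> ('a \<Rightarrow> ennreal) \<Rightarrow> bool" where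
  "good_rate_on T I \<longleftrightarrow> (\<forall>a::real. compactin T {Q \<in> topspace T. I Q \<le> ennreal a})"

definition k_LDP :: "(nat \<Rightarrow> 'a::topological_space measure) \<Rightarrow> ('a \<Rightarrow> ennreal) \<Rightarrow> bool" where
  "k_LDP P J \<longleftrightarrow> good_rate J \<and>
     (\<forall>A \<in> sets borel.
        - enn2ereal (INF x\<in>interior A. J x)
           \<le> liminf (\<lambda>k. elog (measure (P k) A) / ereal (real k)) \<and>
        limsup (\<lambda>k. elog (measure (P k) A) / ereal (real k))
           \<le> - enn2ereal (INF x\<in>closure A. J x))"

text \<open>(k,n)-LDP: p k n B is the probability that L^k_n lies in B; Bs the measurable sets.\<close>
definition kn_LDP :: "'m topology \<Rightarrow> 'm set set \<Rightarrow> (nat \<Rightarrow> nat \<Rightarrow> 'm set \<Rightarrow> real)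
                       \<Rightarrow> ('m \<Rightarrow> ennreal) \<Rightarrow> bool" where
  "kn_LDP T Bs p I \<longleftrightarrow> good_rate_on T I \<and>
     (\<forall>B \<in> Bs.
        - enn2ereal (INF Q\<in>T interior_of B. I Q)
           \<le> liminf (\<lambda>k. liminf (\<lambda>n. elog (p k n B) / ereal (real k * real n))) \<and>
        limsup (\<lambda>k. limsup (\<lambda>n. elog (p k n B) / ereal (real k * real n)))
           \<le> - enn2ereal (INF Q\<in>T closure_of B. I Q))"

definition feller :: "('z::topological_space \<Rightarrow> 'x::topological_space measure) \<Rightarrow> bool" where
  "feller P \<longleftrightarrow> (\<forall>z. P z \<in> PM) \<and>
     (\<forall>f \<in> Cb. continuous_on UNIV (\<lambda>z. \<integral>x. f x \<partial>(P z)))"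

definition empirical :: "nat \<Rightarrow> (nat \<Rightarrow> 'a::topological_space) \<Rightarrow> 'a measure" where
  "empirical n x = measure_of UNIV (sets borel)
      (\<lambda>A. (\<Sum>i<n. indicator A (x i)) / of_nat n)"

text \<open>P(L^k_n in B) for independent X_{n,i} ~ P k (z n i), i < n (product measure).\<close>
definition emp_prob :: "(nat \<Rightarrow> 'z \<Rightarrow> 'x::topological_space measure) \<Rightarrow> (nat \<Rightarrow> nat \<Rightarrow> 'z)
                         \<Rightarrow> nat \<Rightarrow> nat \<Rightarrow> 'x measure set \<Rightarrow> real" where
  "emp_prob P z k n B =
     (let M = PiM {..<n} (\<lambda>i. P k (z n i)) in
        measure M ((\<lambda>\<omega>. empirical n \<omega>) -` B \<inter> space M))"

definition kernels_for :: "'z measure \<Rightarrow> 'x::topological_space measure \<Rightarrow> ('z \<Rightarrow> 'x measure) set" where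
  "kernels_for \<mu> Q = {K. K \<in> measurable \<mu> (prob_algebra borel) \<and> bind \<mu> K = Q}"

definition kcost :: "'z measure \<Rightarrow> ('z \<Rightarrow> 'x \<Rightarrow> ennreal) \<Rightarrow> ('z \<Rightarrow> 'x measure) \<Rightarrow> ennreal" where
  "kcost \<mu> J K = (\<integral>\<^sup>+z. (\<integral>\<^sup>+x. J z x \<partial>(K z)) \<partial>\<mu>)"

definition rateI :: "'z measure \<Rightarrow> ('z \<Rightarrow> 'x::topological_space \<Rightarrow> ennreal) \<Rightarrow> 'x measure \<Rightarrow> ennreal" where
  "rateI \<mu> J Q = (INF K \<in> kernels_for \<mu> Q. kcost \<mu> J K)"

text \<open>S f (z) = inf_x (J_z(x) + f(x)) (shown finite under the hypotheses).\<close>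
definition Sop :: "('z \<Rightarrow> 'x \<Rightarrow> ennreal) \<Rightarrow> ('x \<Rightarrow> real) \<Rightarrow> 'z \<Rightarrow> real" where
  "Sop J f z = real_of_ereal (INF x. enn2ereal (J z x) + ereal (f x))"

end

theory Submission
  imports Defs
begin

text \<open>
  Put \<open>p h = \<integral> sup\<^sub>x (h x - J\<^sub>y x) \<mu>(dy)\<close> and \<open>I\<^sup>* Q = sup\<^sub>h (\<integral>h dQ - p h)\<close>. Exponential
  moments of the empirical measure factorise, so conditions (1), (2) and Varadhan's lemma give
  \<open>1/(kn) log E exp (kn L(h)) \<rightarrow> p h\<close> for every bounded continuous \<open>h\<close>.

  Upper bound: a linear functional on bounded continuous functions dominated by \<open>p + a\<close> is
  \<open>\<sigma>\<close>-smooth, because \<open>p\<close> vanishes along decreasing sequences with limit \<open>0\<close> (Dini on the compact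
  level sets of \<open>J\<^sub>y\<close>), hence it is a probability measure by Daniell's theorem. Tychonoff's theorem in
  the space of functionals therefore yields the compactness of the level sets of \<open>I\<^sup>*\<close>, and a cover of
  every closed set disjoint from \<open>{I\<^sup>* \<le> a}\<close> by finitely many half-spaces, on which Chebyshev's
  inequality applies.

  Lower bound: maximising \<open>t \<cdot> q - lam\<^sub>k (t \<cdot> f) - (\<eta>/2) \<bar>t\<bar>\<^sup>2\<close>, where \<open>lam\<^sub>k\<close> is the prelimit of \<open>p\<close>,
  produces an exponential tilt of \<open>P\<^sup>k\<close> whose mean is close to the prescribed \<open>q\<close> at a cost of at
  most \<open>I\<^sup>* + \<epsilon>\<close>.

  Duality \<open>I = I\<^sup>*\<close>: the same tilted laws are approximate kernels. Near minimisers of a Hilbert norm over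
  such kernels converge for almost every \<open>y\<close>, and the limit is an optimal kernel; this gives (b) and (c).
  In (d) the hypothesis forces \<open>J\<^sub>y = \<infinity>\<close> off \<open>{\<beta> = y}\<close>, and duality replaces a disintegration
  of \<open>Q\<close>.
\<close>

section \<open>Bounded continuous functions and Borel probability measures\<close>

text \<open>All four claims rest on one equivalence, \<open>rateI_le_iff\<close>: for real a \<ge>
  0, the rate at Q is at most a exactly when \<open>dual_le a Q\<close>. Compactness and both
  deviation bounds are proved on the dual side only. The obstacle is the dependence on y. Hypothesis
  (1) tests the points z_{n,i} against bounded continuous functions only, while J_y is not even
  assumed measurable in y. So everything that is averaged before n tends to infinity has to be
  continuous in y. The Feller property ensures this for log-moments of P^k_y under a function on X
  that is the same for all y. For this reason the tilts use a single g, a finite combination of test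
  functions, and never a minimising kernel. The functions J_y enter only after n has gone, through
  sup_x (h x - J_y x). This is Borel in y as a limit of continuous functions, and countably many
  such suprema recover J_y by \<open>J_eq_SUP_hfam\<close>.\<close>

definition supn :: "('x \<Rightarrow> real) \<Rightarrow> real" where
  "supn f = (SUP x. \<bar>f x\<bar>)"

lemma Cb_cont: "f \<in> Cb \<Longrightarrow> continuous_on UNIV f"
  by (simp add: Cb_def)

lemma Cb_abs_le: "f \<in> Cb \<Longrightarrow> \<bar>f x\<bar> \<le> supn f"
  unfolding Cb_def supn_def bounded_iff
  by (auto intro!: cSUP_upper bdd_aboveI2)

lemma supn_nonneg: "f \<in> Cb \<Longrightarrow> 0 \<le> supn f"
  using Cb_abs_le[of f undefined] by linarith

lemma CbI: "continuous_on UNIV f \<Longrightarrow> (\<And>x. \<bar>f x\<bar> \<le> C) \<Longrightarrow> f \<in> Cb"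
  unfolding Cb_def bounded_iff by auto

lemma supn_le: "(\<And>x. \<bar>f x\<bar> \<le> C) \<Longrightarrow> supn f \<le> C"
  unfolding supn_def by (rule cSUP_least) auto

lemma Cb_const [simp, intro]: "(\<lambda>_. c) \<in> Cb"
  by (rule CbI[where C = "\<bar>c\<bar>"]) auto

lemma Cb_add [intro]:
  assumes "f \<in> Cb" "g \<in> Cb" shows "(\<lambda>x. f x + g x) \<in> Cb"
proof (rule CbI)
  show "continuous_on UNIV (\<lambda>x. f x + g x)"
    using assms by (intro continuous_intros Cb_cont)
  show "\<bar>f x + g x\<bar> \<le> supn f + supn g" for x
    using Cb_abs_le[OF assms(1), of x] Cb_abs_le[OF assms(2), of x] by linarith
qed

lemma Cb_scale [intro]:
  assumes "f \<in> Cb" shows "(\<lambda>x. c * f x) \<in> Cb"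
proof (rule CbI)
  show "continuous_on UNIV (\<lambda>x. c * f x)"
    using assms by (intro continuous_intros Cb_cont)
  show "\<bar>c * f x\<bar> \<le> \<bar>c\<bar> * supn f" for x
    using Cb_abs_le[OF assms, of x] by (simp add: abs_mult mult_left_mono)
qed

lemma Cb_minus [intro]: "f \<in> Cb \<Longrightarrow> (\<lambda>x. - f x) \<in> Cb"
  using Cb_scale[of f "-1"] by simp

lemma Cb_diff [intro]: "f \<in> Cb \<Longrightarrow> g \<in> Cb \<Longrightarrow> (\<lambda>x. f x - g x) \<in> Cb"
  using Cb_add[of f "\<lambda>x. - g x"] by auto

lemma Cb_sum [intro]: "(\<And>i. i \<in> A \<Longrightarrow> f i \<in> Cb) \<Longrightarrow> (\<lambda>x. \<Sum>i\<in>A. f i x) \<in> Cb"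
  by (induction A rule: infinite_finite_induct) auto

lemma Cb_abs [intro]: "f \<in> Cb \<Longrightarrow> (\<lambda>x. \<bar>f x\<bar>) \<in> Cb"
  by (rule CbI[where C = "supn f"]) (simp_all add: continuous_on_rabs Cb_cont Cb_abs_le)

lemma Cb_max [intro]:
  assumes "f \<in> Cb" "g \<in> Cb" shows "(\<lambda>x. max (f x) (g x)) \<in> Cb"
proof -
  have "(\<lambda>x. (1/2) * ((f x + g x) + \<bar>f x - g x\<bar>)) \<in> Cb"
    using assms by (intro Cb_scale Cb_add Cb_abs Cb_diff)
  moreover have "(\<lambda>x. (1/2) * ((f x + g x) + \<bar>f x - g x\<bar>)) = (\<lambda>x. max (f x) (g x))"
    by (auto simp: fun_eq_iff max_def)
  ultimately show ?thesis by simp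
qed

lemma Cb_min [intro]:
  assumes "f \<in> Cb" "g \<in> Cb" shows "(\<lambda>x. min (f x) (g x)) \<in> Cb"
proof -
  have "(\<lambda>x. - max (- f x) (- g x)) \<in> Cb"
    using assms by (intro Cb_minus Cb_max)
  moreover have "(\<lambda>x. - max (- f x) (- g x)) = (\<lambda>x. min (f x) (g x))"
    by (auto simp: fun_eq_iff max_def min_def)
  ultimately show ?thesis by simp
qed

lemma Cb_compose_cont:
  assumes "f \<in> Cb" "continuous_on UNIV (\<phi> :: real \<Rightarrow> real)" shows "(\<lambda>x. \<phi> (f x)) \<in> Cb"
proof -
  have "compact (\<phi> ` {- supn f .. supn f})"
    by (intro compact_continuous_image) (auto intro: continuous_on_subset[OF assms(2)])
  then obtain C where C: "\<And>y. y \<in> {- supn f .. supn f} \<Longrightarrow> \<bar>\<phi> y\<bar> \<le> C"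
    by (metis bounded_iff compact_imp_bounded imageI real_norm_def)
  show ?thesis
  proof (rule CbI)
    show "continuous_on UNIV (\<lambda>x. \<phi> (f x))"
      by (rule continuous_on_compose2[OF assms(2) Cb_cont[OF assms(1)]]) auto
    show "\<bar>\<phi> (f x)\<bar> \<le> C" for x
      using Cb_abs_le[OF assms(1), of x] by (intro C) auto
  qed
qed

lemma Cb_exp [intro]: "f \<in> Cb \<Longrightarrow> (\<lambda>x. exp (f x)) \<in> Cb"
  by (rule Cb_compose_cont) (auto intro: continuous_intros)

lemma Cb_mult [intro]:
  assumes "f \<in> Cb" "g \<in> Cb" shows "(\<lambda>x. f x * g x) \<in> Cb"
proof (rule CbI)
  show "continuous_on UNIV (\<lambda>x. f x * g x)"
    using assms by (intro continuous_intros Cb_cont)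
  show "\<bar>f x * g x\<bar> \<le> supn f * supn g" for x
    using Cb_abs_le[OF assms(1), of x] Cb_abs_le[OF assms(2), of x]
    by (auto simp: abs_mult intro!: mult_mono)
qed

lemma Cb_measurable [measurable_dest]: "f \<in> Cb \<Longrightarrow> f \<in> borel_measurable borel"
  by (rule borel_measurable_continuous_onI) (rule Cb_cont)

section \<open>Integrals with respect to Borel probability measures\<close>

lemma PM_iff: "Q \<in> PM \<longleftrightarrow> prob_space Q \<and> sets Q = sets borel"
  by (auto simp: PM_def space_prob_algebra)

lemma PM_prob: "Q \<in> PM \<Longrightarrow> prob_space Q"
  and PM_sets: "Q \<in> PM \<Longrightarrow> sets Q = sets borel"
  by (simp_all add: PM_iff)

lemma PM_space: "Q \<in> PM \<Longrightarrow> space Q = UNIV"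
  using sets_eq_imp_space_eq[OF PM_sets] by simp

lemma PM_measurable: "Q \<in> PM \<Longrightarrow> borel_measurable Q = borel_measurable borel"
  by (rule measurable_cong_sets) (auto simp: PM_sets)

lemma bounded_integrable_PM:
  fixes f :: "'x::topological_space \<Rightarrow> real"
  assumes "Q \<in> PM" "f \<in> borel_measurable borel" "\<And>x. \<bar>f x\<bar> \<le> C"
  shows "integrable Q f"
proof -
  interpret prob_space Q by (rule PM_prob) fact
  show ?thesis
    using assms by (intro integrable_const_bound[where B = C]) (auto simp: PM_measurable)
qed

lemma Cb_integrable: "Q \<in> PM \<Longrightarrow> f \<in> Cb \<Longrightarrow> integrable Q f"
  by (rule bounded_integrable_PM[OF _ Cb_measurable Cb_abs_le])

lemma integral_mono_PM:
  assumes "Q \<in> PM" "f \<in> Cb" "g \<in> Cb" "\<And>x. f x \<le> g x"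
  shows "(\<integral>x. f x \<partial>Q) \<le> (\<integral>x. g x \<partial>Q)"
  using assms by (intro integral_mono Cb_integrable) auto

lemma integral_const_PM [simp]: "Q \<in> PM \<Longrightarrow> (\<integral>x. (c::real) \<partial>Q) = c"
  using prob_space.prob_space[OF PM_prob, of Q] by simp

lemma integral_le_const_PM:
  assumes "Q \<in> PM" "f \<in> borel_measurable borel" "\<And>x. \<bar>f x\<bar> \<le> B" "\<And>x. f x \<le> C"
  shows "(\<integral>x. f x \<partial>Q) \<le> (C::real)"
proof -
  interpret prob_space Q by (rule PM_prob) fact
  have "(\<integral>x. f x \<partial>Q) \<le> (\<integral>x. C \<partial>Q)"
    using assms by (intro integral_mono bounded_integrable_PM[of Q f B]) auto
  then show ?thesis using assms by (simp add: prob_space)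
qed

lemma integral_abs_le_PM:
  assumes "Q \<in> PM" "f \<in> borel_measurable borel" "\<And>x. \<bar>f x\<bar> \<le> C"
  shows "\<bar>\<integral>x. f x \<partial>Q\<bar> \<le> (C::real)"
proof -
  have "(\<integral>x. f x \<partial>Q) \<le> C"
    using assms by (intro integral_le_const_PM[of Q f C]) (auto simp: abs_le_iff)
  moreover have "(\<integral>x. - f x \<partial>Q) \<le> C"
    using assms by (intro integral_le_const_PM[of Q _ C]) (auto simp: abs_le_iff)
  ultimately show ?thesis by simp
qed

lemma Cb_integral_abs_le: "Q \<in> PM \<Longrightarrow> f \<in> Cb \<Longrightarrow> \<bar>\<integral>x. f x \<partial>Q\<bar> \<le> supn f"
  by (rule integral_abs_le_PM[OF _ Cb_measurable Cb_abs_le])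

text \<open>The case distinction is needed because \<^term>\<open>infdist x {} = 0\<close>.\<close>

definition ramp :: "'x::metric_space set \<Rightarrow> nat \<Rightarrow> 'x \<Rightarrow> real" where
  "ramp U n x = (if U = UNIV then 1 else min 1 (real n * infdist x (- U)))"

lemma ramp_bounds: "0 \<le> ramp U n x" "ramp U n x \<le> 1"
  by (auto simp: ramp_def infdist_nonneg)

lemma ramp_Cb [intro]: "ramp U n \<in> Cb"
proof (rule CbI[where C = 1])
  show "continuous_on UNIV (ramp U n)"
    unfolding ramp_def by (cases "U = UNIV") (auto intro!: continuous_intros)
qed (use ramp_bounds[of U n] in auto)

lemma ramp_le_indicator: "ramp U n x \<le> indicator U x"
  by (auto simp: ramp_def indicator_def infdist_nonneg)

lemma ramp_mono: "m \<le> n \<Longrightarrow> ramp U m x \<le> ramp U n x"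
  unfolding ramp_def by (auto simp: infdist_nonneg simp del: min.bounded_iff intro!: min.mono mult_right_mono)

lemma ramp_eventually_1:
  assumes "open U" "x \<in> U" shows "\<forall>\<^sub>F n in sequentially. ramp U n x = 1"
proof (cases "U = UNIV")
  case False
  then have "0 < infdist x (- U)"
    using assms by (intro infdist_pos_not_in_closed) auto
  then obtain N where N: "1 \<le> real N * infdist x (- U)"
    by (metis less_imp_le reals_Archimedean3)
  show ?thesis
    unfolding eventually_sequentially
  proof (intro exI[of _ N] allI impI)
    fix n assume "N \<le> n"
    then have "1 \<le> real n * infdist x (- U)"
      by (intro order_trans[OF N] mult_right_mono) (auto simp: infdist_nonneg)
    then show "ramp U n x = 1" using False by (simp add: ramp_def)
  qed
qed (simp add: ramp_def)

lemma ramp_tendsto: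
  assumes "open U" shows "(\<lambda>n. ramp U n x) \<longlonglongrightarrow> indicator U x"
proof (cases "x \<in> U")
  case True
  then show ?thesis
    using ramp_eventually_1[OF assms True] by (auto intro!: tendsto_eventually simp: eventually_mono)
next
  case False
  have "ramp U n x = 0" for n
    using ramp_le_indicator[of U n x] ramp_bounds[of U n x] False by (auto simp: indicator_def)
  then show ?thesis using False by simp
qed

lemma integral_ramp_tendsto:
  assumes "Q \<in> PM" "open U"
  shows "(\<lambda>n. \<integral>x. ramp U n x \<partial>Q) \<longlonglongrightarrow> measure Q U"
proof -
  interpret prob_space Q by (rule PM_prob) fact
  have U: "U \<in> sets Q" using assms by (simp add: PM_sets)
  have "(\<lambda>n. \<integral>x. ramp U n x \<partial>Q) \<longlonglongrightarrow> (\<integral>x. indicator U x \<partial>Q)"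
  proof (rule integral_dominated_convergence[where w = "\<lambda>_. 1"])
    show "ramp U n \<in> borel_measurable Q" for n
      using ramp_Cb[THEN Cb_measurable, of U n] assms by (simp add: PM_measurable)
    show "AE x in Q. (\<lambda>n. ramp U n x) \<longlonglongrightarrow> indicator U x"
      using ramp_tendsto[OF assms(2)] by simp
    show "AE x in Q. norm (ramp U n x) \<le> 1" for n
      using ramp_bounds[of U n] by simp
  qed (use U in auto)
  then show ?thesis using U by simp
qed

section \<open>Countable families that determine a measure\<close>

definition determining :: "(nat \<Rightarrow> 'x::metric_space \<Rightarrow> real) \<Rightarrow> bool" where
  "determining f \<longleftrightarrow> (\<forall>i. f i \<in> Cb) \<and> (\<forall>i x. 0 \<le> f i x \<and> f i x \<le> 1) \<and>
     (\<exists>G. Int_stable G \<and> (\<forall>U\<in>G. open U) \<and> sets borel = sigma_sets UNIV G \<and> UNIV \<in> G \<and>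
        (\<forall>U\<in>G. \<forall>n. \<exists>i. f i = ramp U n))"

text \<open>Later arguments compare kernels in a weighted l2 norm and need convergence of all means
  off one null set, so the test functions have to be countable in number. The ramps of a countable
  intersection-stable generator suffice, since they increase to the indicators of its
  members.\<close>

lemma ex_determining:
  "\<exists>f :: nat \<Rightarrow> 'x::{metric_space,second_countable_topology} \<Rightarrow> real. determining f"
proof -
  obtain B :: "'x set set" where B: "countable B" "topological_basis B"
    using ex_countable_basis by blast
  \<comment> \<open>Finite intersections of basis sets form a pi-system. The empty family
    contributes \<open>UNIV\<close>, the set of finite measure that the uniqueness theorem for
    measures asks for.\<close>
  define G where "G = (\<lambda>F. \<Inter>F) ` {F. finite F \<and> F \<subseteq> B}"
  have cG: "countable G"
    unfolding G_def by (intro countable_image countable_Collect_finite_subset B)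
  have UG: "UNIV \<in> G"
    unfolding G_def by (rule image_eqI[of _ _ "{}"]) auto
  have oG: "open U" if "U \<in> G" for U
    using that topological_basis_open[OF B(2)] unfolding G_def by (auto intro!: open_Inter)
  have "Int_stable G"
  proof (rule Int_stableI)
    fix a b assume "a \<in> G" "b \<in> G"
    then obtain F1 F2 where "finite F1" "F1 \<subseteq> B" "finite F2" "F2 \<subseteq> B" "a = \<Inter>F1" "b = \<Inter>F2"
      by (auto simp: G_def)
    then show "a \<inter> b \<in> G"
      unfolding G_def by (intro image_eqI[of _ _ "F1 \<union> F2"]) auto
  qed
  have BG: "B \<subseteq> G"
  proof
    fix b assume "b \<in> B"
    then show "b \<in> G" unfolding G_def by (intro image_eqI[of _ _ "{b}"]) auto
  qed
  have sb: "sets borel = sigma_sets UNIV G"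
  proof
    have "sets (borel :: 'x measure) = sigma_sets UNIV B"
      by (simp add: borel_eq_countable_basis[OF B])
    also have "\<dots> \<subseteq> sigma_sets UNIV G" by (rule sigma_sets_mono') (rule BG)
    finally show "sets borel \<subseteq> sigma_sets UNIV G" .
    show "sigma_sets UNIV G \<subseteq> sets borel"
      using sets.sigma_sets_subset[of G "borel :: 'x measure"] oG borel_open by (metis space_borel subsetI)
  qed
  define f where "f = (\<lambda>i. ramp (from_nat_into G (fst (prod_decode i))) (snd (prod_decode i)))"
  have "\<exists>i. f i = ramp U n" if "U \<in> G" for U n
  proof
    show "f (prod_encode (to_nat_on G U, n)) = ramp U n"
      using that cG by (simp add: f_def)
  qed
  then show ?thesis
    unfolding determining_def using \<open>Int_stable G\<close> oG sb UG
    by (intro exI[of _ f] conjI exI[of _ G]) (auto simp: f_def ramp_bounds)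
qed

definition detf :: "nat \<Rightarrow> 'x::{metric_space,second_countable_topology} \<Rightarrow> real" where
  "detf = (SOME f. determining f)"

lemma detf_Cb [simp, intro]: "detf i \<in> Cb"
  and detf_bounds: "0 \<le> detf i x" "detf i x \<le> 1"
  and detf_generator: "\<exists>G. Int_stable G \<and> (\<forall>U\<in>G. open U) \<and> sets borel = sigma_sets UNIV G \<and> UNIV \<in> G \<and>
        (\<forall>U\<in>G. \<forall>n. \<exists>i. detf i = ramp U n)"
  using someI_ex[OF ex_determining, folded detf_def] unfolding determining_def by blast+

lemma PM_eqI:
  fixes Q R :: "'x::{metric_space,second_countable_topology} measure"
  assumes "Q \<in> PM" "R \<in> PM" "\<And>i. (\<integral>x. detf i x \<partial>Q) = (\<integral>x. detf i x \<partial>R)"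
  shows "Q = R"
proof -
  obtain G :: "'x set set" where G: "Int_stable G" "\<And>U. U \<in> G \<Longrightarrow> open U"
    "sets borel = sigma_sets UNIV G" "UNIV \<in> G" "\<And>U n. U \<in> G \<Longrightarrow> \<exists>i. detf i = ramp U n"
    using detf_generator by blast
  interpret Q: prob_space Q by (rule PM_prob) fact
  interpret R: prob_space R by (rule PM_prob) fact
  have eq: "measure Q U = measure R U" if "U \<in> G" for U
  proof (rule LIMSEQ_unique)
    show "(\<lambda>n. \<integral>x. ramp U n x \<partial>Q) \<longlonglongrightarrow> measure Q U"
      using G that assms by (intro integral_ramp_tendsto) auto
    have "(\<lambda>n. \<integral>x. ramp U n x \<partial>R) \<longlonglongrightarrow> measure R U"
      using G that assms by (intro integral_ramp_tendsto) auto
    moreover have "(\<integral>x. ramp U n x \<partial>R) = (\<integral>x. ramp U n x \<partial>Q)" for n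
      using G(5)[OF that, of n] assms(3) by metis
    ultimately show "(\<lambda>n. \<integral>x. ramp U n x \<partial>Q) \<longlonglongrightarrow> measure R U" by simp
  qed
  show ?thesis
  proof (rule measure_eqI_generator_eq[where A = "\<lambda>_. UNIV" and \<Omega> = UNIV and E = G])
    show "emeasure Q X = emeasure R X" if "X \<in> G" for X
      using eq[OF that] by (simp add: Q.emeasure_eq_measure R.emeasure_eq_measure)
  qed (use G assms in \<open>auto simp: PM_sets\<close>)
qed

text \<open>The measure of a set in the generator is a limit of ramp means, and a pi-system
  generator decides measurability into \<open>prob_algebra\<close>. A kernel obtained by choice for
  each point is therefore measurable as soon as its countably many means are.\<close>

lemma measurable_prob_algebraI_detf:
  fixes K :: "'z \<Rightarrow> 'x::{metric_space,second_countable_topology} measure"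
  assumes "\<And>a. a \<in> space M \<Longrightarrow> K a \<in> PM"
    and "\<And>i. (\<lambda>a. \<integral>x. detf i x \<partial>K a) \<in> borel_measurable M"
  shows "K \<in> measurable M (prob_algebra borel)"
proof -
  obtain G :: "'x set set" where G: "Int_stable G" "\<And>U. U \<in> G \<Longrightarrow> open U"
    "sets borel = sigma_sets UNIV G" "UNIV \<in> G" "\<And>U n. U \<in> G \<Longrightarrow> \<exists>i. detf i = ramp U n"
    using detf_generator by blast
  show ?thesis
  proof (rule measurable_prob_algebra_generated[OF G(3,1)])
    fix U assume U: "U \<in> G"
    have "(\<lambda>a. measure (K a) U) \<in> borel_measurable M"
    proof (rule borel_measurable_LIMSEQ_real)
      show "(\<lambda>n. \<integral>x. ramp U n x \<partial>K a) \<longlonglongrightarrow> measure (K a) U" if "a \<in> space M" for a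
        using that assms(1) G(2) U by (intro integral_ramp_tendsto) auto
      show "(\<lambda>a. \<integral>x. ramp U n x \<partial>K a) \<in> borel_measurable M" for n
        using G(5)[OF U, of n] assms(2) by metis
    qed
    then have "(\<lambda>a. ennreal (measure (K a) U)) \<in> borel_measurable M" by simp
    then show "(\<lambda>a. emeasure (K a) U) \<in> borel_measurable M"
    proof (rule measurable_cong[THEN iffD1, rotated])
      fix a assume "a \<in> space M"
      then interpret prob_space "K a" using assms(1) PM_prob by blast
      show "ennreal (measure (K a) U) = emeasure (K a) U" by (simp add: emeasure_eq_measure)
    qed
  qed (use assms(1) in \<open>auto simp: PM_prob PM_sets\<close>)
qed

lemma measurable_integral_prob_algebra:
  fixes f :: "'x::topological_space \<Rightarrow> real"
  assumes "K \<in> measurable M (prob_algebra borel)" "f \<in> Cb"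
  shows "(\<lambda>a. \<integral>x. f x \<partial>K a) \<in> borel_measurable M"
proof -
  have "(\<lambda>Q. \<integral>x. f x \<partial>Q) \<in> borel_measurable (subprob_algebra borel)"
    using Cb_measurable[OF assms(2)] by measurable
  then show ?thesis
    using measurable_compose[OF measurable_prob_algebraD[OF assms(1)]] by blast
qed

section \<open>Daniell representation\<close>

definition linear_on_Cb :: "(('x::topological_space \<Rightarrow> real) \<Rightarrow> real) \<Rightarrow> bool" where
  "linear_on_Cb \<Lambda> \<longleftrightarrow> (\<forall>f\<in>Cb. \<forall>g\<in>Cb. \<Lambda> (\<lambda>x. f x + g x) = \<Lambda> f + \<Lambda> g) \<and>
     (\<forall>f\<in>Cb. \<forall>c. \<Lambda> (\<lambda>x. c * f x) = c * \<Lambda> f)"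

lemma linear_on_CbD:
  assumes "linear_on_Cb \<Lambda>"
  shows "f \<in> Cb \<Longrightarrow> g \<in> Cb \<Longrightarrow> \<Lambda> (\<lambda>x. f x + g x) = \<Lambda> f + \<Lambda> g"
    and "f \<in> Cb \<Longrightarrow> \<Lambda> (\<lambda>x. c * f x) = c * \<Lambda> f"
  using assms by (auto simp: linear_on_Cb_def)

lemma linear_on_Cb_minus:
  assumes "linear_on_Cb \<Lambda>" "f \<in> Cb" shows "\<Lambda> (\<lambda>x. - f x) = - \<Lambda> f"
  using linear_on_CbD(2)[OF assms, of "-1"] by simp

lemma linear_on_Cb_diff:
  assumes "linear_on_Cb \<Lambda>" "f \<in> Cb" "g \<in> Cb" shows "\<Lambda> (\<lambda>x. f x - g x) = \<Lambda> f - \<Lambda> g"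
  using linear_on_CbD(1)[OF assms(1,2) Cb_minus[OF assms(3)]] linear_on_Cb_minus[OF assms(1,3)]
  by simp

lemma linear_on_Cb_zero:
  assumes "linear_on_Cb \<Lambda>" shows "\<Lambda> (\<lambda>x. 0) = 0"
  using linear_on_CbD(2)[OF assms Cb_const, of 0 0] by simp

lemma linear_on_Cb_sum:
  assumes "linear_on_Cb \<Lambda>" "\<And>i. i \<in> I \<Longrightarrow> f i \<in> Cb"
  shows "\<Lambda> (\<lambda>x. \<Sum>i\<in>I. f i x) = (\<Sum>i\<in>I. \<Lambda> (f i))"
  using assms(2)
proof (induction I rule: infinite_finite_induct)
  case (insert i I)
  then show ?case
    using linear_on_CbD(1)[OF assms(1), of "f i" "\<lambda>x. \<Sum>i\<in>I. f i x"] by (auto simp: Cb_sum)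
qed (use linear_on_Cb_zero[OF assms(1)] in auto)

lemma linear_on_Cb_integral: "Q \<in> PM \<Longrightarrow> linear_on_Cb (\<lambda>f. \<integral>x. f x \<partial>Q)"
  by (auto simp: linear_on_Cb_def intro!: Bochner_Integration.integral_add Cb_integrable)

locale daniell =
  fixes \<Lambda> :: "('x::metric_space \<Rightarrow> real) \<Rightarrow> real"
  assumes lin: "linear_on_Cb \<Lambda>"
    and nonneg: "f \<in> Cb \<Longrightarrow> (\<And>x. 0 \<le> f x) \<Longrightarrow> 0 \<le> \<Lambda> f"
    and one: "\<Lambda> (\<lambda>_. 1) = 1"
    and smooth: "(\<And>n. F n \<in> Cb) \<Longrightarrow> (\<And>x. decseq (\<lambda>n. F n x)) \<Longrightarrow> (\<And>x. (\<lambda>n. F n x) \<longlonglongrightarrow> 0) \<Longrightarrow>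
      (\<lambda>n. \<Lambda> (F n)) \<longlonglongrightarrow> 0"
begin

lemma mono:
  assumes "f \<in> Cb" "g \<in> Cb" "\<And>x. f x \<le> g x" shows "\<Lambda> f \<le> \<Lambda> g"
  using nonneg[of "\<lambda>x. g x - f x"] linear_on_Cb_diff[OF lin assms(2,1)] assms by auto

lemma const: "\<Lambda> (\<lambda>_. c) = c"
  using linear_on_CbD(2)[OF lin, of "\<lambda>_. 1" c] one by simp

text \<open>Functions are bounded by the indicator of \<open>U\<close> instead of being compactly
  supported in it, since the space need not be locally compact; \<open>smooth\<close> stands in for
  compactness in \<open>content_UN_le\<close>.\<close>

definition below :: "'x set \<Rightarrow> ('x \<Rightarrow> real) set" where
  "below U = {f \<in> Cb. \<forall>x. 0 \<le> f x \<and> f x \<le> indicator U x}"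

definition content :: "'x set \<Rightarrow> ennreal" where
  "content U = (SUP f\<in>below U. ennreal (\<Lambda> f))"

definition outer :: "'x set \<Rightarrow> ennreal" where
  "outer A = (INF U\<in>{U. open U \<and> A \<subseteq> U}. content U)"

lemma zero_below: "(\<lambda>_. 0) \<in> below U"
  by (auto simp: below_def)

lemma below_Cb: "f \<in> below U \<Longrightarrow> f \<in> Cb"
  by (simp add: below_def)

lemma below_bounds: "f \<in> below U \<Longrightarrow> 0 \<le> f x" "f \<in> below U \<Longrightarrow> f x \<le> indicator U x"
  "f \<in> below U \<Longrightarrow> f x \<le> 1"
  by (auto simp: below_def intro: order_trans indicator_le_1)

lemma content_upper: "f \<in> below U \<Longrightarrow> ennreal (\<Lambda> f) \<le> content U"
  unfolding content_def by (rule SUP_upper)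

lemma content_mono: "U \<subseteq> V \<Longrightarrow> content U \<le> content V"
  unfolding content_def
proof (rule SUP_subset_mono)
  assume "U \<subseteq> V"
  then have "indicator U x \<le> (indicator V x :: real)" for x by (auto split: split_indicator)
  then show "below U \<subseteq> below V" unfolding below_def by (blast intro: order_trans)
qed simp

lemma content_empty: "content {} = 0"
proof -
  have "f = (\<lambda>_. 0)" if "f \<in> below {}" for f
    using below_bounds[OF that] by (auto simp: fun_eq_iff intro: antisym)
  then have "ennreal (\<Lambda> f) = 0" if "f \<in> below {}" for f
    using that linear_on_Cb_zero[OF lin] by fastforce
  then show ?thesis
    unfolding content_def by (auto simp: bot_ennreal[symmetric] SUP_eq_const)
qed

lemma content_UNIV: "content UNIV = 1"
proof (rule antisym)
  show "content UNIV \<le> 1"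
    unfolding content_def
  proof (rule SUP_least)
    fix f assume "f \<in> below UNIV"
    then have "\<Lambda> f \<le> \<Lambda> (\<lambda>_. 1)"
      by (intro mono) (auto simp: below_Cb below_bounds)
    then show "ennreal (\<Lambda> f) \<le> 1" by (simp add: one)
  qed
  show "1 \<le> content UNIV"
    using content_upper[of "\<lambda>_. 1" UNIV] by (simp add: one below_def)
qed

text \<open>Here \<open>smooth\<close> acts: the excess of a function over the partial sums of ramps
  decreases pointwise to 0, so \<open>\<Lambda>\<close> of the excess tends to 0, while the partial
  sums are controlled by the contents of the single sets.\<close>

lemma content_UN_le:
  assumes "\<And>i::nat. open (U i)"
  shows "content (\<Union>i. U i) \<le> (\<Sum>i. content (U i))"
  unfolding content_def[of "\<Union>i. U i"]
proof (rule SUP_least)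
  fix f assume f: "f \<in> below (\<Union>i. U i)"
  \<comment> \<open>The index n both lengthens the sum and steepens the ramps, so that one sequence
    exhausts the whole union.\<close>
  define s where "s = (\<lambda>n x. \<Sum>i<n. ramp (U i) n x)"
  define F where "F = (\<lambda>n x. f x - min (f x) (s n x))"
  have s_Cb: "s n \<in> Cb" for n unfolding s_def by (intro Cb_sum ramp_Cb)
  have F_Cb: "F n \<in> Cb" for n
    unfolding F_def using below_Cb[OF f] s_Cb[of n] by (intro Cb_diff Cb_min) auto
  have s_mono: "s m x \<le> s n x" if "m \<le> n" for m n x
  proof -
    have "s m x \<le> (\<Sum>i<m. ramp (U i) n x)"
      unfolding s_def by (intro sum_mono ramp_mono that)
    also have "\<dots> \<le> s n x"
      unfolding s_def using that by (intro sum_mono2) (auto simp: ramp_bounds)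
    finally show ?thesis .
  qed
  have "(\<lambda>n. \<Lambda> (F n)) \<longlonglongrightarrow> 0"
  proof (rule smooth[OF F_Cb])
    show "decseq (\<lambda>n. F n x)" for x
      unfolding F_def using s_mono[of _ _ x] by (fastforce simp: decseq_def min_def)
    show "(\<lambda>n. F n x) \<longlonglongrightarrow> 0" for x
    proof (cases "x \<in> (\<Union>i. U i)")
      case True
      then obtain i where "x \<in> U i" by auto
      then have "\<forall>\<^sub>F n in sequentially. ramp (U i) n x = 1"
        using assms by (intro ramp_eventually_1) auto
      then have "\<forall>\<^sub>F n in sequentially. F n x = 0"
        using eventually_gt_at_top[of i]
      proof eventually_elim
        fix n assume n: "ramp (U i) n x = 1" "i < n"
        have "ramp (U i) n x \<le> s n x"
          unfolding s_def using n by (intro member_le_sum) (auto simp: ramp_bounds)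
        then show "F n x = 0" using n below_bounds(3)[OF f, of x] by (simp add: F_def)
      qed
      then show ?thesis by (rule tendsto_eventually)
    next
      case False
      then have "f x = 0" using below_bounds(1,2)[OF f, of x] by (simp add: indicator_def)
      moreover have "0 \<le> s n x" for n by (auto simp: s_def ramp_bounds intro!: sum_nonneg)
      ultimately have "F n x = 0" for n by (simp add: F_def)
      then show ?thesis by simp
    qed
  qed
  then have "(\<lambda>n. ennreal (\<Lambda> (F n)) + (\<Sum>i. content (U i))) \<longlonglongrightarrow> ennreal 0 + (\<Sum>i. content (U i))"
    by (intro tendsto_add tendsto_ennrealI tendsto_const)
  moreover have "ennreal (\<Lambda> f) \<le> ennreal (\<Lambda> (F n)) + (\<Sum>i. content (U i))" for n
  proof -
    have FL: "\<Lambda> f = \<Lambda> (F n) + \<Lambda> (\<lambda>x. min (f x) (s n x))"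
      using linear_on_CbD(1)[OF lin F_Cb[of n] Cb_min[OF below_Cb[OF f] s_Cb[of n]]]
      by (simp add: F_def)
    have F0: "0 \<le> \<Lambda> (F n)" by (rule nonneg[OF F_Cb]) (simp add: F_def)
    have "\<Lambda> (\<lambda>x. min (f x) (s n x)) \<le> \<Lambda> (s n)"
      using below_Cb[OF f] s_Cb[of n] by (intro mono) auto
    also have "\<dots> = (\<Sum>i<n. \<Lambda> (ramp (U i) n))"
      unfolding s_def by (rule linear_on_Cb_sum[OF lin]) auto
    finally have "ennreal (\<Lambda> f) \<le> ennreal (\<Lambda> (F n) + (\<Sum>i<n. \<Lambda> (ramp (U i) n)))"
      by (intro ennreal_leI) (simp add: FL)
    also have "\<dots> = ennreal (\<Lambda> (F n)) + (\<Sum>i<n. ennreal (\<Lambda> (ramp (U i) n)))"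
      using F0 nonneg[OF ramp_Cb] by (subst ennreal_plus) (auto simp: ramp_bounds sum_nonneg)
    also have "(\<Sum>i<n. ennreal (\<Lambda> (ramp (U i) n))) \<le> (\<Sum>i<n. content (U i))"
      by (intro sum_mono content_upper) (auto simp: below_def ramp_bounds ramp_le_indicator)
    also have "\<dots> \<le> (\<Sum>i. content (U i))" by (rule sum_le_suminf) auto
    finally show ?thesis by (simp add: add_left_mono)
  qed
  ultimately show "ennreal (\<Lambda> f) \<le> (\<Sum>i. content (U i))"
    using LIMSEQ_le_const by force
qed

lemma outer_open: "open U \<Longrightarrow> outer U = content U"
  unfolding outer_def by (rule antisym) (auto intro: INF_lower INF_greatest content_mono)

lemma outer_mono: "A \<subseteq> B \<Longrightarrow> outer A \<le> outer B"
  unfolding outer_def by (rule INF_superset_mono) auto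

lemma outer_UN_le: "outer (\<Union>i. A i) \<le> (\<Sum>i::nat. outer (A i))"
proof (rule ennreal_le_epsilon)
  fix e :: real assume e: "0 < e" and fin: "(\<Sum>i. outer (A i)) < top"
  have "\<exists>U. open U \<and> A i \<subseteq> U \<and> content U \<le> outer (A i) + ennreal (e * (1/2)^Suc i)" for i
  proof -
    have "outer (A i) < outer (A i) + ennreal (e * (1/2)^Suc i)"
      using fin e by (auto simp: less_top dest!: ennreal_suminf_lessD)
    then obtain U where "open U" "A i \<subseteq> U" "content U < outer (A i) + ennreal (e * (1/2)^Suc i)"
      unfolding outer_def[of "A i"] INF_less_iff by auto
    then show ?thesis by (intro exI[of _ U]) auto
  qed
  then obtain U where U: "\<And>i. open (U i)" "\<And>i. A i \<subseteq> U i"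
      "\<And>i. content (U i) \<le> outer (A i) + ennreal (e * (1/2)^Suc i)"
    by metis
  have "outer (\<Union>i. A i) \<le> content (\<Union>i. U i)"
    unfolding outer_def using U by (intro INF_lower) auto
  also have "\<dots> \<le> (\<Sum>i. content (U i))" by (rule content_UN_le) (rule U)
  also have "\<dots> \<le> (\<Sum>i. outer (A i) + ennreal (e * (1/2)^Suc i))"
    by (intro suminf_le U) auto
  also have "\<dots> = (\<Sum>i. outer (A i)) + (\<Sum>i. ennreal (e * (1/2)^Suc i))"
    by (rule suminf_add[symmetric]) auto
  also have "(\<Sum>i. ennreal (e * (1/2)^Suc i)) = ennreal e"
    using sums_mult[OF power_half_series, of e] e
    by (intro suminf_ennreal_eq) auto
  finally show "outer (\<Union>i. A i) \<le> (\<Sum>i. outer (A i)) + ennreal e" .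
qed

lemma outer_measure_space_outer: "outer_measure_space (Pow UNIV) outer"
  unfolding outer_measure_space_def positive_def increasing_def countably_subadditive_def
  using outer_mono outer_UN_le by (auto simp: outer_open content_empty)

text \<open>Caratheodory's condition for an open set, tested on open sets. A function below the
  intersection may be positive arbitrarily close to \<open>V - U\<close>; cutting it off at height e
  makes room for any function below an open set that contains \<open>V - U\<close>.\<close>

lemma open_split:
  assumes "open U" "open V"
  shows "outer (V \<inter> U) + outer (V - U) \<le> content V"
proof -
  have *: "ennreal (\<Lambda> f) + outer (V - U) \<le> content V" if f: "f \<in> below (V \<inter> U)" for f
  proof (rule ennreal_le_epsilon)
    fix e :: real assume e: "0 < e"
    define f' where "f' = (\<lambda>x. max (f x - e) 0)"
    have f'_Cb: "f' \<in> Cb" unfolding f'_def using below_Cb[OF f] by (intro Cb_max Cb_diff) auto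
    \<comment> \<open>\<open>f'\<close> vanishes on \<open>W\<close>, so adding a function below
      \<open>W\<close> to it gives a function below \<open>V\<close>.\<close>
    define W where "W = V \<inter> {x. f x < e}"
    have "open W"
      unfolding W_def using assms Cb_cont[OF below_Cb[OF f]]
      by (intro open_Int open_Collect_less) auto
    have "V - U \<subseteq> W"
    proof
      fix x assume "x \<in> V - U"
      then show "x \<in> W" using below_bounds(2)[OF f, of x] e by (auto simp: W_def indicator_def)
    qed
    have "\<Lambda> f \<le> \<Lambda> (\<lambda>x. f' x + e)"
      using f'_Cb below_Cb[OF f] by (intro mono) (auto simp: f'_def)
    then have le: "\<Lambda> f \<le> \<Lambda> f' + e"
      using linear_on_CbD(1)[OF lin f'_Cb, of "\<lambda>_. e"] by (simp add: const)
    have f'0: "0 \<le> \<Lambda> f'" by (rule nonneg[OF f'_Cb]) (simp add: f'_def)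
    have "ennreal (\<Lambda> f') + ennreal (\<Lambda> g) \<le> content V" if g: "g \<in> below W" for g
    proof -
      have "ennreal (\<Lambda> f') + ennreal (\<Lambda> g) = ennreal (\<Lambda> (\<lambda>x. f' x + g x))"
        using f'0 linear_on_CbD(1)[OF lin f'_Cb below_Cb[OF g]] nonneg[OF below_Cb[OF g]]
          below_bounds[OF g] by simp
      also have "\<dots> \<le> content V"
      proof (rule content_upper)
        have "0 \<le> f' x + g x \<and> f' x + g x \<le> indicator V x" for x
          using below_bounds[OF g, of x] below_bounds[OF f, of x] e
          by (auto simp: f'_def W_def indicator_def max_def split: if_splits)
        then show "(\<lambda>x. f' x + g x) \<in> below V"
          using f'_Cb below_Cb[OF g] by (auto simp: below_def)
      qed
      finally show ?thesis .
    qed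
    then have "(SUP g\<in>below W. ennreal (\<Lambda> g) + ennreal (\<Lambda> f')) \<le> content V"
      by (intro SUP_least) (simp add: add.commute)
    then have *: "ennreal (\<Lambda> f') + content W \<le> content V"
      unfolding content_def[of W] using zero_below[of W]
      by (subst (asm) ennreal_SUP_add_left) (auto simp: add.commute)
    have "ennreal (\<Lambda> f) + outer (V - U) \<le> ennreal (\<Lambda> f' + e) + content W"
      using le \<open>open W\<close> \<open>V - U \<subseteq> W\<close> outer_mono[of "V - U" W]
      by (intro add_mono ennreal_leI) (auto simp: outer_open)
    also have "\<dots> = (ennreal (\<Lambda> f') + content W) + ennreal e"
      using f'0 e by (simp add: ennreal_plus ac_simps)
    also have "\<dots> \<le> content V + ennreal e" using * by (rule add_right_mono)
    finally show "ennreal (\<Lambda> f) + outer (V - U) \<le> content V + ennreal e" .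
  qed
  have "outer (V \<inter> U) + outer (V - U) = (SUP f\<in>below (V \<inter> U). ennreal (\<Lambda> f) + outer (V - U))"
    using assms zero_below[of "V \<inter> U"]
    by (subst ennreal_SUP_add_left) (auto simp: outer_open content_def open_Int)
  also have "\<dots> \<le> content V" using * by (intro SUP_least)
  finally show ?thesis .
qed

lemma open_in_lambda_system:
  assumes "open U" shows "U \<in> lambda_system UNIV (Pow UNIV) outer"
proof -
  have "outer (A \<inter> U) + outer (A - U) = outer A" for A
  proof (rule antisym)
    show "outer (A \<inter> U) + outer (A - U) \<le> outer A"
      unfolding outer_def[of A]
    proof (rule INF_greatest)
      fix V assume V: "V \<in> {V. open V \<and> A \<subseteq> V}"
      then have "outer (A \<inter> U) + outer (A - U) \<le> outer (V \<inter> U) + outer (V - U)"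
        by (intro add_mono outer_mono) auto
      also have "\<dots> \<le> content V" using V assms by (intro open_split) auto
      finally show "outer (A \<inter> U) + outer (A - U) \<le> content V" .
    qed
    define B where "B = (\<lambda>i::nat. if i = 0 then A \<inter> U else if i = 1 then A - U else {})"
    have "outer A = outer (\<Union>i. B i)"
      by (rule arg_cong[where f = outer]) (auto simp: B_def split: if_splits)
    also have "\<dots> \<le> (\<Sum>i. outer (B i))" by (rule outer_UN_le)
    also have "\<dots> = (\<Sum>i\<in>{0,1}. outer (B i))"
      by (rule suminf_finite) (auto simp: B_def outer_open content_empty)
    also have "\<dots> = outer (A \<inter> U) + outer (A - U)" by (simp add: B_def)
    finally show "outer A \<le> outer (A \<inter> U) + outer (A - U)" .
  qed
  moreover have "algebra (UNIV :: 'x set) (Pow UNIV)"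
    using sigma_algebra_Pow sigma_algebra.axioms(1) by blast
  ultimately show ?thesis by (simp add: algebra.lambda_system_eq)
qed

definition rep :: "'x measure" where
  "rep = measure_of UNIV (sets borel) outer"

lemma rep_sets: "sets rep = sets borel"
  unfolding rep_def by (rule sigma_algebra.sets_measure_of_eq) (metis sets.sigma_algebra_axioms space_borel)

lemma rep_emeasure:
  assumes "A \<in> sets borel" shows "emeasure rep A = outer A"
proof -
  interpret P: sigma_algebra UNIV "Pow UNIV :: 'x set set" by (rule sigma_algebra_Pow)
  have ms: "measure_space UNIV (lambda_system UNIV (Pow UNIV) outer) outer"
    by (rule P.caratheodory_lemma[OF outer_measure_space_outer])
  then interpret L: sigma_algebra UNIV "lambda_system UNIV (Pow UNIV) outer"
    by (simp add: measure_space_def)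
  have sub: "sets borel \<subseteq> lambda_system UNIV (Pow UNIV) outer"
    unfolding sets_borel by (rule L.sigma_sets_subset) (use open_in_lambda_system in blast)
  show ?thesis
    unfolding rep_def
  proof (rule emeasure_measure_of_sigma[OF _ _ _ assms])
    show "sigma_algebra UNIV (sets (borel :: 'x measure))"
      by (metis sets.sigma_algebra_axioms space_borel)
    show "positive (sets borel) outer"
      using outer_measure_space_outer by (auto simp: outer_measure_space_def positive_def)
    show "countably_additive (sets borel) outer"
      using ms sub unfolding measure_space_def countably_additive_def by (meson subset_trans subsetD)
  qed
qed

lemma rep_PM: "rep \<in> PM"
proof -
  have "emeasure rep (space rep) = 1"
    using rep_emeasure[of UNIV] sets_eq_imp_space_eq[OF rep_sets]
    by (simp add: outer_open content_UNIV)
  then show ?thesis by (simp add: PM_iff rep_sets prob_spaceI)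
qed

text \<open>A layer-cake argument in one direction: each of N slices of height 1/N, multiplied by N,
  lies below an open superlevel set, where \<open>content_upper\<close> bounds
  \<open>\<Lambda>\<close>. The converse inequality comes from \<open>1 - f\<close> in
  \<open>eq_integral\<close>.\<close>

lemma le_integral_unit:
  assumes f: "f \<in> Cb" "\<And>x. 0 \<le> f x" "\<And>x. f x \<le> 1"
  shows "\<Lambda> f \<le> (\<integral>x. f x \<partial>rep)"
proof (rule field_le_epsilon)
  interpret prob_space rep using rep_PM by (rule PM_prob)
  fix e :: real assume "0 < e"
  then obtain m where m: "1 / real (Suc m) < e" using nat_approx_posE by metis
  define N where "N = real (Suc m)"
  have N: "N > 0" by (simp add: N_def)
  \<comment> \<open>\<open>\<phi> i (f x)\<close> is the part of f x between the heights i/N and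
    (i+1)/N.\<close>
  define \<phi> where "\<phi> = (\<lambda>i t. max 0 (min (t - real i / N) (1 / N)))"
  have sum_\<phi>: "(\<Sum>i<k. \<phi> i t) = min t (real k / N)" if "0 \<le> t" for k t
  proof (induction k)
    case (Suc k)
    have "real (Suc k) / N = real k / N + 1 / N" by (simp add: add_divide_distrib)
    moreover have "min t a + max 0 (min (t - a) d) = min t (a + d)" if "0 < d" for a d :: real
      using that by linarith
    ultimately show ?case using Suc N by (simp add: \<phi>_def)
  qed (use that in simp)
  define O' where "O' = (\<lambda>i::nat. {x. real i / N < f x})"
  have oO: "open (O' i)" for i
    unfolding O'_def using Cb_cont[OF f(1)] by (intro open_Collect_less) auto
  have \<phi>_Cb: "(\<lambda>x. \<phi> i (f x)) \<in> Cb" for i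
    unfolding \<phi>_def using f(1) by (intro Cb_max Cb_min Cb_diff) auto
  have \<Lambda>\<phi>: "\<Lambda> (\<lambda>x. \<phi> i (f x)) \<le> (1 / N) * measure rep (O' i)" for i
  proof -
    have "0 \<le> N * \<phi> i (f x) \<and> N * \<phi> i (f x) \<le> indicator (O' i) x" for x
    proof (cases "x \<in> O' i")
      case True
      have "0 \<le> \<phi> i (f x)" "\<phi> i (f x) \<le> 1 / N" using N by (auto simp: \<phi>_def)
      then show ?thesis using N True by (auto simp: field_simps)
    next
      case False
      then have "\<phi> i (f x) = 0" using N by (auto simp: \<phi>_def O'_def)
      then show ?thesis by simp
    qed
    then have "(\<lambda>x. N * \<phi> i (f x)) \<in> below (O' i)"
      using \<phi>_Cb[of i] by (auto simp: below_def)
    then have "ennreal (\<Lambda> (\<lambda>x. N * \<phi> i (f x))) \<le> emeasure rep (O' i)"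
      using content_upper oO rep_emeasure[of "O' i"] by (simp add: outer_open)
    then have "\<Lambda> (\<lambda>x. N * \<phi> i (f x)) \<le> measure rep (O' i)"
      by (simp add: emeasure_eq_measure)
    then show ?thesis using N linear_on_CbD(2)[OF lin \<phi>_Cb] by (simp add: field_simps)
  qed
  have O_int: "integrable rep (\<lambda>x. (1 / N) * indicator (O' i) x)" for i
    using oO by (intro integrable_mult_right) (auto simp: rep_sets fmeasurable_def less_top[symmetric]
       intro!: integrable_real_indicator)
  have "(\<Sum>i<Suc m. \<phi> i (f x)) = f x" for x
    using sum_\<phi>[OF f(2)[of x], of "Suc m"] f(3)[of x]
    by (simp add: N_def min_def del: sum.lessThan_Suc of_nat_Suc)
  then have "\<Lambda> f = \<Lambda> (\<lambda>x. \<Sum>i<Suc m. \<phi> i (f x))"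
    by (simp del: sum.lessThan_Suc)
  also have "\<dots> = (\<Sum>i<Suc m. \<Lambda> (\<lambda>x. \<phi> i (f x)))"
    by (rule linear_on_Cb_sum[OF lin \<phi>_Cb])
  also have "\<dots> \<le> (\<Sum>i<Suc m. (1 / N) * measure rep (O' i))"
    by (intro sum_mono \<Lambda>\<phi>)
  also have "\<dots> = (\<Sum>i<Suc m. \<integral>x. (1 / N) * indicator (O' i) x \<partial>rep)"
    using oO by (intro sum.cong) (auto simp: rep_sets)
  also have "\<dots> = (\<integral>x. (\<Sum>i<Suc m. (1 / N) * indicator (O' i) x) \<partial>rep)"
    by (rule Bochner_Integration.integral_sum[symmetric]) (rule O_int)
  also have "\<dots> \<le> (\<integral>x. f x + 1 / N \<partial>rep)"
  proof (rule integral_mono)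
    show "integrable rep (\<lambda>x. \<Sum>i<Suc m. (1 / N) * indicator (O' i) x :: real)"
      by (intro Bochner_Integration.integrable_sum O_int)
    show "integrable rep (\<lambda>x. f x + 1 / N)"
      using rep_PM f(1) by (intro Cb_integrable) auto
    fix x
    \<comment> \<open>Slice i is full on the superlevel set with index \<open>Suc i\<close>, so
      shifting the index by one costs only the first term, at most 1/N.\<close>
    have "(\<Sum>i<Suc m. (1 / N) * indicator (O' i) x)
        = (1 / N) * indicator (O' 0) x + (\<Sum>i<m. (1 / N) * indicator (O' (Suc i)) x :: real)"
      by (rule sum.lessThan_Suc_shift)
    also have "\<dots> \<le> 1 / N + (\<Sum>i<m. \<phi> i (f x))"
    proof (intro add_mono sum_mono)
      show "(1 / N) * indicator (O' 0) x \<le> 1 / N" using N by (simp add: indicator_def)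
      fix i
      show "(1 / N) * indicator (O' (Suc i)) x \<le> \<phi> i (f x)"
        using N by (auto simp: indicator_def O'_def \<phi>_def add_divide_distrib max_def min_def)
    qed
    also have "\<dots> \<le> f x + 1 / N" using sum_\<phi>[OF f(2)[of x], of m] by simp
    finally show "(\<Sum>i<Suc m. (1 / N) * indicator (O' i) x) \<le> f x + 1 / N" .
  qed
  also have "\<dots> = (\<integral>x. f x \<partial>rep) + 1 / N"
    using rep_PM Cb_integrable[OF rep_PM f(1)] by (subst Bochner_Integration.integral_add) (auto simp: prob_space)
  finally show "\<Lambda> f \<le> (\<integral>x. f x \<partial>rep) + e" using m by (simp add: N_def)
qed

lemma eq_integral:
  assumes f: "f \<in> Cb" shows "\<Lambda> f = (\<integral>x. f x \<partial>rep)"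
proof -
  interpret prob_space rep using rep_PM by (rule PM_prob)
  define C where "C = supn f"
  have C: "0 \<le> C" using supn_nonneg[OF f] by (simp add: C_def)
  have fC: "\<bar>f x\<bar> \<le> C" for x using Cb_abs_le[OF f] by (simp add: C_def)
  \<comment> \<open>Affine rescaling into the unit interval; the + 1 keeps the divisor positive when
    C is 0.\<close>
  define g where "g = (\<lambda>x. (1 / (2 * C + 1)) * (f x + C))"
  have g: "g \<in> Cb" unfolding g_def using f by (intro Cb_scale Cb_add) auto
  have g01: "0 \<le> g x" "g x \<le> 1" for x
    using fC[of x] C by (auto simp: g_def field_simps)
  have "\<Lambda> g \<le> (\<integral>x. g x \<partial>rep)" by (rule le_integral_unit[OF g g01])
  moreover have "\<Lambda> (\<lambda>x. 1 - g x) \<le> (\<integral>x. 1 - g x \<partial>rep)"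
    using g g01 by (intro le_integral_unit) auto
  then have "1 - \<Lambda> g \<le> 1 - (\<integral>x. g x \<partial>rep)"
    using linear_on_Cb_diff[OF lin _ g, of "\<lambda>_. 1"] Cb_integrable[OF rep_PM g] rep_PM
    by (simp add: const Bochner_Integration.integral_diff prob_space)
  ultimately have eq: "\<Lambda> g = (\<integral>x. g x \<partial>rep)" by simp
  have f_eq: "f = (\<lambda>x. (2 * C + 1) * g x + (- C))"
    using C by (auto simp: g_def fun_eq_iff)
  have "\<Lambda> f = (2 * C + 1) * \<Lambda> g - C"
    by (subst f_eq, subst linear_on_CbD(1)[OF lin Cb_scale[OF g]])
      (auto simp: linear_on_CbD(2)[OF lin g] const)
  also have "\<dots> = (\<integral>x. f x \<partial>rep)"
    using eq Cb_integrable[OF rep_PM g] rep_PM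
    by (subst f_eq) (simp add: Bochner_Integration.integral_add prob_space)
  finally show ?thesis .
qed

end

text \<open>The bound \<open>\<Lambda> \<le> p + a\<close> may be used on all multiples of a function, so the constant \<open>a\<close>
  scales away and \<open>\<Lambda>\<close> inherits positivity, normalisation and \<open>\<sigma>\<close>-smoothness from \<open>p\<close>.\<close>

definition dini_functional :: "(('x::topological_space \<Rightarrow> real) \<Rightarrow> real) \<Rightarrow> bool" where
  "dini_functional p \<longleftrightarrow> (\<forall>h\<in>Cb. \<forall>c. (\<forall>x. h x \<le> c) \<longrightarrow> p h \<le> c) \<and>
     (\<forall>F. (\<forall>n. F n \<in> Cb) \<longrightarrow> (\<forall>x. decseq (\<lambda>n. F n x)) \<longrightarrow> (\<forall>x. (\<lambda>n. F n x) \<longlonglongrightarrow> 0) \<longrightarrow>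
        (\<lambda>n. p (F n)) \<longlonglongrightarrow> (0::real))"

theorem dominated_functional_representation:
  fixes \<Lambda> :: "('x::metric_space \<Rightarrow> real) \<Rightarrow> real"
  assumes lin: "linear_on_Cb \<Lambda>" and p: "dini_functional p"
    and dom: "\<And>h. h \<in> Cb \<Longrightarrow> \<Lambda> h \<le> p h + a"
  shows "\<exists>Q\<in>PM. \<forall>f\<in>Cb. \<Lambda> f = (\<integral>x. f x \<partial>Q)"
proof -
  have pc: "p h \<le> c" if "h \<in> Cb" "\<And>x. h x \<le> c" for h c
    using p that by (auto simp: dini_functional_def)
  have a0: "0 \<le> a"
    using dom[of "\<lambda>_. 0"] pc[of "\<lambda>_. 0" 0] linear_on_Cb_zero[OF lin] by simp
  have scaled: "\<Lambda> h \<le> (p (\<lambda>x. t * h x) + a) / t" if "h \<in> Cb" "0 < t" for h t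
    using dom[OF Cb_scale[OF that(1)], of t] linear_on_CbD(2)[OF lin that(1)] that(2)
    by (simp add: field_simps)
  have le_const: "\<Lambda> h \<le> c" if h: "h \<in> Cb" "\<And>x. h x \<le> c" for h c
  proof (rule field_le_epsilon)
    fix e :: real assume e: "0 < e"
    \<comment> \<open>Applying the domination to \<open>t * h\<close> divides a by t; a + 1 in place
      of a keeps t positive when a is 0.\<close>
    define t where "t = (a + 1) / e"
    have t: "0 < t" using a0 e by (simp add: t_def)
    have "p (\<lambda>x. t * h x) \<le> t * c" using h t by (intro pc) auto
    then have "\<Lambda> h \<le> (t * c + a) / t"
      using scaled[OF h(1) t] t by (meson add_right_mono divide_right_mono less_imp_le order_trans)
    also have "\<dots> = c + a / t" using t by (simp add: field_simps)
    also have "a / t \<le> e" using a0 e by (simp add: t_def field_simps)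
    finally show "\<Lambda> h \<le> c + e" by simp
  qed
  interpret daniell \<Lambda>
  proof
    show "linear_on_Cb \<Lambda>" by (rule lin)
    show "0 \<le> \<Lambda> f" if "f \<in> Cb" "\<And>x. 0 \<le> f x" for f
      using le_const[of "\<lambda>x. - f x" 0] linear_on_Cb_minus[OF lin that(1)] that by auto
    show "\<Lambda> (\<lambda>_. 1) = 1"
      using le_const[of "\<lambda>_. 1" 1] le_const[of "\<lambda>_. -1" "-1"] linear_on_Cb_minus[OF lin, of "\<lambda>_. 1"]
      by simp
    fix F :: "nat \<Rightarrow> 'x \<Rightarrow> real"
    assume F: "\<And>n. F n \<in> Cb" "\<And>x. decseq (\<lambda>n. F n x)" "\<And>x. (\<lambda>n. F n x) \<longlonglongrightarrow> 0"
    have F0: "0 \<le> F n x" for n x using decseq_ge[OF F(2,3)] .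
    show "(\<lambda>n. \<Lambda> (F n)) \<longlonglongrightarrow> 0"
    proof (rule LIMSEQ_I)
      fix r :: real assume r: "0 < r"
      \<comment> \<open>Chosen so that \<open>(1 + a) / t\<close> equals r / 2, where 1 is the
        eventual bound for p along the scaled sequence.\<close>
      define t where "t = (a + 1) * 2 / r"
      have t: "0 < t" using a0 r by (simp add: t_def)
      have "(\<lambda>n. p (\<lambda>x. t * F n x)) \<longlonglongrightarrow> 0"
        using p unfolding dini_functional_def
      proof (elim conjE allE impE)
        show "\<forall>n. (\<lambda>x. t * F n x) \<in> Cb" using F by auto
        show "\<forall>x. decseq (\<lambda>n. t * F n x)"
          using F(2) t by (auto simp: decseq_def)
        show "\<forall>x. (\<lambda>n. t * F n x) \<longlonglongrightarrow> 0"
          using tendsto_mult_right_zero[OF F(3)] by auto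
      qed auto
      then obtain n0 where n0: "\<And>n. n0 \<le> n \<Longrightarrow> p (\<lambda>x. t * F n x) < 1"
        using order_tendstoD(2)[of _ "0::real" _ 1] by (fastforce simp: eventually_sequentially)
      show "\<exists>n0. \<forall>n\<ge>n0. norm (\<Lambda> (F n) - 0) < r"
      proof (intro exI allI impI)
        fix n assume "n0 \<le> n"
        then have "\<Lambda> (F n) < (1 + a) / t"
          using scaled[OF F(1) t, of n] n0[of n] t
          by (meson add_strict_right_mono divide_strict_right_mono order_le_less_trans)
        also have "\<dots> < r" using a0 r by (simp add: t_def field_simps add_pos_nonneg)
        finally have "\<Lambda> (F n) < r" .
        moreover have "0 \<le> \<Lambda> (F n)"
          using le_const[of "\<lambda>x. - F n x" 0] linear_on_Cb_minus[OF lin F(1)] F F0 by auto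
        ultimately show "norm (\<Lambda> (F n) - 0) < r" by simp
      qed
    qed
  qed
  show ?thesis using rep_PM eq_integral by blast
qed

section \<open>Compactness in the narrow topology\<close>

lemma openin_narrow_subbasis:
  assumes "f \<in> Cb" "open U" shows "openin narrow_topology {Q \<in> PM. (\<integral>x. f x \<partial>Q) \<in> U}"
  unfolding narrow_topology_def using assms by (intro topology_generated_by_Basis) auto

lemma topspace_narrow [simp]: "topspace narrow_topology = PM"
proof
  show "topspace narrow_topology \<subseteq> PM"
    unfolding narrow_topology_def topology_generated_by_topspace by auto
  have "openin narrow_topology {Q \<in> PM. (\<integral>x. (0::real) \<partial>Q) \<in> UNIV}"
    by (rule openin_narrow_subbasis) auto
  from openin_subset[OF this] show "PM \<subseteq> topspace narrow_topology" by auto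
qed

text \<open>The value 0 off \<open>Cb\<close> pins the coordinates that carry no information, so
  that the image of \<open>PM\<close> lies in the Tychonoff-compact \<open>fbox\<close>, as in the
  Banach-Alaoglu theorem. The narrow topology is induced by the product topology along this
  map.\<close>

definition evalf :: "'x::topological_space measure \<Rightarrow> ('x \<Rightarrow> real) \<Rightarrow> real" where
  "evalf Q f = (if f \<in> Cb then \<integral>x. f x \<partial>Q else 0)"

lemma narrow_open_vimage:
  assumes "openin narrow_topology V" shows "\<exists>W. open W \<and> V = {Q \<in> PM. evalf Q \<in> W}"
proof -
  have "generate_topology_on {{Q \<in> PM. (\<integral>x. f x \<partial>Q) \<in> U} | f U. f \<in> Cb \<and> open U} V"
    using assms unfolding narrow_topology_def openin_topology_generated_by_iff .
  then show ?thesis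
  proof induction
    case Empty
    then show ?case by (intro exI[of _ "{}"]) auto
  next
    case (Int a b)
    then obtain Wa Wb where "open Wa" "a = {Q \<in> PM. evalf Q \<in> Wa}" "open Wb" "b = {Q \<in> PM. evalf Q \<in> Wb}"
      by auto
    then show ?case by (intro exI[of _ "Wa \<inter> Wb"]) auto
  next
    case (UN K)
    then have "\<forall>k\<in>K. \<exists>W. open W \<and> k = {Q \<in> PM. evalf Q \<in> W}" by blast
    then obtain W where W: "\<forall>k\<in>K. open (W k) \<and> k = {Q \<in> PM. evalf Q \<in> W k}"
      using bchoice by meson
    have "\<Union>K = (\<Union>k\<in>K. {Q \<in> PM. evalf Q \<in> W k})"
      using W by (metis (no_types, lifting) SUP_cong image_ident)
    also have "\<dots> = {Q \<in> PM. evalf Q \<in> (\<Union>k\<in>K. W k)}" by blast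
    finally show ?case using W by (intro exI[of _ "\<Union>k\<in>K. W k"]) blast
  next
    case (Basis s)
    then obtain f U where s: "s = {Q \<in> PM. (\<integral>x. f x \<partial>Q) \<in> U}" "f \<in> Cb" "open U" by auto
    have "open ((\<lambda>\<Lambda> :: ('a \<Rightarrow> real) \<Rightarrow> real. \<Lambda> f) -` U)"
      using s(3) by (intro open_vimage) auto
    then show ?case
      using s by (intro exI[of _ "(\<lambda>\<Lambda>. \<Lambda> f) -` U"]) (auto simp: evalf_def)
  qed
qed

lemma compact_Pi_UNIV:
  fixes S :: "'i \<Rightarrow> 'b::topological_space set"
  assumes "\<And>i. compact (S i)" shows "compact {x. \<forall>i. x i \<in> S i}"
proof -
  have "compactin (product_topology (\<lambda>i. euclidean) UNIV) (PiE UNIV S)"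
    using assms by (simp add: compactin_PiE)
  moreover have "PiE UNIV S = {x. \<forall>i. x i \<in> S i}" by auto
  ultimately show ?thesis
    by (simp add: euclidean_product_topology)
qed

lemma abs_le_interval_iff: "\<bar>y\<bar> \<le> (c::real) \<longleftrightarrow> - c \<le> y \<and> y \<le> c"
  by auto

definition fbox :: "(('x::topological_space \<Rightarrow> real) \<Rightarrow> real) set" where
  "fbox = {\<Lambda>. \<forall>f. \<Lambda> f \<in> (if f \<in> Cb then {- supn f .. supn f} else {0})}"

lemma compact_fbox: "compact fbox"
  unfolding fbox_def by (rule compact_Pi_UNIV) auto

lemma closed_fbox: "closed fbox"
proof -
  have *: "fbox = (\<Inter>f. (\<lambda>\<Lambda>. \<Lambda> f) -` (if f \<in> Cb then {- supn f .. supn f} else {0}))"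
    unfolding fbox_def by blast
  have "closed ((\<lambda>\<Lambda> :: ('a \<Rightarrow> real) \<Rightarrow> real. \<Lambda> f) -` (if f \<in> Cb then {- supn f .. supn f} else {0}))" for f
    by (rule closed_vimage) simp_all
  then show ?thesis unfolding * by (simp add: closed_INT)
qed

lemma closed_eval_coord:
  "closed {\<Lambda> :: 'i \<Rightarrow> real. \<Lambda> i \<le> c}" "open {\<Lambda> :: 'i \<Rightarrow> real. c < \<Lambda> i}"
proof -
  have *: "continuous_on UNIV (\<lambda>\<Lambda> :: 'i \<Rightarrow> real. \<Lambda> i)" by simp
  show "closed {\<Lambda> :: 'i \<Rightarrow> real. \<Lambda> i \<le> c}" by (rule closed_Collect_le[OF * continuous_on_const])
  show "open {\<Lambda> :: 'i \<Rightarrow> real. c < \<Lambda> i}" by (rule open_Collect_less[OF continuous_on_const *])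
qed

lemma closed_linear_on_Cb: "closed {\<Lambda> :: ('x::topological_space \<Rightarrow> real) \<Rightarrow> real. linear_on_Cb \<Lambda>}"
proof -
  have c: "continuous_on UNIV (\<lambda>\<Lambda> :: ('x \<Rightarrow> real) \<Rightarrow> real. \<Lambda> f)" for f by simp
  have *: "{\<Lambda> :: ('x \<Rightarrow> real) \<Rightarrow> real. linear_on_Cb \<Lambda>} =
      (\<Inter>f\<in>Cb. \<Inter>g\<in>Cb. {\<Lambda>. \<Lambda> (\<lambda>x. f x + g x) = \<Lambda> f + \<Lambda> g}) \<inter>
      (\<Inter>f\<in>Cb. \<Inter>c. {\<Lambda>. \<Lambda> (\<lambda>x. c * f x) = c * \<Lambda> f})"
    by (auto simp: linear_on_Cb_def)
  show ?thesis
    unfolding * by (intro closed_Int closed_INT ballI closed_Collect_eq[OF c continuous_on_add[OF c c]]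
      closed_Collect_eq[OF c continuous_on_mult_left[OF c]])
qed

lemma evalf_fbox: "Q \<in> PM \<Longrightarrow> evalf Q \<in> fbox"
  using Cb_integral_abs_le[of Q] unfolding evalf_def fbox_def abs_le_interval_iff by simp

lemma evalf_linear:
  assumes "Q \<in> PM" shows "linear_on_Cb (evalf Q)"
proof -
  have "linear_on_Cb (evalf Q) \<longleftrightarrow> linear_on_Cb (\<lambda>f. \<integral>x. f x \<partial>Q)"
    unfolding linear_on_Cb_def evalf_def by (intro conj_cong ball_cong all_cong1 refl) auto
  then show ?thesis using linear_on_Cb_integral[OF assms] by simp
qed

lemma fbox_eq_evalf:
  assumes "\<Lambda> \<in> fbox" "\<And>f. f \<in> Cb \<Longrightarrow> \<Lambda> f = (\<integral>x. f x \<partial>Q)" shows "\<Lambda> = evalf Q"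
proof
  fix f
  have "\<Lambda> f \<in> (if f \<in> Cb then {- supn f .. supn f} else {0})"
    using assms(1) unfolding fbox_def by blast
  then show "\<Lambda> f = evalf Q f" using assms(2)[of f] by (auto simp: evalf_def split: if_splits)
qed

text \<open>Passing to the compact closure of \<open>C\<close> in the space of all functionals on \<^const>\<open>Cb\<close> makes
  exponential tightness superfluous: limit functionals dominated by \<open>p + a\<close> are probability
  measures, and the others lie in one of the open half-spaces.\<close>

lemma finite_halfspace_cover:
  fixes C :: "'x::metric_space measure set"
  assumes p: "dini_functional p" and C: "closedin narrow_topology C"
    and sep: "\<And>Q. Q \<in> C \<Longrightarrow> \<exists>h\<in>Cb. p h + a < (\<integral>x. h x \<partial>Q)"
  shows "\<exists>H. finite H \<and> H \<subseteq> Cb \<and> (\<forall>Q\<in>C. \<exists>h\<in>H. p h + a < (\<integral>x. h x \<partial>Q))"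
proof -
  have CPM: "C \<subseteq> PM" using closedin_subset[OF C] by simp
  define K where "K = closure (evalf ` C)"
  have K_box: "K \<subseteq> fbox"
    unfolding K_def
  proof (rule closure_minimal[OF _ closed_fbox], rule image_subsetI)
    fix Q assume "Q \<in> C" then show "evalf Q \<in> fbox" using CPM by (intro evalf_fbox) auto
  qed
  have K_lin: "K \<subseteq> {\<Lambda>. linear_on_Cb \<Lambda>}"
    unfolding K_def
  proof (rule closure_minimal[OF _ closed_linear_on_Cb], rule image_subsetI)
    fix Q assume "Q \<in> C" then show "evalf Q \<in> {\<Lambda>. linear_on_Cb \<Lambda>}"
      using CPM by (intro CollectI evalf_linear) auto
  qed
  have "compact K"
  proof -
    have "compact (fbox \<inter> K)" unfolding K_def by (intro compact_Int_closed compact_fbox closed_closure)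
    then show ?thesis using K_box by (simp only: Int_absorb1)
  qed
  have "\<exists>h\<in>Cb. p h + a < \<Lambda> h" if \<Lambda>K: "\<Lambda> \<in> K" for \<Lambda>
  proof (rule ccontr)
    assume "\<not> ?thesis"
    then have \<Lambda>: "\<Lambda> h \<le> p h + a" if "h \<in> Cb" for h
      using that by (simp add: not_less)
    have "linear_on_Cb \<Lambda>" using subsetD[OF K_lin \<Lambda>K] by simp
    from dominated_functional_representation[OF this p \<Lambda>]
    obtain Q where Q: "Q \<in> PM" "\<And>f. f \<in> Cb \<Longrightarrow> \<Lambda> f = (\<integral>x. f x \<partial>Q)" by blast
    have eq: "\<Lambda> = evalf Q"
      using subsetD[OF K_box \<Lambda>K] Q(2) by (rule fbox_eq_evalf)
    show False
    proof (cases "Q \<in> C")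
      case True
      then obtain h where "h \<in> Cb" "p h + a < (\<integral>x. h x \<partial>Q)" using sep by blast
      then show False using \<Lambda>[of h] Q(2)[of h] by simp
    next
      case False
      have "openin narrow_topology (PM - C)"
        using C by (simp add: closedin_def)
      from narrow_open_vimage[OF this]
      obtain W where W: "open W" "PM - C = {Q \<in> PM. evalf Q \<in> W}" by (elim exE conjE)
      have "Q \<in> PM - C" using False Q(1) by simp
      then have "evalf Q \<in> W" unfolding W(2) by simp
      then have "W \<inter> closure (evalf ` C) \<noteq> {}"
        using \<Lambda>K unfolding eq K_def by blast
      then have "W \<inter> evalf ` C \<noteq> {}"
        using open_Int_closure_eq_empty[OF W(1)] by blast
      then obtain Q' where "Q' \<in> C" "evalf Q' \<in> W" by blast
      then have "Q' \<in> PM - C" unfolding W(2) using CPM by blast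
      then show False using \<open>Q' \<in> C\<close> by simp
    qed
  qed
  then have cover: "K \<subseteq> (\<Union>h\<in>Cb. {\<Lambda>. p h + a < \<Lambda> h})" by auto
  obtain H where H: "H \<subseteq> Cb" "finite H" "K \<subseteq> (\<Union>h\<in>H. {\<Lambda>. p h + a < \<Lambda> h})"
    by (rule compactE_image[OF \<open>compact K\<close> closed_eval_coord(2) cover])
  have "\<exists>h\<in>H. p h + a < (\<integral>x. h x \<partial>Q)" if "Q \<in> C" for Q
  proof -
    have "evalf Q \<in> K"
      unfolding K_def by (rule subsetD[OF closure_subset imageI[OF that]])
    then obtain h where "h \<in> H" "p h + a < evalf Q h" using H(3) by blast
    then show ?thesis using H(1) by (intro bexI[of _ h]) (auto simp: evalf_def split: if_splits)
  qed
  then show ?thesis using H by blast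
qed

text \<open>Under \<open>evalf\<close> the set becomes exactly a closed part of the compact box,
  because dominated functionals are integrals by \<open>dominated_functional_representation\<close>.
  Open covers are carried to the product space and back.\<close>

lemma compactin_dominated_PM:
  fixes p :: "('x::metric_space \<Rightarrow> real) \<Rightarrow> real"
  assumes p: "dini_functional p"
  shows "compactin narrow_topology {Q \<in> PM. \<forall>h\<in>Cb. (\<integral>x. h x \<partial>Q) \<le> p h + a}"
proof -
  let ?L = "{Q \<in> PM. \<forall>h\<in>Cb. (\<integral>x. h x \<partial>Q) \<le> p h + a}"
  let ?K = "fbox \<inter> ({\<Lambda>. linear_on_Cb \<Lambda>} \<inter> (\<Inter>h\<in>Cb. {\<Lambda>. \<Lambda> h \<le> p h + a}))"
  have K: "compact ?K"
    by (intro compact_Int_closed[OF compact_fbox] closed_Int[OF closed_linear_on_Cb] closed_INT ballI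
        closed_eval_coord(1))
  have KsL: "?K \<subseteq> evalf ` ?L"
  proof
    fix \<Lambda> assume \<Lambda>: "\<Lambda> \<in> ?K"
    then have \<Lambda>': "linear_on_Cb \<Lambda>" "\<And>h. h \<in> Cb \<Longrightarrow> \<Lambda> h \<le> p h + a" "\<Lambda> \<in> fbox" by simp_all
    from dominated_functional_representation[OF \<Lambda>'(1) p \<Lambda>'(2)]
    obtain Q where Q: "Q \<in> PM" "\<And>f. f \<in> Cb \<Longrightarrow> \<Lambda> f = (\<integral>x. f x \<partial>Q)" by blast
    have "\<Lambda> = evalf Q" using \<Lambda>'(3) Q(2) by (rule fbox_eq_evalf)
    moreover have "Q \<in> ?L" using \<Lambda>'(2) Q by simp
    ultimately show "\<Lambda> \<in> evalf ` ?L" by (rule image_eqI)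
  qed
  have LK: "evalf ` ?L \<subseteq> ?K"
  proof (rule image_subsetI)
    fix Q assume Q: "Q \<in> ?L"
    then have "evalf Q \<in> fbox" "linear_on_Cb (evalf Q)" by (simp_all add: evalf_fbox evalf_linear)
    moreover have "evalf Q h \<le> p h + a" if "h \<in> Cb" for h
      using Q that by (simp add: evalf_def)
    ultimately show "evalf Q \<in> ?K" by simp
  qed
  have KL: "evalf ` ?L = ?K" by (rule subset_antisym[OF LK KsL])
  show ?thesis
    unfolding compactin_def
  proof (intro conjI allI impI)
    show "?L \<subseteq> topspace narrow_topology" by auto
    fix \<U> assume \<U>: "Ball \<U> (openin narrow_topology) \<and> ?L \<subseteq> \<Union>\<U>"
    then have "\<forall>V\<in>\<U>. \<exists>W. open W \<and> V = {Q \<in> PM. evalf Q \<in> W}"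
      by (auto intro!: narrow_open_vimage)
    from bchoice[OF this] obtain W where W0: "\<forall>V\<in>\<U>. open (W V) \<and> V = {Q \<in> PM. evalf Q \<in> W V}" ..
    have W1: "open (W V)" if "V \<in> \<U>" for V using bspec[OF W0 that] by (rule conjunct1)
    have W2: "Q \<in> V \<longleftrightarrow> Q \<in> PM \<and> evalf Q \<in> W V" if "V \<in> \<U>" for V Q
    proof -
      have "V = {Q \<in> PM. evalf Q \<in> W V}" using bspec[OF W0 that] by (rule conjunct2)
      from arg_cong[where f = "\<lambda>S. Q \<in> S", OF this] show ?thesis by simp
    qed
    note W = W1 W2
    have "evalf ` ?L \<subseteq> (\<Union>V\<in>\<U>. W V)"
    proof
      fix \<Lambda> assume "\<Lambda> \<in> evalf ` ?L"
      then obtain Q where Q: "Q \<in> ?L" "\<Lambda> = evalf Q" by (rule imageE)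
      have "?L \<subseteq> \<Union>\<U>" using \<U> by (rule conjunct2)
      from subsetD[OF this Q(1)] obtain V where "V \<in> \<U>" "Q \<in> V" by (rule UnionE)
      then show "\<Lambda> \<in> (\<Union>V\<in>\<U>. W V)" using W(2)[of V Q] Q(2) by simp blast
    qed
    note cover = this
    have "compact (evalf ` ?L)" using K by (simp only: KL)
    obtain \<F> where F: "\<F> \<subseteq> \<U>" "finite \<F>" "evalf ` ?L \<subseteq> (\<Union>V\<in>\<F>. W V)"
      by (rule compactE_image[OF \<open>compact (evalf ` ?L)\<close> W(1) cover])
    have "?L \<subseteq> \<Union>\<F>"
    proof
      fix Q assume Q: "Q \<in> ?L"
      have "evalf Q \<in> (\<Union>V\<in>\<F>. W V)" by (rule subsetD[OF F(3) imageI[OF Q]])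
      then obtain V where "V \<in> \<F>" "evalf Q \<in> W V" by (rule UN_E)
      moreover have "Q \<in> PM" using Q by simp
      ultimately show "Q \<in> \<Union>\<F>" using W(2)[of V Q] F(1) by (intro UnionI[of V]) auto
    qed
    then show "\<exists>\<F>. finite \<F> \<and> \<F> \<subseteq> \<U> \<and> ?L \<subseteq> \<Union>\<F>"
      using F(1,2) by (intro exI[of _ \<F>] conjI)
  qed
qed

text \<open>The product space is compact but need not be sequentially compact, so a cluster point
  replaces the limit of a subsequence. Only eventual upper bounds are transferred; lower bounds
  follow on passing to \<open>- f\<close>.\<close>

lemma cluster_functional:
  fixes \<Lambda> :: "nat \<Rightarrow> ('x::topological_space \<Rightarrow> real) \<Rightarrow> real"
  assumes lin: "\<And>n. linear_on_Cb (\<Lambda> n)" and bd: "\<And>n f. f \<in> Cb \<Longrightarrow> \<bar>\<Lambda> n f\<bar> \<le> supn f"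
  obtains \<Theta> where "linear_on_Cb \<Theta>"
    and "\<And>f c. f \<in> Cb \<Longrightarrow> \<forall>\<^sub>F n in sequentially. \<Lambda> n f \<le> c \<Longrightarrow> \<Theta> f \<le> c"
proof -
  define \<Lambda>' where "\<Lambda>' = (\<lambda>n f. if f \<in> Cb then \<Lambda> n f else 0)"
  have lin': "linear_on_Cb (\<Lambda>' n)" for n
  proof -
    have "linear_on_Cb (\<Lambda>' n) \<longleftrightarrow> linear_on_Cb (\<Lambda> n)"
      unfolding linear_on_Cb_def \<Lambda>'_def by (intro conj_cong ball_cong all_cong1 refl) auto
    then show ?thesis using lin by simp
  qed
  have box: "\<Lambda>' n \<in> fbox" for n
    using bd unfolding \<Lambda>'_def fbox_def abs_le_interval_iff by simp
  define K where "K = (\<lambda>N. closure (\<Lambda>' ` {N..}))"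
  have Kbox: "K N \<subseteq> fbox" for N
    unfolding K_def using box closed_fbox by (intro closure_minimal) auto
  have "fbox \<inter> \<Inter>(range K) \<noteq> {}"
  proof (rule compact_imp_fip[OF compact_fbox])
    show "closed T" if "T \<in> range K" for T using that by (auto simp: K_def)
    fix F assume F: "finite F" "F \<subseteq> range K"
    then obtain I where I: "finite I" "F = K ` I" by (meson finite_subset_image)
    define N where "N = Max (insert 0 I)"
    have "\<Lambda>' N \<in> K i" if "i \<in> I" for i
    proof -
      have "i \<le> N" using I(1) that by (simp add: N_def)
      then have "\<Lambda>' N \<in> \<Lambda>' ` {i..}" by auto
      then show ?thesis unfolding K_def by (rule subsetD[OF closure_subset])
    qed
    then show "fbox \<inter> \<Inter>F \<noteq> {}" using box[of N] I(2) by auto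
  qed
  then obtain \<Theta> where \<Theta>: "\<And>N. \<Theta> \<in> K N" by auto
  have cl: "\<Theta> \<in> S" if "closed S" "\<And>n. N \<le> n \<Longrightarrow> \<Lambda>' n \<in> S" for S N
    using \<Theta>[of N] closure_minimal[of "\<Lambda>' ` {N..}" S] that by (auto simp: K_def)
  show ?thesis
  proof
    show "linear_on_Cb \<Theta>" using cl[OF closed_linear_on_Cb, of 0] lin' by auto
    fix f :: "'x \<Rightarrow> real" and c assume f: "f \<in> Cb" and ev: "\<forall>\<^sub>F n in sequentially. \<Lambda> n f \<le> c"
    then obtain N where "\<And>n. N \<le> n \<Longrightarrow> \<Lambda>' n f \<le> c"
      by (auto simp: eventually_sequentially \<Lambda>'_def)
    then show "\<Theta> f \<le> c" using cl[OF closed_eval_coord(1), of N f c] by auto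
  qed
qed

section \<open>Good rate functions and Varadhan's lemma\<close>

text \<open>Points of infinite cost have to be left out because \<open>enn2real\<close> maps
  infinity to 0.\<close>

definition vsup :: "('x \<Rightarrow> ennreal) \<Rightarrow> ('x \<Rightarrow> real) \<Rightarrow> real" where
  "vsup J h = (SUP x\<in>{x. J x < \<infinity>}. h x - enn2real (J x))"

locale rate_fn =
  fixes J :: "'x::{metric_space,second_countable_topology} \<Rightarrow> ennreal"
  assumes good: "good_rate J" and inf0: "(INF x. J x) = 0"
begin

lemma ex_small: "0 < e \<Longrightarrow> \<exists>x. J x < ennreal e"
proof -
  assume "0 < e"
  then have "(INF x. J x) < ennreal e" using inf0 by simp
  then show ?thesis by (auto simp: INF_less_iff)
qed

lemma dom_ne: "{x. J x < \<infinity>} \<noteq> {}"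
proof -
  obtain x where "J x < ennreal 1" using ex_small[of 1] by auto
  then have "J x < \<infinity>" using ennreal_less_top[of 1] by (metis infinity_ennreal_def order.strict_trans)
  then show ?thesis by blast
qed

lemma vsup_bdd: "h \<in> Cb \<Longrightarrow> bdd_above ((\<lambda>x. h x - enn2real (J x)) ` {x. J x < \<infinity>})"
proof (rule bdd_aboveI2)
  fix x assume "h \<in> Cb"
  from Cb_abs_le[OF this, of x] show "h x - enn2real (J x) \<le> supn h"
    using enn2real_nonneg[of "J x"] by linarith
qed

lemma vsup_upper: "h \<in> Cb \<Longrightarrow> J x < \<infinity> \<Longrightarrow> h x - enn2real (J x) \<le> vsup J h"
  unfolding vsup_def by (rule cSUP_upper[OF _ vsup_bdd]) auto

lemma vsup_least: "(\<And>x. J x < \<infinity> \<Longrightarrow> h x - enn2real (J x) \<le> c) \<Longrightarrow> vsup J h \<le> c"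
  unfolding vsup_def by (rule cSUP_least[OF dom_ne]) auto

lemma vsup_le_const: "(\<And>x. h x \<le> c) \<Longrightarrow> vsup J h \<le> c"
proof (rule vsup_least)
  fix x assume "\<And>x. h x \<le> c"
  then show "h x - enn2real (J x) \<le> c" using enn2real_nonneg[of "J x"] by (metis diff_mono diff_zero)
qed

lemma vsup_ge_const:
  assumes "h \<in> Cb" "\<And>x. c \<le> h x" shows "c \<le> vsup J h"
proof (rule field_le_epsilon)
  fix e :: real assume e: "0 < e"
  then obtain x where x: "J x < ennreal e" using ex_small by blast
  then have Jx: "J x < \<infinity>" using ennreal_less_top[of e] by (metis infinity_ennreal_def order.strict_trans)
  have "enn2real (J x) < e"
    using x e by (cases "J x") (auto simp: ennreal_less_iff)
  then show "c \<le> vsup J h + e" using vsup_upper[OF assms(1) Jx] assms(2)[of x] by linarith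
qed

lemma vsup_abs_le: "h \<in> Cb \<Longrightarrow> \<bar>vsup J h\<bar> \<le> supn h"
  using vsup_le_const[of h "supn h"] vsup_ge_const[of h "- supn h"] Cb_abs_le[of h]
  unfolding abs_le_interval_iff by blast

lemma closed_level: "closed {x. J x \<le> ennreal a}"
  using good by (simp add: good_rate_def compact_imp_closed)

text \<open>Dini's argument runs on the compact level set of J at height \<open>supn (F 0)\<close>.
  Outside it the cost already outweighs \<open>F 0\<close>, hence every \<open>F n\<close>, and the
  difference is at most 0.\<close>

lemma vsup_dini:
  assumes F: "\<And>n. F n \<in> Cb" "\<And>x. decseq (\<lambda>n. F n x)" "\<And>x. (\<lambda>n. F n x) \<longlonglongrightarrow> 0"
  shows "(\<lambda>n. vsup J (F n)) \<longlonglongrightarrow> 0"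
proof (rule LIMSEQ_I)
  fix r :: real assume r: "0 < r"
  have F0: "0 \<le> F n x" for n x using decseq_ge[OF F(2,3)] .
  define K where "K = (\<lambda>n. {x. J x \<le> ennreal (supn (F 0))} \<inter> {x. r / 2 \<le> F n x})"
  have "\<exists>N. K N = {}"
  proof (rule ccontr)
    assume ne: "\<nexists>N. K N = {}"
    have "{x. J x \<le> ennreal (supn (F 0))} \<inter> \<Inter>(K ` UNIV) \<noteq> {}"
    proof (rule compact_imp_fip)
      show "compact {x. J x \<le> ennreal (supn (F 0))}" using good by (simp add: good_rate_def)
      show "closed T" if T: "T \<in> K ` UNIV" for T
      proof -
        obtain n where "T = K n" using T by blast
        then show ?thesis
          unfolding K_def by (auto intro!: closed_Int closed_level closed_Collect_le Cb_cont F)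
      qed
      fix G assume G: "finite G" "G \<subseteq> K ` UNIV"
      then obtain I where I: "finite I" "G = K ` I" by (meson finite_subset_image)
      define N where "N = Max (insert 0 I)"
      have "K N \<subseteq> K i" if "i \<in> I" for i
      proof -
        have "i \<le> N" using I(1) that by (simp add: N_def)
        then have "F N x \<le> F i x" for x using F(2)[of x] by (simp add: decseq_def)
        then show ?thesis unfolding K_def using order_trans by blast
      qed
      moreover obtain x where "x \<in> K N" using ne by blast
      ultimately have "x \<in> {x. J x \<le> ennreal (supn (F 0))} \<inter> \<Inter>G" using I(2) by (auto simp: K_def)
      then show "{x. J x \<le> ennreal (supn (F 0))} \<inter> \<Inter>G \<noteq> {}" by blast
    qed
    then obtain x where x: "\<And>n. r / 2 \<le> F n x" by (auto simp: K_def)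
    have "r / 2 \<le> 0" by (rule LIMSEQ_le_const[OF F(3)[of x]]) (use x in auto)
    then show False using r by simp
  qed
  then obtain N where N: "K N = {}" ..
  show "\<exists>n0. \<forall>n\<ge>n0. norm (vsup J (F n) - 0) < r"
  proof (intro exI[of _ N] allI impI)
    fix n assume n: "N \<le> n"
    have "vsup J (F n) \<le> r / 2"
    proof (rule vsup_least)
      fix x assume x: "J x < \<infinity>"
      have le: "F n x \<le> F N x" "F n x \<le> F 0 x" using F(2)[of x] n by (simp_all add: decseq_def)
      show "F n x - enn2real (J x) \<le> r / 2"
      proof (cases "J x \<le> ennreal (supn (F 0))")
        case True
        then have "F N x < r / 2" using N by (auto simp: K_def not_le)
        then show ?thesis using le enn2real_nonneg[of "J x"] by linarith
      next
        case False
        then have "supn (F 0) \<le> enn2real (J x)"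
          using x supn_nonneg[OF F(1)] by (metis enn2real_ennreal enn2real_mono linear top.not_eq_extremum infinity_ennreal_def less_top)
        then show ?thesis using le Cb_abs_le[OF F(1), of 0 x] r by linarith
      qed
    qed
    moreover have "0 \<le> vsup J (F n)" by (rule vsup_ge_const[OF F(1) F0])
    ultimately show "norm (vsup J (F n) - 0) < r" using r by simp
  qed
qed

lemma le_J: "h \<in> Cb \<Longrightarrow> ennreal (h x - vsup J h) \<le> J x"
proof (cases "J x < \<infinity>")
  case True
  assume "h \<in> Cb"
  from vsup_upper[OF this True] have "h x - vsup J h \<le> enn2real (J x)" by simp
  then have "ennreal (h x - vsup J h) \<le> ennreal (enn2real (J x))" by (rule ennreal_leI)
  moreover have "ennreal (enn2real (J x)) = J x" using True by (intro ennreal_enn2real) simp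
  ultimately show ?thesis by simp
qed (simp add: not_less top_unique)

lemma integral_le_cost:
  assumes Q: "Q \<in> PM" and h: "h \<in> Cb"
  shows "ennreal ((\<integral>x. h x \<partial>Q) - vsup J h) \<le> (\<integral>\<^sup>+x. J x \<partial>Q)"
proof -
  interpret prob_space Q by (rule PM_prob) fact
  let ?g = "\<lambda>x. h x - vsup J h"
  have g: "?g \<in> Cb" "(\<lambda>x. max 0 (?g x)) \<in> Cb"
    using h by (auto intro!: Cb_max Cb_diff)
  have "(\<integral>x. h x \<partial>Q) - vsup J h = (\<integral>x. ?g x \<partial>Q)"
    using Q Cb_integrable[OF Q h] by (simp add: Bochner_Integration.integral_diff prob_space)
  also have "\<dots> \<le> (\<integral>x. max 0 (?g x) \<partial>Q)"
    using Q g by (intro integral_mono_PM) auto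
  finally have "ennreal ((\<integral>x. h x \<partial>Q) - vsup J h) \<le> ennreal (\<integral>x. max 0 (?g x) \<partial>Q)"
    by (rule ennreal_leI)
  also have "\<dots> = (\<integral>\<^sup>+x. ennreal (max 0 (?g x)) \<partial>Q)"
    by (rule nn_integral_eq_integral[symmetric]) (use Cb_integrable[OF Q g(2)] in auto)
  also have "\<dots> \<le> (\<integral>\<^sup>+x. J x \<partial>Q)"
    using le_J[OF h] by (intro nn_integral_mono) (simp add: max_def)
  finally show ?thesis .
qed

end

subsection \<open>A good rate function as a countable supremum of bounded continuous functions\<close>

definition dense_seq :: "nat \<Rightarrow> 'x::second_countable_topology" where
  "dense_seq = (SOME s. \<forall>X. open X \<and> X \<noteq> {} \<longrightarrow> (\<exists>n. s n \<in> X))"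

lemma dense_seq:
  assumes "open X" "X \<noteq> {}" shows "\<exists>n. dense_seq n \<in> X"
proof -
  obtain D :: "'a set" where D: "countable D" "\<And>X. open X \<Longrightarrow> X \<noteq> {} \<Longrightarrow> \<exists>d\<in>D. d \<in> X"
    by (metis countable_dense_exists)
  have "\<forall>X. open X \<and> X \<noteq> {} \<longrightarrow> (\<exists>n. from_nat_into D n \<in> X)"
  proof (intro allI impI)
    fix X :: "'a set" assume "open X \<and> X \<noteq> {}"
    then obtain d where "d \<in> D" "d \<in> X" using D(2) by blast
    then show "\<exists>n. from_nat_into D n \<in> X"
      using D(1) by (intro exI[of _ "to_nat_on D d"]) simp
  qed
  then have "\<exists>s :: nat \<Rightarrow> 'a. \<forall>X. open X \<and> X \<noteq> {} \<longrightarrow> (\<exists>n. s n \<in> X)"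
    by (rule exI[of _ "from_nat_into D"])
  from someI_ex[OF this] show ?thesis unfolding dense_seq_def using assms by blast
qed

text \<open>Inverted cones with apex height 0 at a point of a dense sequence, slope m n and floor
  -m.\<close>

definition hfam :: "nat \<Rightarrow> 'x::{metric_space,second_countable_topology} \<Rightarrow> real" where
  "hfam i = (case prod_decode i of (d, j) \<Rightarrow> case prod_decode j of (m, n) \<Rightarrow>
     (\<lambda>y. - real m * min 1 (real n * dist y (dense_seq d))))"

lemma hfam_ex:
  fixes x :: "'x::{metric_space,second_countable_topology}"
  assumes "0 < r" shows "\<exists>x0 i. dist x x0 < r \<and> hfam i = (\<lambda>y. - real m * min 1 (real n * dist y x0))"
proof -
  obtain d where "(dense_seq d :: 'x) \<in> ball x r"
    using dense_seq[of "ball x r"] assms by auto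
  moreover define x0 :: 'x where "x0 = dense_seq d"
  ultimately have x0: "x0 \<in> ball x r" by simp
  have "hfam (prod_encode (d, prod_encode (m, n))) = (\<lambda>y. - real m * min 1 (real n * dist y x0))"
    by (simp add: hfam_def x0_def)
  then show ?thesis
    using x0 by (intro exI[of _ x0] exI[of _ "prod_encode (d, prod_encode (m, n))"]) simp
qed

lemma hfam_Cb [intro]: "hfam i \<in> Cb"
proof -
  obtain d m n where i: "i = prod_encode (d, prod_encode (m, n))"
    by (metis prod_decode_inverse surj_pair)
  show ?thesis
    unfolding i hfam_def
    by (auto intro!: CbI[where C = "real m"] continuous_intros simp: abs_mult mult_left_le)
qed

context rate_fn
begin

text \<open>A conjugate formula that follows from lower semicontinuity alone, because the test
  functions are not linear. If J exceeds c' on a ball around x, a steep cone with apex near x and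
  floor at most -c' has \<open>vsup\<close> at most -c', while its value at x is nearly 0.\<close>

lemma J_eq_SUP_hfam: "J x = (SUP i. ennreal (hfam i x - vsup J (hfam i)))"
proof (rule antisym)
  show "(SUP i. ennreal (hfam i x - vsup J (hfam i))) \<le> J x"
    by (intro SUP_least le_J hfam_Cb)
  show "J x \<le> (SUP i. ennreal (hfam i x - vsup J (hfam i)))"
  proof (rule dense_le)
    fix y assume "y < J x"
    then obtain y' where y': "y < y'" "y' < J x" using dense by blast
    define c where "c = enn2real y"
    define c' where "c' = enn2real y'"
    have y_c: "y = ennreal c" "0 \<le> c" and y'_c: "y' = ennreal c'" "0 \<le> c'"
      using y' unfolding c_def c'_def by (cases y; cases y'; force)+
    have cc: "c < c'" using y'(1) y_c y'_c by (simp add: ennreal_less_iff)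
    have "open (- {x. J x \<le> ennreal c'})" using closed_level by (rule open_Compl)
    moreover have "x \<in> - {x. J x \<le> ennreal c'}" using y'(2) y'_c by (simp add: not_le)
    ultimately obtain r where r: "0 < r" "ball x r \<subseteq> - {x. J x \<le> ennreal c'}"
      by (meson open_contains_ball)
    obtain m where m: "c' \<le> real m" using real_arch_simple by blast
    obtain n where n: "2 / r < real n" using reals_Archimedean2 by blast
    then have n0: "0 < real n" using r(1) by (meson divide_pos_pos less_trans zero_less_numeral)
    \<comment> \<open>The first bound keeps the narrow part of the cone, of radius 1/n < r/2, inside
      the ball around x. The second keeps the cone above c - c' at x; the + 1 makes the divisor
      positive.\<close>
    define \<delta> where "\<delta> = min (r / 2) ((c' - c) / (real m * real n + 1))"
    have \<delta>: "0 < \<delta>" using r(1) cc by (auto simp: \<delta>_def intro!: divide_pos_pos add_nonneg_pos)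
    obtain x0 i where x0: "dist x x0 < \<delta>" and h: "hfam i = (\<lambda>y. - real m * min 1 (real n * dist y x0))"
      using hfam_ex[OF \<delta>] by metis
    have "vsup J (hfam i) \<le> - c'"
    proof (rule vsup_least)
      fix w assume w: "J w < \<infinity>"
      have nn: "0 \<le> min 1 (real n * dist w x0)" by simp
      show "hfam i w - enn2real (J w) \<le> - c'"
      proof (cases "1 \<le> real n * dist w x0")
        case True
        then have "hfam i w = - real m" by (simp add: h min_def)
        then show ?thesis using m enn2real_nonneg[of "J w"] by linarith
      next
        case False
        then have "dist w x0 < 1 / real n" using n0 by (simp add: field_simps)
        also have "1 / real n < r / 2" using n n0 r(1) by (simp add: field_simps)
        finally have "dist x w < r"
          using x0 dist_triangle2[of x w x0] by (simp add: \<delta>_def)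
        then have "ennreal c' < J w" using r(2) by (auto simp: subset_iff not_le)
        then have "c' \<le> enn2real (J w)"
          using w y'_c(2) by (cases "J w") (auto simp: ennreal_less_iff)
        moreover have "hfam i w \<le> 0" using nn by (simp add: h)
        ultimately show ?thesis by linarith
      qed
    qed
    moreover have "- (c' - c) \<le> hfam i x"
    proof -
      have "real m * min 1 (real n * dist x x0) \<le> real m * (real n * \<delta>)"
        using x0 n0 by (intro mult_left_mono) (auto intro!: min.coboundedI2)
      also have "\<dots> \<le> (real m * real n + 1) * \<delta>" using \<delta> by (simp add: algebra_simps)
      also have "\<dots> \<le> (real m * real n + 1) * ((c' - c) / (real m * real n + 1))"
        unfolding \<delta>_def by (intro mult_left_mono) auto
      also have "\<dots> = c' - c"
        by (metis add_nonneg_pos less_irrefl mult_nonneg_nonneg nonzero_mult_div_cancel_left of_nat_0_le_iff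
            times_divide_eq_right zero_less_one)
      finally show ?thesis by (simp add: h)
    qed
    ultimately have "ennreal c \<le> ennreal (hfam i x - vsup J (hfam i))" by (intro ennreal_leI) simp
    also have "\<dots> \<le> (SUP i. ennreal (hfam i x - vsup J (hfam i)))" by (rule SUP_upper) simp
    finally show "y \<le> (SUP i. ennreal (hfam i x - vsup J (hfam i)))" using y_c by simp
  qed
qed

text \<open>Running maxima of 0 and the functions of \<open>J_eq_SUP_hfam\<close> increase to J, so
  monotone convergence reduces the cost to bounded continuous g below J. For such g the value
  \<open>vsup J g\<close> is at most 0, and the domination leaves c.\<close>

lemma cost_le_of_dominated:
  assumes Q: "Q \<in> PM" and dom: "\<And>h. h \<in> Cb \<Longrightarrow> (\<integral>x. h x \<partial>Q) \<le> c + vsup J h"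
  shows "(\<integral>\<^sup>+x. J x \<partial>Q) \<le> ennreal c"
proof -
  define g where "g = rec_nat (\<lambda>x::'x. 0) (\<lambda>n u x. max (u x) (hfam n x - vsup J (hfam n)))"
  have g0: "g 0 = (\<lambda>x. 0)" and gS: "g (Suc n) = (\<lambda>x. max (g n x) (hfam n x - vsup J (hfam n)))" for n
    by (simp_all add: g_def)
  have g_Cb: "g n \<in> Cb" for n
    by (induction n) (auto simp: g0 gS intro!: Cb_max Cb_diff)
  have g_le: "ennreal (g n x) \<le> J x" for n x
    using le_J[OF hfam_Cb] by (induction n) (auto simp: g0 gS max_def)
  have g_nonneg: "0 \<le> g n x" for n x
    by (induction n) (auto simp: g0 gS)
  have g_inc: "incseq (\<lambda>n x. ennreal (g n x))"
    by (rule incseq_SucI) (auto simp: gS le_fun_def intro!: ennreal_leI)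
  have J_eq: "J x = (SUP n. ennreal (g n x))" for x
  proof (rule antisym)
    show "J x \<le> (SUP n. ennreal (g n x))"
      unfolding J_eq_SUP_hfam[of x]
    proof (rule SUP_least)
      fix i
      have "ennreal (hfam i x - vsup J (hfam i)) \<le> ennreal (g (Suc i) x)"
        by (intro ennreal_leI) (simp add: gS)
      also have "\<dots> \<le> (SUP n. ennreal (g n x))" by (rule SUP_upper) simp
      finally show "ennreal (hfam i x - vsup J (hfam i)) \<le> (SUP n. ennreal (g n x))" .
    qed
  qed (intro SUP_least g_le)
  have "(\<integral>\<^sup>+x. J x \<partial>Q) = (\<integral>\<^sup>+x. (SUP n. ennreal (g n x)) \<partial>Q)"
    using J_eq by simp
  also have "\<dots> = (SUP n. \<integral>\<^sup>+x. ennreal (g n x) \<partial>Q)"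
  proof (rule nn_integral_monotone_convergence_SUP[OF g_inc])
    show "(\<lambda>x. ennreal (g n x)) \<in> borel_measurable Q" for n
      using Cb_measurable[OF g_Cb[of n]] Q by (simp add: PM_measurable)
  qed
  also have "\<dots> \<le> ennreal c"
  proof (rule SUP_least)
    fix n
    have "vsup J (g n) \<le> 0"
    proof (rule vsup_least)
      fix x assume "J x < \<infinity>"
      then show "g n x - enn2real (J x) \<le> 0"
        using g_le[of n x] g_nonneg[of n x] by (cases "J x") auto
    qed
    then have "(\<integral>x. g n x \<partial>Q) \<le> c" using dom[OF g_Cb[of n]] by simp
    moreover have "(\<integral>\<^sup>+x. ennreal (g n x) \<partial>Q) = ennreal (\<integral>x. g n x \<partial>Q)"
      using Cb_integrable[OF Q g_Cb] g_nonneg by (intro nn_integral_eq_integral) auto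
    ultimately show "(\<integral>\<^sup>+x. ennreal (g n x) \<partial>Q) \<le> ennreal c" by (simp add: ennreal_leI)
  qed
  finally show ?thesis .
qed

end

text \<open>The infimum behind \<open>Sop\<close> turns out to be a real number, so
  \<open>real_of_ereal\<close> loses nothing. The change of sign translates (b) into the convention
  of \<open>p\<close> and \<open>dual_le\<close>.\<close>

lemma Sop_eq_vsup:
  assumes "rate_fn (J z)" "f \<in> Cb"
  shows "Sop J f z = - vsup (J z) (\<lambda>x. - f x)"
proof -
  interpret rate_fn "J z" by fact
  have "(INF x. enn2ereal (J z x) + ereal (f x)) = ereal (- vsup (J z) (\<lambda>x. - f x))"
  proof (rule antisym)
    show "ereal (- vsup (J z) (\<lambda>x. - f x)) \<le> (INF x. enn2ereal (J z x) + ereal (f x))"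
    proof (rule INF_greatest)
      fix x
      show "ereal (- vsup (J z) (\<lambda>x. - f x)) \<le> enn2ereal (J z x) + ereal (f x)"
      proof (cases "J z x")
        case (real r)
        then have "- f x - r \<le> vsup (J z) (\<lambda>x. - f x)"
          using vsup_upper[OF Cb_minus[OF assms(2)], of x] by simp
        then show ?thesis using real by simp
      qed simp
    qed
    show "(INF x. enn2ereal (J z x) + ereal (f x)) \<le> ereal (- vsup (J z) (\<lambda>x. - f x))"
    proof (rule ereal_le_real)
      fix w assume w: "ereal (- vsup (J z) (\<lambda>x. - f x)) \<le> ereal w"
      show "(INF x. enn2ereal (J z x) + ereal (f x)) \<le> ereal w"
      proof (rule ccontr)
        assume "\<not> ?thesis"
        then have gt: "ereal w < (INF x. enn2ereal (J z x) + ereal (f x))" by simp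
        then obtain w' where w': "w < w'" "ereal w' < (INF x. enn2ereal (J z x) + ereal (f x))"
          using ereal_dense2 by force
        have "vsup (J z) (\<lambda>x. - f x) \<le> - w'"
        proof (rule vsup_least)
          fix x assume "J z x < \<infinity>"
          then obtain r where r: "J z x = ennreal r" "0 \<le> r" by (cases "J z x") auto
          have "ereal w' < enn2ereal (J z x) + ereal (f x)"
            using w'(2) by (meson INF_lower UNIV_I less_le_trans)
          then show "- f x - enn2real (J z x) \<le> - w'" using r by simp
        qed
        then show False using w w'(1) by simp
      qed
    qed
  qed
  then show ?thesis by (simp add: Sop_def)
qed

subsection \<open>Varadhan's lemma\<close>

text \<open>The upper bound for the whole space: its mass is 1 for every k \<ge> 1, so the infimum
  of J cannot be positive.\<close>

lemma k_LDP_rate_fn: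
  fixes P :: "nat \<Rightarrow> 'x::{metric_space,second_countable_topology} measure"
  assumes "k_LDP P J" "\<And>k. k \<ge> 1 \<Longrightarrow> P k \<in> PM" shows "rate_fn J"
proof
  show "good_rate J" using assms by (simp add: k_LDP_def)
  have "limsup (\<lambda>k. elog (measure (P k) UNIV) / ereal (real k)) \<le> - enn2ereal (INF x\<in>closure UNIV. J x)"
    using bspec[OF conjunct2[OF assms(1)[unfolded k_LDP_def]], of UNIV] by simp
  moreover have "limsup (\<lambda>k. elog (measure (P k) UNIV) / ereal (real k)) = 0"
  proof (rule lim_imp_Limsup)
    show "(\<lambda>k. elog (measure (P k) UNIV) / ereal (real k)) \<longlonglongrightarrow> 0"
    proof (rule tendsto_eventually)
      show "\<forall>\<^sub>F k in sequentially. elog (measure (P k) UNIV) / ereal (real k) = 0"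
        using eventually_ge_at_top[of 1]
      proof eventually_elim
        fix k :: nat assume k: "1 \<le> k"
        then have "measure (P k) UNIV = 1"
          using prob_space.prob_space[OF PM_prob[OF assms(2)]] PM_space[OF assms(2)] by metis
        then show "elog (measure (P k) UNIV) / ereal (real k) = 0" using k by (simp add: elog_def)
      qed
    qed
  qed simp
  ultimately have "enn2ereal (INF x. J x) \<le> 0" by simp
  then show "(INF x. J x) = 0" by (metis enn2ereal_nonneg antisym enn2ereal_inject zero_ennreal.rep_eq)
qed

text \<open>Negative c is allowed on purpose: in Varadhan's lemma c is a level of g minus
  \<open>vsup J g\<close>, which may be negative. For such c the bound is the nonnegativity of
  J.\<close>

lemma k_LDP_closed_bound:
  fixes P :: "nat \<Rightarrow> 'x::{metric_space,second_countable_topology} measure"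
  assumes ldp: "k_LDP P J" and F: "closed F" and c: "\<And>x. x \<in> F \<Longrightarrow> ereal c \<le> enn2ereal (J x)"
    and e: "0 < e"
  shows "\<forall>\<^sub>F k in sequentially. measure (P k) F \<le> exp (- real k * (c - e))"
proof -
  have "ereal c \<le> enn2ereal (INF x\<in>F. J x)"
  proof (cases "0 \<le> c")
    case True
    have "ennreal c \<le> (INF x\<in>F. J x)"
    proof (rule INF_greatest)
      fix x assume "x \<in> F"
      from c[OF this] True show "ennreal c \<le> J x"
        by (simp add: less_eq_ennreal.rep_eq enn2ereal_ennreal)
    qed
    then show ?thesis using True by (simp add: less_eq_ennreal.rep_eq enn2ereal_ennreal)
  next
    case False
    then have "ereal c \<le> 0" by simp
    then show ?thesis using enn2ereal_nonneg order_trans by blast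
  qed
  then have "- enn2ereal (INF x\<in>F. J x) \<le> ereal (- c)"
    by (metis ereal_minus_le_minus uminus_ereal.simps(1))
  moreover have "limsup (\<lambda>k. elog (measure (P k) F) / ereal (real k)) \<le> - enn2ereal (INF x\<in>F. J x)"
    using ldp F by (auto simp: k_LDP_def dest!: bspec[of _ _ F])
  ultimately have "limsup (\<lambda>k. elog (measure (P k) F) / ereal (real k)) \<le> ereal (- c)"
    by (rule order_trans[rotated])
  also have "ereal (- c) < ereal (- (c - e))" using e by simp
  finally have "\<forall>\<^sub>F k in sequentially. elog (measure (P k) F) / ereal (real k) < ereal (- (c - e))"
    by (rule Limsup_lessD)
  then show ?thesis using eventually_ge_at_top[of 1]
  proof eventually_elim
    fix k :: nat assume *: "elog (measure (P k) F) / ereal (real k) < ereal (- (c - e))" "1 \<le> k"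
    show "measure (P k) F \<le> exp (- real k * (c - e))"
    proof (cases "measure (P k) F \<le> 0")
      case False
      then have "ln (measure (P k) F) / real k < - (c - e)" using * by (simp add: elog_def)
      then have "ln (measure (P k) F) \<le> - real k * (c - e)"
        using *(2) by (simp add: field_simps)
      then show ?thesis using False by (metis exp_le_cancel_iff exp_ln not_le)
    qed (use exp_ge_zero order_trans in blast)
  qed
qed

lemma k_LDP_open_bound:
  fixes P :: "nat \<Rightarrow> 'x::{metric_space,second_countable_topology} measure"
  assumes ldp: "k_LDP P J" and U: "open U" "x \<in> U" and x: "J x < \<infinity>" and e: "0 < e"
  shows "\<forall>\<^sub>F k in sequentially. exp (- real k * (enn2real (J x) + e)) \<le> measure (P k) U"
proof -
  obtain r where r: "J x = ennreal r" "0 \<le> r" using x by (cases "J x") auto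
  have "(INF x\<in>U. J x) \<le> ennreal r" using U(2) r by (metis INF_lower)
  then have "enn2ereal (INF x\<in>U. J x) \<le> ereal r" using r by (simp add: less_eq_ennreal.rep_eq)
  then have "ereal (- r) \<le> - enn2ereal (INF x\<in>U. J x)"
    by (metis ereal_minus_le_minus uminus_ereal.simps(1))
  also have "\<dots> \<le> liminf (\<lambda>k. elog (measure (P k) U) / ereal (real k))"
    using ldp U by (auto simp: k_LDP_def interior_open dest!: bspec[of _ _ U])
  finally have "ereal (- r) \<le> liminf (\<lambda>k. elog (measure (P k) U) / ereal (real k))" .
  then have "ereal (- (r + e)) < liminf (\<lambda>k. elog (measure (P k) U) / ereal (real k))"
    using e by (auto intro: less_le_trans[of _ "ereal (- r)"])
  then have "\<forall>\<^sub>F k in sequentially. ereal (- (r + e)) < elog (measure (P k) U) / ereal (real k)"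
    by (rule less_LiminfD)
  then show ?thesis using eventually_ge_at_top[of 1]
  proof eventually_elim
    fix k :: nat assume *: "ereal (- (r + e)) < elog (measure (P k) U) / ereal (real k)" "1 \<le> k"
    have pos: "0 < measure (P k) U"
      using * by (rule_tac ccontr) (auto simp: elog_def)
    then have "- (r + e) < ln (measure (P k) U) / real k" using * by (simp add: elog_def)
    then have "- real k * (r + e) \<le> ln (measure (P k) U)" using *(2) by (simp add: field_simps)
    then show "exp (- real k * (enn2real (J x) + e)) \<le> measure (P k) U"
      using pos r by (metis enn2real_ennreal exp_le_cancel_iff exp_ln)
  qed
qed

text \<open>Upper half: the range of g is bounded, so finitely many closed superlevel sets with
  spacing e suffice, and on each of them J is at least the level minus \<open>vsup J g\<close>.
  Lower half: a neighbourhood of one near-maximiser of g - J.\<close>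

theorem Varadhan:
  fixes P :: "nat \<Rightarrow> 'x::{metric_space,second_countable_topology} measure"
  assumes ldp: "k_LDP P J" and P: "\<And>k. k \<ge> 1 \<Longrightarrow> P k \<in> PM" and g: "g \<in> Cb"
  shows "(\<lambda>k. ln (\<integral>x. exp (real k * g x) \<partial>P k) / real k) \<longlonglongrightarrow> vsup J g"
proof (rule LIMSEQ_I)
  interpret rate_fn J using ldp P by (rule k_LDP_rate_fn)
  define v where "v = vsup J g"
  define Zk where "Zk = (\<lambda>k. \<integral>x. exp (real k * g x) \<partial>P k)"
  have exp_Cb: "(\<lambda>x. exp (real k * g x)) \<in> Cb" for k using g by auto
  fix r :: real assume r: "0 < r"
  define e where "e = r / 4"
  have e: "0 < e" using r by (simp add: e_def)
  define C where "C = supn g"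
  have gC: "- C \<le> g x" "g x \<le> C" for x using Cb_abs_le[OF g, of x] by (auto simp: C_def)
  \<comment> \<open>Enough levels of spacing e to climb from -C to C; the factor N disappears after
    taking logarithms and dividing by k.\<close>
  define N where "N = Suc (nat \<lfloor>2 * C / e\<rfloor>)"
  define F where "F = (\<lambda>i::nat. {x. - C + real i * e \<le> g x})"
  have clF: "closed (F i)" for i
    unfolding F_def by (intro closed_Collect_le continuous_on_const Cb_cont g)
  have ub1: "\<forall>\<^sub>F k in sequentially. \<forall>i\<in>{..<N}. measure (P k) (F i) \<le> exp (- real k * ((- C + real i * e - v) - e))"
  proof (rule eventually_ball_finite)
    show "\<forall>i\<in>{..<N}. \<forall>\<^sub>F k in sequentially. measure (P k) (F i) \<le> exp (- real k * ((- C + real i * e - v) - e))"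
    proof
      fix i
      show "\<forall>\<^sub>F k in sequentially. measure (P k) (F i) \<le> exp (- real k * ((- C + real i * e - v) - e))"
      proof (rule k_LDP_closed_bound[OF ldp clF _ e])
        fix x assume "x \<in> F i"
        then have x: "- C + real i * e \<le> g x" by (simp add: F_def)
        show "ereal (- C + real i * e - v) \<le> enn2ereal (J x)"
        proof (cases "J x")
          case (real s)
          then show ?thesis using vsup_upper[OF g, of x] x by (simp add: v_def enn2ereal_ennreal)
        qed simp
      qed
    qed
  qed simp
  have ub: "\<forall>\<^sub>F k in sequentially. Zk k \<le> real N * exp (real k * (v + 2 * e))"
    using ub1 eventually_ge_at_top[of 1]
  proof eventually_elim
    fix k :: nat
    assume k: "\<forall>i\<in>{..<N}. measure (P k) (F i) \<le> exp (- real k * ((- C + real i * e - v) - e))" "1 \<le> k"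
    interpret Pk: prob_space "P k" using P k(2) PM_prob by blast
    have Fs: "F i \<in> sets (P k)" for i using clF PM_sets[OF P[OF k(2)]] by simp
    have intF: "integrable (P k) (\<lambda>x. exp (real k * (- C + real (Suc i) * e)) * indicator (F i) x)" for i
      using Fs by (intro integrable_mult_right integrable_real_indicator) (auto simp: Pk.emeasure_eq_measure)
    have "Zk k \<le> (\<integral>x. (\<Sum>i<N. exp (real k * (- C + real (Suc i) * e)) * indicator (F i) x) \<partial>P k)"
      unfolding Zk_def
    proof (rule integral_mono)
      show "integrable (P k) (\<lambda>x. exp (real k * g x))" using P[OF k(2)] exp_Cb by (rule Cb_integrable)
      show "integrable (P k) (\<lambda>x. \<Sum>i<N. exp (real k * (- C + real (Suc i) * e)) * indicator (F i) x)"
        by (intro Bochner_Integration.integrable_sum intF)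
      fix x
      define i where "i = nat \<lfloor>(g x + C) / e\<rfloor>"
      have nn: "0 \<le> (g x + C) / e" using gC[of x] e by simp
      have i: "real i \<le> (g x + C) / e" "(g x + C) / e < real (Suc i)"
        using nn unfolding i_def by linarith+
      have "(g x + C) / e \<le> 2 * C / e" using gC[of x] e by (intro divide_right_mono) auto
      then have "i < N" unfolding i_def N_def using nn by (simp add: floor_mono nat_mono less_Suc_eq_le)
      have xF: "x \<in> F i" using i(1) e by (simp add: F_def field_simps)
      have "g x \<le> - C + real (Suc i) * e" using i(2) e by (simp add: field_simps)
      then have "exp (real k * g x) \<le> exp (real k * (- C + real (Suc i) * e)) * indicator (F i) x"
        using xF by (simp add: mult_left_mono)
      also have "\<dots> \<le> (\<Sum>i<N. exp (real k * (- C + real (Suc i) * e)) * indicator (F i) x)"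
        using \<open>i < N\<close> by (intro member_le_sum) auto
      finally show "exp (real k * g x) \<le> (\<Sum>i<N. exp (real k * (- C + real (Suc i) * e)) * indicator (F i) x)" .
    qed
    also have "\<dots> = (\<Sum>i<N. exp (real k * (- C + real (Suc i) * e)) * measure (P k) (F i))"
      using Fs intF by (subst Bochner_Integration.integral_sum) auto
    also have "\<dots> \<le> (\<Sum>i<N. exp (real k * (- C + real (Suc i) * e)) * exp (- real k * ((- C + real i * e - v) - e)))"
      using k(1) by (intro sum_mono mult_left_mono) auto
    also have "\<dots> = (\<Sum>i<N. exp (real k * (v + 2 * e)))"
      by (intro sum.cong refl) (simp add: exp_add[symmetric] algebra_simps)
    finally show "Zk k \<le> real N * exp (real k * (v + 2 * e))" by simp
  qed
  have "\<exists>x\<in>{x. J x < \<infinity>}. v - e < g x - enn2real (J x)"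
    using less_cSUP_iff[OF dom_ne vsup_bdd[OF g], of "v - e"] e by (simp add: v_def vsup_def)
  then obtain x where x: "J x < \<infinity>" "v - e < g x - enn2real (J x)" by blast
  define U where "U = {y. g x - e < g y}"
  have oU: "open U" "x \<in> U"
    using Cb_cont[OF g] e by (auto simp: U_def intro!: open_Collect_less)
  have lb: "\<forall>\<^sub>F k in sequentially. exp (real k * (v - 3 * e)) \<le> Zk k"
    using k_LDP_open_bound[OF ldp oU x(1) e] eventually_ge_at_top[of 1]
  proof eventually_elim
    fix k :: nat assume k: "exp (- real k * (enn2real (J x) + e)) \<le> measure (P k) U" "1 \<le> k"
    interpret Pk: prob_space "P k" using P k(2) PM_prob by blast
    have Us: "U \<in> sets (P k)" using oU PM_sets[OF P[OF k(2)]] by simp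
    have "real k * (v - 3 * e) \<le> real k * ((g x - e) - (enn2real (J x) + e))"
      using x(2) by (intro mult_left_mono) auto
    then have "exp (real k * (v - 3 * e)) \<le> exp (real k * (g x - e)) * exp (- real k * (enn2real (J x) + e))"
      by (simp add: exp_add[symmetric] algebra_simps)
    also have "\<dots> \<le> exp (real k * (g x - e)) * measure (P k) U"
      using k(1) by (intro mult_left_mono) auto
    also have "\<dots> = (\<integral>y. exp (real k * (g x - e)) * indicator U y \<partial>P k)"
      using Us by simp
    also have "\<dots> \<le> Zk k"
      unfolding Zk_def
    proof (rule integral_mono)
      show "integrable (P k) (\<lambda>x. exp (real k * g x))" using P[OF k(2)] exp_Cb by (rule Cb_integrable)
      show "integrable (P k) (\<lambda>y. exp (real k * (g x - e)) * indicator U y)"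
        using Us by (intro integrable_mult_right integrable_real_indicator) (auto simp: Pk.emeasure_eq_measure)
      show "exp (real k * (g x - e)) * indicator U y \<le> exp (real k * g y)" for y
        by (auto simp: U_def indicator_def intro!: mult_left_mono)
    qed
    finally show "exp (real k * (v - 3 * e)) \<le> Zk k" .
  qed
  have "\<forall>\<^sub>F k in sequentially. ln (real N) / e \<le> real k"
    by (meson eventually_sequentiallyI real_arch_simple of_nat_mono order_trans)
  then have "\<forall>\<^sub>F k in sequentially. norm (ln (Zk k) / real k - v) < r"
    using ub lb eventually_ge_at_top[of 1]
  proof eventually_elim
    fix k :: nat
    assume k: "ln (real N) / e \<le> real k" "Zk k \<le> real N * exp (real k * (v + 2 * e))"
      "exp (real k * (v - 3 * e)) \<le> Zk k" "1 \<le> k"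
    have pos: "0 < Zk k" using k(3) exp_gt_zero less_le_trans by blast
    have "ln (Zk k) \<le> ln (real N * exp (real k * (v + 2 * e)))"
      using k(2) pos by (subst ln_le_cancel_iff) auto
    also have "\<dots> = ln (real N) + real k * (v + 2 * e)" by (simp add: ln_mult N_def)
    also have "\<dots> \<le> real k * e + real k * (v + 2 * e)" using k(1) e by (simp add: field_simps)
    finally have 1: "ln (Zk k) / real k \<le> v + 3 * e" using k(4) by (simp add: field_simps)
    have "real k * (v - 3 * e) \<le> ln (Zk k)"
      using k(3) pos by (metis exp_le_cancel_iff exp_ln)
    then have 2: "v - 3 * e \<le> ln (Zk k) / real k" using k(4) by (simp add: field_simps)
    show "norm (ln (Zk k) / real k - v) < r"
      using 1 2 r by (simp add: e_def abs_less_iff)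
  qed
  then show "\<exists>n0. \<forall>k\<ge>n0. norm (ln (\<integral>x. exp (real k * g x) \<partial>P k) / real k - vsup J g) < r"
    unfolding eventually_sequentially Zk_def v_def .
qed

section \<open>Log-moment generating functions and exponential tilting\<close>

definition mgf :: "'x measure \<Rightarrow> ('x \<Rightarrow> real) \<Rightarrow> real" where
  "mgf Q h = (\<integral>x. exp (h x) \<partial>Q)"

definition tilt :: "'x measure \<Rightarrow> ('x \<Rightarrow> real) \<Rightarrow> 'x measure" where
  "tilt Q h = density Q (\<lambda>x. ennreal (exp (h x) / mgf Q h))"

lemma PM_measure_space [simp]: "Q \<in> PM \<Longrightarrow> measure Q (space Q) = 1"
  by (rule prob_space.prob_space[OF PM_prob])

lemma Cb_measurable_PM: "Q \<in> PM \<Longrightarrow> f \<in> Cb \<Longrightarrow> f \<in> borel_measurable Q"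
  by (simp add: Cb_measurable PM_measurable)

lemma mgf_bounds:
  assumes "Q \<in> PM" "h \<in> Cb" shows "exp (- supn h) \<le> mgf Q h" "mgf Q h \<le> exp (supn h)"
proof -
  have b: "- supn h \<le> h x" "h x \<le> supn h" for x
    using Cb_abs_le[OF assms(2), of x] by auto
  have "(\<integral>x. exp (- supn h) \<partial>Q) \<le> mgf Q h"
    unfolding mgf_def using assms b by (intro integral_mono_PM Cb_exp) auto
  then show "exp (- supn h) \<le> mgf Q h" using assms(1) by simp
  have "mgf Q h \<le> (\<integral>x. exp (supn h) \<partial>Q)"
    unfolding mgf_def using assms b by (intro integral_mono_PM Cb_exp) auto
  then show "mgf Q h \<le> exp (supn h)" using assms(1) by simp
qed

lemma mgf_pos: "Q \<in> PM \<Longrightarrow> h \<in> Cb \<Longrightarrow> 0 < mgf Q h"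
  using mgf_bounds(1)[of Q h] exp_gt_zero[of "- supn h"] by linarith

lemma ln_le_of_le_exp: "a \<le> exp b \<Longrightarrow> 0 < a \<Longrightarrow> ln a \<le> b"
  for a b :: real
  using ln_mono[of a "exp b"] by simp

lemma ln_mgf_abs_le:
  assumes "Q \<in> PM" "h \<in> Cb" shows "\<bar>ln (mgf Q h)\<bar> \<le> supn h"
proof -
  have "ln (mgf Q h) \<le> supn h"
    using mgf_bounds(2)[OF assms] mgf_pos[OF assms] by (rule ln_le_of_le_exp)
  moreover have "- supn h \<le> ln (mgf Q h)"
    using mgf_bounds(1)[OF assms] mgf_pos[OF assms] by (simp add: ln_ge_iff)
  ultimately show ?thesis by auto
qed

context
  fixes Q :: "'x::topological_space measure" and h :: "'x \<Rightarrow> real"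
  assumes Q: "Q \<in> PM" and h: "h \<in> Cb"
begin

lemma tilt_integral:
  assumes f: "f \<in> Cb" shows "(\<integral>x. f x \<partial>tilt Q h) = (\<integral>x. exp (h x) * f x \<partial>Q) / mgf Q h"
proof -
  have "(\<integral>x. f x \<partial>tilt Q h) = (\<integral>x. (exp (h x) / mgf Q h) * f x \<partial>Q)"
    unfolding tilt_def
  proof (rule integral_real_density)
    show "(\<lambda>x. exp (h x) / mgf Q h) \<in> borel_measurable Q"
      by (intro borel_measurable_divide borel_measurable_const Cb_measurable_PM[OF Q Cb_exp[OF h]])
    show "AE x in Q. 0 \<le> exp (h x) / mgf Q h" using mgf_pos[OF Q h] by (intro AE_I2) simp
  qed (rule Cb_measurable_PM[OF Q f])
  also have "\<dots> = (\<integral>x. (exp (h x) * f x) / mgf Q h \<partial>Q)" by simp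
  finally show ?thesis by simp
qed

lemma tilt_PM: "tilt Q h \<in> PM"
proof -
  have m: "(\<lambda>x. exp (h x) / mgf Q h) \<in> borel_measurable Q"
    by (intro borel_measurable_divide borel_measurable_const Cb_measurable_PM[OF Q Cb_exp[OF h]])
  have "emeasure (tilt Q h) (space (tilt Q h)) = (\<integral>\<^sup>+x. ennreal (exp (h x) / mgf Q h) \<partial>Q)"
    unfolding tilt_def using m by (simp add: emeasure_density cong: nn_integral_cong_simp)
  also have "\<dots> = ennreal (\<integral>x. exp (h x) / mgf Q h \<partial>Q)"
    using Cb_integrable[OF Q Cb_exp[OF h]] mgf_pos[OF Q h]
    by (intro nn_integral_eq_integral) auto
  also have "(\<integral>x. exp (h x) / mgf Q h \<partial>Q) = 1"
    using mgf_pos[OF Q h] by (simp add: mgf_def)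
  finally show ?thesis by (simp add: PM_iff prob_spaceI tilt_def PM_sets[OF Q])
qed

lemma mgf_add:
  assumes u: "u \<in> Cb" shows "mgf Q (\<lambda>x. h x + u x) = mgf Q h * mgf (tilt Q h) u"
  using tilt_integral[OF Cb_exp[OF u]] mgf_pos[OF Q h] by (simp add: mgf_def exp_add)

lemma ln_mgf_add:
  assumes u: "u \<in> Cb" shows "ln (mgf Q (\<lambda>x. h x + u x)) = ln (mgf Q h) + ln (mgf (tilt Q h) u)"
  unfolding mgf_add[OF u] using mgf_pos[OF Q h] mgf_pos[OF tilt_PM u] by (rule ln_mult_pos)

end

text \<open>A first-order expansion with explicit error that avoids differentiating
  \<open>mgf\<close>: exp u \<le> 1 + u + u^2 for u \<le> 1, and ln x \<le> x - 1. This one-sided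
  estimate serves both the stationarity condition in \<open>tilting\<close> and the Chernoff bounds
  in \<open>lower_bound_tilted\<close>.\<close>

lemma ln_mgf_le_mean:
  assumes Q: "Q \<in> PM" and u: "u \<in> Cb" "\<And>x. \<bar>u x\<bar> \<le> c" "c \<le> 1"
  shows "ln (mgf Q u) \<le> (\<integral>x. u x \<partial>Q) + c\<^sup>2"
proof -
  have "mgf Q u \<le> (\<integral>x. (1 + c\<^sup>2) + u x \<partial>Q)"
    unfolding mgf_def
  proof (rule integral_mono_PM[OF Q])
    show "(\<lambda>x. (1 + c\<^sup>2) + u x) \<in> Cb" using u by auto
    fix x
    have 1: "exp (u x) \<le> 1 + u x + (u x)\<^sup>2"
    proof (cases "0 \<le> u x")
      case True
      then show ?thesis using exp_bound[of "u x"] u(2)[of x] u(3) by auto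
    next
      case False
      have "exp (u x) \<le> 1 / (1 - u x)"
      proof -
        have "1 - u x \<le> exp (- u x)" using exp_ge_add_one_self[of "- u x"] by simp
        then have "1 / exp (- u x) \<le> 1 / (1 - u x)" using False by (intro divide_left_mono) auto
        then show ?thesis by (simp add: exp_minus field_simps)
      qed
      also have "\<dots> \<le> 1 + u x + (u x)\<^sup>2"
      proof -
        \<comment> \<open>(1 + u + u^2)(1 - u) = 1 - u^3, which is at least 1 for negative
          u.\<close>
        have "(u x) ^ 3 \<le> 0" using False by (simp add: power_le_zero_eq)
        then have "1 \<le> (1 + u x + (u x)\<^sup>2) * (1 - u x)"
          by (simp add: algebra_simps power2_eq_square power3_eq_cube)
        then show ?thesis using False by (simp add: divide_le_eq)
      qed
      finally show ?thesis .
    qed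
    have "\<bar>u x\<bar>\<^sup>2 \<le> c\<^sup>2" using u(2)[of x] by (intro power_mono) auto
    then show "exp (u x) \<le> 1 + c\<^sup>2 + u x" using 1 by simp
  qed (use u in auto)
  also have "\<dots> = 1 + c\<^sup>2 + (\<integral>x. u x \<partial>Q)"
    using Cb_integrable[OF Q u(1)] integral_const_PM[OF Q, of "1 + c\<^sup>2"]
      prob_space.finite_measure[OF PM_prob[OF Q]]
    by (subst Bochner_Integration.integral_add) (auto intro!: Cb_integrable[OF Q])
  finally have "mgf Q u - 1 \<le> (\<integral>x. u x \<partial>Q) + c\<^sup>2" by simp
  moreover have "ln (mgf Q u) \<le> mgf Q u - 1" using mgf_pos[OF Q u(1)] by (rule ln_le_minus_one)
  ultimately show ?thesis by linarith
qed

lemma mean_le_ln_mgf: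
  assumes Q: "Q \<in> PM" and u: "u \<in> Cb" shows "(\<integral>x. u x \<partial>Q) \<le> ln (mgf Q u)"
proof -
  define m where "m = (\<integral>x. u x \<partial>Q)"
  have c1: "(\<lambda>x. exp m * (1 + (u x - m))) \<in> Cb"
    using u by (intro Cb_scale Cb_add Cb_diff Cb_const)
  have c2: "(\<lambda>x. 1 + (u x - m)) \<in> Cb" "(\<lambda>x. u x - m) \<in> Cb"
    using u by (auto intro!: Cb_add Cb_diff)
  have "(\<integral>x. 1 + (u x - m) \<partial>Q) = 1"
    using Cb_integrable[OF Q u] Cb_integrable[OF Q c2(2)] Cb_integrable[OF Q Cb_const]
      integral_const_PM[OF Q, of 1] integral_const_PM[OF Q, of m]
    by (subst Bochner_Integration.integral_add; (subst Bochner_Integration.integral_diff)?) (auto simp: m_def)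
  then have "exp m = (\<integral>x. exp m * (1 + (u x - m)) \<partial>Q)" by simp
  also have "\<dots> \<le> mgf Q u"
    unfolding mgf_def
  proof (rule integral_mono_PM[OF Q c1 Cb_exp[OF u]])
    fix x
    have "exp m * (1 + (u x - m)) \<le> exp m * exp (u x - m)"
      by (intro mult_left_mono exp_ge_add_one_self) auto
    then show "exp m * (1 + (u x - m)) \<le> exp (u x)" by (simp add: exp_add[symmetric])
  qed
  finally show ?thesis using mgf_pos[OF Q u] by (simp add: ln_ge_iff m_def[symmetric])
qed

text \<open>The Donsker-Varadhan inequality: the bracket is the relative entropy of
  \<open>tilt Q g\<close> with respect to Q.\<close>

lemma tilt_mean_le:
  assumes Q: "Q \<in> PM" and g: "g \<in> Cb" and h: "h \<in> Cb"
  shows "(\<integral>x. h x \<partial>tilt Q g) \<le> ((\<integral>x. g x \<partial>tilt Q g) - ln (mgf Q g)) + ln (mgf Q h)"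
proof -
  have hg: "(\<lambda>x. h x - g x) \<in> Cb" using g h by auto
  have "(\<integral>x. h x - g x \<partial>tilt Q g) \<le> ln (mgf (tilt Q g) (\<lambda>x. h x - g x))"
    by (rule mean_le_ln_mgf[OF tilt_PM[OF Q g] hg])
  also have "\<dots> = ln (mgf Q h) - ln (mgf Q g)"
    using ln_mgf_add[OF Q g hg] by simp
  finally show ?thesis
    using Cb_integrable[OF tilt_PM[OF Q g] h] Cb_integrable[OF tilt_PM[OF Q g] g] by simp
qed

section \<open>Empirical measures\<close>

text \<open>As an image of the uniform measure on the indices, the empirical measure inherits
  countable additivity and a formula for integrals; n \<ge> 1 excludes division by 0.\<close>

lemma empirical_eq_distr:
  fixes x :: "nat \<Rightarrow> 'x::topological_space"
  assumes "n \<ge> 1"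
  shows "empirical n x = distr (uniform_count_measure {..<n}) borel x"
proof -
  let ?N = "distr (uniform_count_measure {..<n}) borel x"
  have x: "x \<in> measurable (uniform_count_measure {..<n}) borel"
    by (auto simp: measurable_def uniform_count_measure_def)
  have eq: "emeasure ?N A = (\<Sum>i<n. indicator A (x i)) / of_nat n" if "A \<in> sets borel" for A
  proof -
    have "emeasure ?N A = emeasure (uniform_count_measure {..<n}) (x -` A \<inter> {..<n})"
      using x that by (simp add: emeasure_distr space_uniform_count_measure)
    also have "\<dots> = ennreal (card (x -` A \<inter> {..<n}) / card {..<n})"
      by (subst emeasure_uniform_count_measure) auto
    also have "\<dots> = of_nat (card (x -` A \<inter> {..<n})) / of_nat n"
      using assms by (simp add: divide_ennreal[symmetric] ennreal_of_nat_eq_real_of_nat)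
    also have "of_nat (card (x -` A \<inter> {..<n})) = (\<Sum>i<n. indicator A (x i) :: ennreal)"
      by (simp add: indicator_def of_bool_def sum.If_cases vimage_def Int_def conj_commute)
    finally show ?thesis .
  qed
  have "empirical n x = measure_of UNIV (sets borel) (emeasure ?N)"
    unfolding empirical_def
    by (rule measure_of_eq) (use eq sets.sigma_sets_eq[of "borel :: 'x measure"] in auto)
  also have "\<dots> = ?N"
    using measure_of_of_measure[of ?N] by simp
  finally show ?thesis .
qed

lemma empirical_PM:
  assumes "n \<ge> 1" shows "empirical n (x :: nat \<Rightarrow> 'x::topological_space) \<in> PM"
proof -
  interpret prob_space "uniform_count_measure {..<n}"
    using assms by (intro prob_space_uniform_count_measure) (auto simp: lessThan_empty_iff)
  show ?thesis
    unfolding empirical_eq_distr[OF assms] PM_iff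
  proof
    show "prob_space (distr (uniform_count_measure {..<n}) borel x)"
      by (rule prob_space_distr) (auto simp: measurable_def uniform_count_measure_def)
  qed simp
qed

lemma empirical_integral:
  assumes "n \<ge> 1" "f \<in> Cb" shows "(\<integral>y. f y \<partial>empirical n x) = (\<Sum>i<n. f (x i)) / real n"
proof -
  have "(\<integral>y. f y \<partial>empirical n x) = (\<integral>i. f (x i) \<partial>uniform_count_measure {..<n})"
    unfolding empirical_eq_distr[OF assms(1)] using Cb_measurable[OF assms(2)]
    by (intro integral_distr) (auto simp: measurable_def uniform_count_measure_def)
  also have "\<dots> = (\<Sum>i<n. f (x i)) / real n"
    using integral_uniform_count_measure[of "{..<n}" "\<lambda>i. f (x i)"] by simp
  finally show ?thesis .
qed

lemma empirical_measurable:
  fixes Q :: "nat \<Rightarrow> 'x::{metric_space,second_countable_topology} measure"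
  assumes "n \<ge> 1" "\<And>i. Q i \<in> PM"
  shows "empirical n \<in> measurable (PiM {..<n} Q) (prob_algebra borel)"
proof (rule measurable_prob_algebraI_detf)
  fix j
  have "(\<lambda>\<omega>. (\<Sum>i<n. detf j (\<omega> i)) / real n) \<in> borel_measurable (PiM {..<n} Q)"
  proof (intro borel_measurable_divide borel_measurable_sum borel_measurable_const)
    fix i assume "i \<in> {..<n}"
    then have "(\<lambda>\<omega>. \<omega> i) \<in> measurable (PiM {..<n} Q) (Q i)"
      by (rule measurable_component_singleton)
    moreover have "detf j \<in> borel_measurable (Q i)"
      by (rule Cb_measurable_PM[OF assms(2) detf_Cb])
    ultimately show "(\<lambda>\<omega>. detf j (\<omega> i)) \<in> borel_measurable (PiM {..<n} Q)"
      by (rule measurable_compose)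
  qed
  then show "(\<lambda>\<omega>. \<integral>x. detf j x \<partial>empirical n \<omega>) \<in> borel_measurable (PiM {..<n} Q)"
    unfolding empirical_integral[OF assms(1) detf_Cb] .
qed (use empirical_PM[OF assms(1)] in auto)

section \<open>The two-parameter system\<close>

locale kn_system =
  fixes z :: "nat \<Rightarrow> nat \<Rightarrow> 'z::polish_space"
    and \<mu> :: "'z measure"
    and P :: "nat \<Rightarrow> 'z \<Rightarrow> 'x::polish_space measure"
    and J :: "'z \<Rightarrow> 'x \<Rightarrow> ennreal"
  assumes mu: "\<mu> \<in> PM"
    and conv: "f \<in> Cb \<Longrightarrow> (\<lambda>n. (\<Sum>i<n. f (z n i)) / real n) \<longlonglongrightarrow> (\<integral>y. f y \<partial>\<mu>)"
    and fel: "k \<ge> 1 \<Longrightarrow> feller (P k)"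
    and ldp: "k_LDP (\<lambda>k. P k y) (J y)"
begin

lemma P_PM: "k \<ge> 1 \<Longrightarrow> P k y \<in> PM"
  using fel by (simp add: feller_def)

lemma P_cont: "k \<ge> 1 \<Longrightarrow> f \<in> Cb \<Longrightarrow> continuous_on UNIV (\<lambda>y. \<integral>x. f x \<partial>P k y)"
  using fel by (simp add: feller_def)

lemma rate_fn_J: "rate_fn (J y)"
  using ldp P_PM by (rule k_LDP_rate_fn)

definition cgf :: "nat \<Rightarrow> ('x \<Rightarrow> real) \<Rightarrow> 'z \<Rightarrow> real" where
  "cgf k h y = ln (mgf (P k y) h)"

definition psi :: "nat \<Rightarrow> ('x \<Rightarrow> real) \<Rightarrow> real" where
  "psi k h = (\<integral>y. cgf k h y \<partial>\<mu>)"

text \<open>The speed k is built in: this is the quantity that Varadhan's lemma sends to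
  \<open>vsup (J y) h\<close>.\<close>

definition lamz :: "nat \<Rightarrow> ('x \<Rightarrow> real) \<Rightarrow> 'z \<Rightarrow> real" where
  "lamz k h y = cgf k (\<lambda>x. real k * h x) y / real k"

definition lam :: "nat \<Rightarrow> ('x \<Rightarrow> real) \<Rightarrow> real" where
  "lam k h = (\<integral>y. lamz k h y \<partial>\<mu>)"

definition p :: "('x \<Rightarrow> real) \<Rightarrow> real" where
  "p h = (\<integral>y. vsup (J y) h \<partial>\<mu>)"

definition tmean :: "nat \<Rightarrow> ('x \<Rightarrow> real) \<Rightarrow> ('x \<Rightarrow> real) \<Rightarrow> 'z \<Rightarrow> real" where
  "tmean k g f y = (\<integral>x. f x \<partial>tilt (P k y) g)"

section \<open>Continuity in y and the limit as k tends to infinity\<close>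

lemma cgf_abs_le: "k \<ge> 1 \<Longrightarrow> h \<in> Cb \<Longrightarrow> \<bar>cgf k h y\<bar> \<le> supn h"
  unfolding cgf_def by (intro ln_mgf_abs_le P_PM)

lemma mgf_cont: "k \<ge> 1 \<Longrightarrow> h \<in> Cb \<Longrightarrow> continuous_on UNIV (\<lambda>y. mgf (P k y) h)"
  unfolding mgf_def by (intro P_cont) auto

lemma cgf_Cb: "k \<ge> 1 \<Longrightarrow> h \<in> Cb \<Longrightarrow> cgf k h \<in> Cb"
proof (rule CbI)
  assume k: "k \<ge> 1" and h: "h \<in> Cb"
  have "mgf (P k y) h \<noteq> 0" for y using mgf_pos[OF P_PM[OF k] h, of y] by simp
  then show "continuous_on UNIV (cgf k h)"
    unfolding cgf_def using mgf_cont[OF k h] by (intro continuous_on_ln) auto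
qed (rule cgf_abs_le)

lemma lamz_Cb: "k \<ge> 1 \<Longrightarrow> h \<in> Cb \<Longrightarrow> lamz k h \<in> Cb"
  unfolding lamz_def using Cb_scale[OF cgf_Cb[OF _ Cb_scale], of k h "1 / real k"] by simp

lemma lam_eq_psi: "lam k h = psi k (\<lambda>x. real k * h x) / real k"
  unfolding lam_def lamz_def psi_def by simp

lemma lamz_abs_le:
  assumes "k \<ge> 1" "h \<in> Cb" shows "\<bar>lamz k h y\<bar> \<le> supn h"
proof -
  have "supn (\<lambda>x. real k * h x) \<le> real k * supn h"
    by (rule supn_le) (simp add: abs_mult mult_left_mono Cb_abs_le[OF assms(2)])
  then have "\<bar>cgf k (\<lambda>x. real k * h x) y\<bar> \<le> real k * supn h"
    using cgf_abs_le[OF assms(1) Cb_scale[OF assms(2), of "real k"], of y] by linarith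
  then show ?thesis using assms(1) by (simp add: lamz_def field_simps)
qed

lemma lamz_tendsto: "h \<in> Cb \<Longrightarrow> (\<lambda>k. lamz k h y) \<longlonglongrightarrow> vsup (J y) h"
  using Varadhan[OF ldp P_PM, of h y] by (simp add: lamz_def cgf_def mgf_def)

text \<open>Measurability in y is inherited from the continuous functions \<open>lamz k h\<close>,
  of which this is the pointwise limit. The shift to \<open>Suc k\<close> skips k = 0, about which
  the Feller hypothesis says nothing.\<close>

lemma vsup_measurable: "h \<in> Cb \<Longrightarrow> (\<lambda>y. vsup (J y) h) \<in> borel_measurable borel"
proof (rule borel_measurable_LIMSEQ_real)
  assume h: "h \<in> Cb"
  show "(\<lambda>k. lamz (Suc k) h y) \<longlonglongrightarrow> vsup (J y) h" for y
    using lamz_tendsto[OF h] by (rule LIMSEQ_Suc)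
  show "lamz (Suc k) h \<in> borel_measurable borel" for k
    using lamz_Cb[OF _ h, of "Suc k"] by (intro Cb_measurable) auto
qed

lemma vsup_abs_le: "h \<in> Cb \<Longrightarrow> \<bar>vsup (J y) h\<bar> \<le> supn h"
  by (rule rate_fn.vsup_abs_le[OF rate_fn_J])

lemma vsup_integrable: "h \<in> Cb \<Longrightarrow> integrable \<mu> (\<lambda>y. vsup (J y) h)"
  by (rule bounded_integrable_PM[OF mu vsup_measurable vsup_abs_le])

lemma lam_tendsto: assumes h: "h \<in> Cb" shows "(\<lambda>k. lam k h) \<longlonglongrightarrow> p h"
proof -
  have "(\<lambda>k. lam (Suc k) h) \<longlonglongrightarrow> p h"
    unfolding lam_def p_def
  proof (rule integral_dominated_convergence[where w = "\<lambda>_. supn h"])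
    show "(\<lambda>y. vsup (J y) h) \<in> borel_measurable \<mu>"
      using vsup_measurable[OF h] by (simp add: PM_measurable[OF mu])
    show "lamz (Suc k) h \<in> borel_measurable \<mu>" for k
      using lamz_Cb[OF _ h, of "Suc k"] by (intro Cb_measurable_PM[OF mu]) simp
    show "integrable \<mu> (\<lambda>_. supn h)" using mu by (intro Cb_integrable) auto
    show "AE y in \<mu>. (\<lambda>k. lamz (Suc k) h y) \<longlonglongrightarrow> vsup (J y) h"
      using lamz_tendsto[OF h, THEN LIMSEQ_Suc] by simp
    show "AE y in \<mu>. norm (lamz (Suc k) h y) \<le> supn h" for k
      using lamz_abs_le[OF _ h, of "Suc k"] by simp
  qed
  then show ?thesis by (rule LIMSEQ_imp_Suc)
qed

lemma dini_vsup: "dini_functional (vsup (J y))"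
  unfolding dini_functional_def
  using rate_fn.vsup_dini[OF rate_fn_J] rate_fn.vsup_le_const[OF rate_fn_J] by blast

text \<open>Dini convergence on the fibres passes to the integral by dominated convergence, with
  \<open>supn (F 0)\<close> as a bound common to all y.\<close>

lemma dini_p: "dini_functional p"
  unfolding dini_functional_def
proof (intro conjI ballI allI impI)
  fix h :: "'x \<Rightarrow> real" and c assume h: "h \<in> Cb" and c: "\<forall>x. h x \<le> c"
  show "p h \<le> c"
    unfolding p_def
    using c by (intro integral_le_const_PM[OF mu vsup_measurable[OF h] vsup_abs_le[OF h]]
        rate_fn.vsup_le_const[OF rate_fn_J]) auto
next
  fix F :: "nat \<Rightarrow> 'x \<Rightarrow> real"
  assume F: "\<forall>n. F n \<in> Cb" "\<forall>x. decseq (\<lambda>n. F n x)" "\<forall>x. (\<lambda>n. F n x) \<longlonglongrightarrow> 0"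
  have F_le: "\<bar>F n x\<bar> \<le> supn (F 0)" for n x
  proof -
    have "0 \<le> F n x" "F n x \<le> F 0 x" using decseq_ge[of "\<lambda>n. F n x" 0 n] F by (auto simp: decseq_def)
    then show ?thesis using Cb_abs_le[of "F 0" x] F(1) by auto
  qed
  have "(\<lambda>n. p (F n)) \<longlonglongrightarrow> (\<integral>y. 0 \<partial>\<mu>)"
    unfolding p_def
  proof (rule integral_dominated_convergence[where w = "\<lambda>_. supn (F 0)"])
    show "(\<lambda>y. vsup (J y) (F n)) \<in> borel_measurable \<mu>" for n
      using vsup_measurable[of "F n"] F(1) by (simp add: PM_measurable[OF mu])
    show "integrable \<mu> (\<lambda>_. supn (F 0))" using mu by (intro Cb_integrable) auto
    show "AE y in \<mu>. (\<lambda>n. vsup (J y) (F n)) \<longlonglongrightarrow> 0"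
      using F dini_vsup unfolding dini_functional_def by blast
    show "AE y in \<mu>. norm (vsup (J y) (F n)) \<le> supn (F 0)" for n
    proof (rule AE_I2)
      fix y
      have "supn (F n) \<le> supn (F 0)" by (rule supn_le) (rule F_le)
      then show "norm (vsup (J y) (F n)) \<le> supn (F 0)"
        using vsup_abs_le[of "F n" y] F(1) by simp
    qed
  qed simp
  then show "(\<lambda>n. p (F n)) \<longlonglongrightarrow> 0" by simp
qed

lemma tmean_Cb: assumes "k \<ge> 1" "g \<in> Cb" "f \<in> Cb" shows "tmean k g f \<in> Cb"
proof (rule CbI)
  have eq: "tmean k g f y = (\<integral>x. exp (g x) * f x \<partial>P k y) / mgf (P k y) g" for y
    unfolding tmean_def using tilt_integral[OF P_PM[OF assms(1)] assms(2,3)] .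
  have "mgf (P k y) g \<noteq> 0" for y using mgf_pos[OF P_PM[OF assms(1)] assms(2), of y] by simp
  then have "continuous_on UNIV (\<lambda>y. (\<integral>x. exp (g x) * f x \<partial>P k y) / mgf (P k y) g)"
    using assms by (intro continuous_on_divide P_cont mgf_cont Cb_mult Cb_exp) auto
  then show "continuous_on UNIV (tmean k g f)" by (simp add: eq[abs_def])
  show "\<bar>tmean k g f y\<bar> \<le> supn f" for y
    unfolding tmean_def by (intro Cb_integral_abs_le tilt_PM P_PM assms)
qed

text \<open>The integrated tilted mean acts as the derivative of \<open>psi k\<close> at h in
  direction u, and the error c^2 on the fibres is uniform in y.\<close>

lemma psi_add_le:
  assumes k: "k \<ge> 1" and h: "h \<in> Cb" and u: "u \<in> Cb" "\<And>x. \<bar>u x\<bar> \<le> c" "c \<le> 1"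
  shows "psi k (\<lambda>x. h x + u x) \<le> psi k h + (\<integral>y. tmean k h u y \<partial>\<mu>) + c\<^sup>2"
proof -
  have hu: "(\<lambda>x. h x + u x) \<in> Cb" using h u by auto
  have "psi k (\<lambda>x. h x + u x) \<le> (\<integral>y. (cgf k h y + tmean k h u y) + c\<^sup>2 \<partial>\<mu>)"
    unfolding psi_def
  proof (rule integral_mono_PM[OF mu])
    show "(\<lambda>y. (cgf k h y + tmean k h u y) + c\<^sup>2) \<in> Cb"
      by (intro Cb_add Cb_const cgf_Cb tmean_Cb k h u)
    fix y
    show "cgf k (\<lambda>x. h x + u x) y \<le> (cgf k h y + tmean k h u y) + c\<^sup>2"
      using ln_mgf_add[OF P_PM[OF k] h u(1)] ln_mgf_le_mean[OF tilt_PM[OF P_PM[OF k] h] u]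
      by (simp add: cgf_def tmean_def)
  qed (rule cgf_Cb[OF k hu])
  also have "\<dots> = psi k h + (\<integral>y. tmean k h u y \<partial>\<mu>) + c\<^sup>2"
    unfolding psi_def
    using Cb_integrable[OF mu cgf_Cb[OF k h]] Cb_integrable[OF mu tmean_Cb[OF k h u(1)]]
      Cb_integrable[OF mu Cb_add[OF cgf_Cb[OF k h] tmean_Cb[OF k h u(1)]]]
      Cb_integrable[OF mu Cb_const[of "c\<^sup>2"]] integral_const_PM[OF mu, of "c\<^sup>2"]
    by (simp add: Bochner_Integration.integral_add)
  finally show ?thesis .
qed

lemma lamz_mono_add:
  assumes k: "k \<ge> 1" and h: "h \<in> Cb" and g: "g \<in> Cb" and d: "\<And>x. h x \<le> g x + d"
  shows "lamz k h y \<le> lamz k g y + d"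
proof -
  have "mgf (P k y) (\<lambda>x. real k * h x) \<le> mgf (P k y) (\<lambda>x. real k * (g x + d))"
    unfolding mgf_def using d h g
    by (intro integral_mono_PM[OF P_PM[OF k]] Cb_exp Cb_scale Cb_add) (auto intro: mult_left_mono)
  also have "\<dots> = mgf (P k y) (\<lambda>x. real k * g x) * exp (real k * d)"
    unfolding mgf_def by (simp add: distrib_left exp_add)
  finally have "cgf k (\<lambda>x. real k * h x) y \<le> ln (mgf (P k y) (\<lambda>x. real k * g x) * exp (real k * d))"
    unfolding cgf_def using mgf_pos[OF P_PM[OF k] Cb_scale[OF h]] by (intro ln_mono) auto
  also have "\<dots> = cgf k (\<lambda>x. real k * g x) y + real k * d"
    unfolding cgf_def using mgf_pos[OF P_PM[OF k] Cb_scale[OF g]] by (subst ln_mult_pos) auto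
  finally show ?thesis using k by (simp add: lamz_def field_simps)
qed

lemma lam_mono_add:
  assumes k: "k \<ge> 1" and h: "h \<in> Cb" and g: "g \<in> Cb" and d: "\<And>x. h x \<le> g x + d"
  shows "lam k h \<le> lam k g + d"
proof -
  have "lam k h \<le> (\<integral>y. lamz k g y + d \<partial>\<mu>)"
    unfolding lam_def using lamz_mono_add[OF assms]
    by (intro integral_mono_PM[OF mu] Cb_add lamz_Cb k h g) auto
  also have "\<dots> = lam k g + d"
    unfolding lam_def using Cb_integrable[OF mu lamz_Cb[OF k g]] integral_const_PM[OF mu, of d]
      Cb_integrable[OF mu Cb_const[of d]]
    by (simp add: Bochner_Integration.integral_add)
  finally show ?thesis .
qed

subsection \<open>Exponential moments of the empirical measure\<close>

abbreviation prodm :: "nat \<Rightarrow> nat \<Rightarrow> (nat \<Rightarrow> 'x) measure" where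
  "prodm k n \<equiv> PiM {..<n} (\<lambda>i. P k (z n i))"

definition expmom :: "nat \<Rightarrow> nat \<Rightarrow> ('x \<Rightarrow> real) \<Rightarrow> real" where
  "expmom k n h = (\<integral>\<omega>. exp (\<Sum>i<n. h (\<omega> i)) \<partial>prodm k n)"

lemma prod_prob: "k \<ge> 1 \<Longrightarrow> prob_space (prodm k n)"
  using P_PM PM_prob by (intro prob_space_PiM) blast

lemma sum_coord_measurable:
  assumes "k \<ge> 1" "f \<in> Cb" shows "(\<lambda>\<omega>. \<Sum>i<n. f (\<omega> i)) \<in> borel_measurable (prodm k n)"
proof (rule borel_measurable_sum)
  fix i assume "i \<in> {..<n}"
  then have "(\<lambda>\<omega>. \<omega> i) \<in> measurable (prodm k n) (P k (z n i))"
    by (rule measurable_component_singleton)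
  moreover have "f \<in> borel_measurable (P k (z n i))"
    by (rule Cb_measurable_PM[OF P_PM[OF assms(1)] assms(2)])
  ultimately show "(\<lambda>\<omega>. f (\<omega> i)) \<in> borel_measurable (prodm k n)"
    by (rule measurable_compose)
qed

lemma exp_sum_integrable:
  assumes "k \<ge> 1" "h \<in> Cb" shows "integrable (prodm k n) (\<lambda>\<omega>. exp (\<Sum>i<n. h (\<omega> i)))"
proof -
  interpret prob_space "prodm k n" by (rule prod_prob[OF assms(1)])
  show ?thesis
  proof (rule integrable_const_bound[where B = "exp (\<Sum>i<n. supn h)"])
    have "(\<Sum>i<n. h (\<omega> i)) \<le> (\<Sum>i<n. supn h)" for \<omega>
      using Cb_abs_le[OF assms(2)] by (intro sum_mono) (auto simp: abs_le_iff)
    then show "AE \<omega> in prodm k n. norm (exp (\<Sum>i<n. h (\<omega> i))) \<le> exp (\<Sum>i<n. supn h)"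
      by (simp del: sum_constant)
    show "(\<lambda>\<omega>. exp (\<Sum>i<n. h (\<omega> i))) \<in> borel_measurable (prodm k n)"
      using sum_coord_measurable[OF assms] by measurable
  qed
qed

lemma expmom_eq_prod:
  assumes k: "k \<ge> 1" and h: "h \<in> Cb" shows "expmom k n h = (\<Prod>i<n. mgf (P k (z n i)) h)"
proof -
  interpret prod: product_prob_space "\<lambda>i. P k (z n i)"
    using P_PM[OF k] PM_prob by (intro product_prob_spaceI) blast
  have "expmom k n h = (\<integral>\<omega>. (\<Prod>i<n. exp (h (\<omega> i))) \<partial>prodm k n)"
    unfolding expmom_def by (simp add: exp_sum)
  also have "\<dots> = (\<Prod>i<n. \<integral>x. exp (h x) \<partial>P k (z n i))"
    using Cb_integrable[OF P_PM[OF k] Cb_exp[OF h]] by (intro prod.product_integral_prod) auto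
  finally show ?thesis by (simp add: mgf_def)
qed

lemma expmom_pos: "k \<ge> 1 \<Longrightarrow> h \<in> Cb \<Longrightarrow> 0 < expmom k n h"
  unfolding expmom_eq_prod by (intro prod_pos mgf_pos P_PM) auto

text \<open>Independence turns the log-moment into an average of \<open>cgf k h\<close> over the
  points z n i; it converges because the Feller property makes \<open>cgf k h\<close>
  continuous.\<close>

lemma ln_expmom_tendsto:
  assumes k: "k \<ge> 1" and h: "h \<in> Cb" shows "(\<lambda>n. ln (expmom k n h) / real n) \<longlonglongrightarrow> psi k h"
proof -
  have "ln (expmom k n h) = (\<Sum>i<n. cgf k h (z n i))" for n
    unfolding expmom_eq_prod[OF assms] cgf_def using mgf_pos[OF P_PM[OF k] h]
    by (intro ln_prod) (auto simp: less_imp_neq[symmetric])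
  then show ?thesis using conv[OF cgf_Cb[OF assms]] by (simp add: psi_def)
qed

end

section \<open>Auxiliary facts on extended logarithms, narrow neighbourhoods and interior
  maxima\<close>

lemma elog_le: "q \<le> exp s \<Longrightarrow> elog q \<le> ereal s"
  by (auto simp: elog_def intro!: ln_le_of_le_exp)

lemma elog_ge: "exp s \<le> q \<Longrightarrow> ereal s \<le> elog q"
  using exp_gt_zero[of s] by (auto simp: elog_def ln_ge_iff simp del: exp_gt_zero)

lemma elog_divide_le: "q \<le> exp (t * c) \<Longrightarrow> 0 < t \<Longrightarrow> elog q / ereal t \<le> ereal c"
  using ereal_divide_right_mono[OF elog_le[of q "t * c"], of "ereal t"] by simp

lemma elog_divide_ge: "exp (t * c) \<le> q \<Longrightarrow> 0 < t \<Longrightarrow> ereal c \<le> elog q / ereal t"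
  using ereal_divide_right_mono[OF elog_ge[of "t * c" q], of "ereal t"] by simp

lemma narrow_nbhd:
  assumes "openin narrow_topology V" "Q \<in> V"
  shows "\<exists>F e. finite F \<and> F \<subseteq> Cb \<and> 0 < e \<and>
    (\<forall>R\<in>PM. (\<forall>f\<in>F. \<bar>(\<integral>x. f x \<partial>R) - (\<integral>x. f x \<partial>Q)\<bar> < e) \<longrightarrow> R \<in> V)"
proof -
  have "generate_topology_on {{Q \<in> PM. (\<integral>x. f x \<partial>Q) \<in> U} | f U. f \<in> Cb \<and> open U} V"
    using assms unfolding narrow_topology_def openin_topology_generated_by_iff by simp
  then show ?thesis using assms(2)
  proof induction
    case Empty
    then show ?case by simp
  next
    case (Int a b)
    then obtain F e G e' where F: "finite F" "F \<subseteq> Cb" "0 < e"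
      "\<forall>R\<in>PM. (\<forall>f\<in>F. \<bar>(\<integral>x. f x \<partial>R) - (\<integral>x. f x \<partial>Q)\<bar> < e) \<longrightarrow> R \<in> a"
      and G: "finite G" "G \<subseteq> Cb" "0 < e'"
      "\<forall>R\<in>PM. (\<forall>f\<in>G. \<bar>(\<integral>x. f x \<partial>R) - (\<integral>x. f x \<partial>Q)\<bar> < e') \<longrightarrow> R \<in> b" by blast
    show ?case
    proof (intro exI[of _ "F \<union> G"] exI[of _ "min e e'"] conjI ballI impI)
      fix R :: "'a measure" assume R: "R \<in> PM" "\<forall>f\<in>F \<union> G. \<bar>(\<integral>x. f x \<partial>R) - (\<integral>x. f x \<partial>Q)\<bar> < min e e'"
      then show "R \<in> a \<inter> b" using F(4) G(4) by simp
    qed (use F G in auto)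
  next
    case (UN K)
    then obtain k where k: "k \<in> K" "Q \<in> k" by blast
    from UN(2)[OF k] show ?case using k(1) by (meson UnionI)
  next
    case (Basis s)
    then obtain f U where s: "s = {Q \<in> PM. (\<integral>x. f x \<partial>Q) \<in> U}" "f \<in> Cb" "open U" by auto
    then obtain e where e: "0 < e" "ball (\<integral>x. f x \<partial>Q) e \<subseteq> U"
      using Basis(2) by (auto simp: open_contains_ball)
    show ?case
    proof (intro exI[of _ "{f}"] exI[of _ e] conjI ballI impI)
      fix R :: "'a measure" assume R: "R \<in> PM" "\<forall>f\<in>{f}. \<bar>(\<integral>x. f x \<partial>R) - (\<integral>x. f x \<partial>Q)\<bar> < e"
      then have "(\<integral>x. f x \<partial>R) \<in> ball (\<integral>x. f x \<partial>Q) e" by (simp add: dist_real_def abs_minus_commute)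
      then show "R \<in> s" using e(2) R(1) s(1) by auto
    qed (use s e in auto)
  qed
qed

text \<open>Stationarity at an interior maximum without derivatives: both signs of s are used, and
  for small s the linear term beats the quadratic one.\<close>

lemma derivative_zero_of_quadratic_bound:
  fixes A :: real
  assumes "0 < d" "\<And>s. \<bar>s\<bar> < d \<Longrightarrow> s * A \<le> s\<^sup>2 * B" shows "A = 0"
proof (rule ccontr)
  assume A: "A \<noteq> 0"
  \<comment> \<open>The second bound makes \<open>s * (\<bar>B\<bar> + 1)\<close> at most half of
    \<open>\<bar>A\<bar>\<close>.\<close>
  define s where "s = min (d / 2) (\<bar>A\<bar> / (2 * (\<bar>B\<bar> + 1)))"
  have s: "0 < s" "s < d" "s \<le> \<bar>A\<bar> / (2 * (\<bar>B\<bar> + 1))" using assms(1) A by (auto simp: s_def)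
  have "s * \<bar>A\<bar> \<le> s\<^sup>2 * B"
    using assms(2)[of s] assms(2)[of "- s"] s by (cases "0 \<le> A") auto
  then have "\<bar>A\<bar> \<le> s * B" using s(1) by (simp add: power2_eq_square)
  also have "\<dots> \<le> s * (\<bar>B\<bar> + 1)" using s(1) by (intro mult_left_mono) auto
  also have "\<dots> \<le> \<bar>A\<bar> / (2 * (\<bar>B\<bar> + 1)) * (\<bar>B\<bar> + 1)" using s(3) by (intro mult_right_mono) auto
  also have "\<dots> = \<bar>A\<bar> / 2" by (simp add: field_simps)
  finally show False using A by simp
qed

context kn_system
begin

text \<open>Says \<open>I\<^sup>* Q \<le> a\<close> level by level, so that no supremum of a
  possibly unbounded set of reals is formed.\<close>

definition dual_le :: "real \<Rightarrow> 'x measure \<Rightarrow> bool" where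
  "dual_le a Q \<longleftrightarrow> (\<forall>h\<in>Cb. (\<integral>x. h x \<partial>Q) \<le> p h + a)"

section \<open>The upper bound\<close>

text \<open>The exponential Chebyshev inequality for each half-space of the cover, summed over the
  finite set H.\<close>

lemma emp_prob_le:
  assumes k: "k \<ge> 1" and n: "n \<ge> 1" and H: "finite H" "H \<subseteq> Cb"
    and B: "\<And>Q. Q \<in> B \<Longrightarrow> \<exists>h\<in>H. p h + a < (\<integral>x. h x \<partial>Q)"
  shows "emp_prob P z k n B \<le> (\<Sum>h\<in>H. expmom k n (\<lambda>x. real k * h x) * exp (- real k * real n * (p h + a)))"
proof -
  interpret prob_space "prodm k n" by (rule prod_prob[OF k])
  let ?A = "(\<lambda>\<omega>. empirical n \<omega>) -` B \<inter> space (prodm k n)"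
  let ?T = "\<lambda>h \<omega>. exp (\<Sum>i<n. real k * h (\<omega> i)) * exp (- real k * real n * (p h + a))"
  have intT: "integrable (prodm k n) (?T h)" if "h \<in> H" for h
    using H that by (intro integrable_mult_left exp_sum_integrable[OF k]) auto
  have T_int: "(\<integral>\<omega>. (\<Sum>h\<in>H. ?T h \<omega>) \<partial>prodm k n)
      = (\<Sum>h\<in>H. expmom k n (\<lambda>x. real k * h x) * exp (- real k * real n * (p h + a)))"
    using intT by (subst Bochner_Integration.integral_sum) (auto simp: expmom_def)
  show ?thesis
  proof (cases "?A \<in> sets (prodm k n)")
    case True
    have "emp_prob P z k n B = (\<integral>\<omega>. indicator ?A \<omega> \<partial>prodm k n)"
      using True by (simp add: emp_prob_def Let_def)
    also have "\<dots> \<le> (\<integral>\<omega>. (\<Sum>h\<in>H. ?T h \<omega>) \<partial>prodm k n)"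
    proof (rule integral_mono)
      show "integrable (prodm k n) (indicator ?A :: _ \<Rightarrow> real)"
        using True by (intro integrable_real_indicator) (auto simp: emeasure_eq_measure)
      show "integrable (prodm k n) (\<lambda>\<omega>. \<Sum>h\<in>H. ?T h \<omega>)"
        by (intro Bochner_Integration.integrable_sum intT)
      fix \<omega>
      show "indicator ?A \<omega> \<le> (\<Sum>h\<in>H. ?T h \<omega>)"
      proof (cases "\<omega> \<in> ?A")
        case True
        then have "empirical n \<omega> \<in> B" by simp
        then obtain h where h: "h \<in> H" "p h + a < (\<integral>x. h x \<partial>empirical n \<omega>)" using B by blast
        have "h \<in> Cb" using h(1) H(2) by blast
        then have "p h + a < (\<Sum>i<n. h (\<omega> i)) / real n"
          using h(2) unfolding empirical_integral[OF n \<open>h \<in> Cb\<close>] by simp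
        then have "real n * (p h + a) \<le> (\<Sum>i<n. h (\<omega> i))" using n by (simp add: field_simps)
        then have "real k * (real n * (p h + a)) \<le> real k * (\<Sum>i<n. h (\<omega> i))" by (rule mult_left_mono) simp
        then have "1 \<le> ?T h \<omega>"
          by (simp add: exp_add[symmetric] sum_distrib_left[symmetric] mult.assoc del: mult_minus_left)
        also have "\<dots> \<le> (\<Sum>h\<in>H. ?T h \<omega>)" using h(1) H(1) by (intro member_le_sum) auto
        finally show ?thesis using True by simp
      qed (auto intro!: sum_nonneg)
    qed
    finally show ?thesis by (simp only: T_int)
  next
    case False
    \<comment> \<open>\<open>measure\<close> has the default value 0 on sets outside the
      sigma-algebra.\<close>
    then have "emp_prob P z k n B = 0" by (simp add: emp_prob_def Let_def measure_notin_sets)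
    also have "0 \<le> (\<Sum>h\<in>H. expmom k n (\<lambda>x. real k * h x) * exp (- real k * real n * (p h + a)))"
      using H by (intro sum_nonneg mult_nonneg_nonneg less_imp_le[OF expmom_pos[OF k]]) auto
    finally show ?thesis .
  qed
qed

lemma upper_bound:
  assumes B: "B \<subseteq> PM"
    and sep: "\<And>Q. Q \<in> narrow_topology closure_of B \<Longrightarrow> \<exists>h\<in>Cb. p h + a < (\<integral>x. h x \<partial>Q)"
  shows "limsup (\<lambda>k. limsup (\<lambda>n. elog (emp_prob P z k n B) / ereal (real k * real n))) \<le> ereal (- a)"
proof (rule ereal_le_epsilon2)
  from finite_halfspace_cover[OF dini_p closedin_closure_of sep]
  obtain H where "finite H \<and> H \<subseteq> Cb \<and>
    (\<forall>Q\<in>narrow_topology closure_of B. \<exists>h\<in>H. p h + a < (\<integral>x. h x \<partial>Q))" ..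
  then have H: "finite H" "H \<subseteq> Cb"
    "\<forall>Q\<in>narrow_topology closure_of B. \<exists>h\<in>H. p h + a < (\<integral>x. h x \<partial>Q)" by simp_all
  have BH: "\<exists>h\<in>H. p h + a < (\<integral>x. h x \<partial>Q)" if "Q \<in> B" for Q
    using H(3) closure_of_subset[of B narrow_topology] B that by auto
  fix r :: real assume r: "0 < r"
  \<comment> \<open>The budget r is shared by the limit in k, the limit in n and the cardinality of
    H.\<close>
  define e where "e = r / 3"
  have e: "0 < e" using r by (simp add: e_def)
  have "\<forall>\<^sub>F k in sequentially. \<forall>h\<in>H. lam k h < p h + e"
    using H e by (intro eventually_ball_finite ballI order_tendstoD(2)[OF lam_tendsto]) auto
  then have "\<forall>\<^sub>F k in sequentially.
      limsup (\<lambda>n. elog (emp_prob P z k n B) / ereal (real k * real n)) \<le> ereal (- a + r)"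
    using eventually_ge_at_top[of 1]
  proof eventually_elim
    fix k :: nat assume k: "\<forall>h\<in>H. lam k h < p h + e" "1 \<le> k"
    have "\<forall>\<^sub>F n in sequentially. \<forall>h\<in>H. ln (expmom k n (\<lambda>x. real k * h x)) / real n < psi k (\<lambda>x. real k * h x) + real k * e"
      using H e k(2)
      by (intro eventually_ball_finite ballI order_tendstoD(2)[OF ln_expmom_tendsto]) auto
    moreover have "\<forall>\<^sub>F n in sequentially. (real (card H) + 1) \<le> exp (e * real n)"
    proof -
      have "filterlim (\<lambda>n. exp (e * real n)) at_top sequentially"
        using e by (intro filterlim_compose[OF exp_at_top] filterlim_tendsto_pos_mult_at_top[OF tendsto_const]
            filterlim_real_sequentially)
      then show ?thesis by (simp add: filterlim_at_top)
    qed
    ultimately have "\<forall>\<^sub>F n in sequentially. elog (emp_prob P z k n B) / ereal (real k * real n) \<le> ereal (- a + r)"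
      using eventually_ge_at_top[of 1]
    proof eventually_elim
      fix n :: nat
      assume n: "\<forall>h\<in>H. ln (expmom k n (\<lambda>x. real k * h x)) / real n < psi k (\<lambda>x. real k * h x) + real k * e"
        "real (card H) + 1 \<le> exp (e * real n)" "1 \<le> n"
      have kn: "0 < real k * real n" using k(2) n(3) by simp
      have term_le: "expmom k n (\<lambda>x. real k * h x) * exp (- real k * real n * (p h + a))
          \<le> exp (real k * real n * (- a + 2 * e))" if h: "h \<in> H" for h
      proof -
        have hC: "(\<lambda>x. real k * h x) \<in> Cb" using h H(2) by auto
        have "ln (expmom k n (\<lambda>x. real k * h x)) / real n < real k * lam k h + real k * e"
          using n(1) h k(2) by (simp add: lam_eq_psi)
        also have "\<dots> \<le> real k * (p h + e) + real k * e"
          using k h by (intro add_right_mono mult_left_mono) (auto intro: less_imp_le)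
        finally have "ln (expmom k n (\<lambda>x. real k * h x)) \<le> real k * real n * (p h + 2 * e)"
          using n(3) by (simp add: field_simps)
        then have "expmom k n (\<lambda>x. real k * h x) \<le> exp (real k * real n * (p h + 2 * e))"
          using expmom_pos[OF k(2) hC, of n] by (metis exp_le_cancel_iff exp_ln)
        then have "expmom k n (\<lambda>x. real k * h x) * exp (- real k * real n * (p h + a))
            \<le> exp (real k * real n * (p h + 2 * e)) * exp (- real k * real n * (p h + a))"
          by (rule mult_right_mono) simp
        also have "\<dots> = exp (real k * real n * (- a + 2 * e))"
          by (simp add: exp_add[symmetric] algebra_simps)
        finally show ?thesis .
      qed
      have "emp_prob P z k n B \<le> (\<Sum>h\<in>H. expmom k n (\<lambda>x. real k * h x) * exp (- real k * real n * (p h + a)))"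
        by (rule emp_prob_le[OF k(2) n(3) H(1,2) BH])
      also have "\<dots> \<le> (\<Sum>h\<in>H. exp (real k * real n * (- a + 2 * e)))"
        by (intro sum_mono term_le)
      also have "\<dots> \<le> exp (e * real n) * exp (real k * real n * (- a + 2 * e))"
        using n(2) by (simp add: mult_right_mono)
      also have "\<dots> \<le> exp (real k * real n * e) * exp (real k * real n * (- a + 2 * e))"
        using k(2) n(3) e by (intro mult_right_mono) (auto simp: mult.commute)
      also have "\<dots> = exp (real k * real n * (- a + r))"
        by (simp add: exp_add[symmetric] e_def algebra_simps)
      finally show "elog (emp_prob P z k n B) / ereal (real k * real n) \<le> ereal (- a + r)"
        by (rule elog_divide_le[OF _ kn])
    qed
    then show "limsup (\<lambda>n. elog (emp_prob P z k n B) / ereal (real k * real n)) \<le> ereal (- a + r)"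
      by (rule Limsup_bounded)
  qed
  then show "limsup (\<lambda>k. limsup (\<lambda>n. elog (emp_prob P z k n B) / ereal (real k * real n))) \<le> ereal (- a) + ereal r"
    using Limsup_bounded by fastforce
qed

section \<open>Tilting to a prescribed mean\<close>

lemma tmean_scale: "(\<integral>y. tmean k g (\<lambda>x. c * f x) y \<partial>\<mu>) = c * (\<integral>y. tmean k g f y \<partial>\<mu>)"
  by (simp add: tmean_def)

lemma lam_zero: "k \<ge> 1 \<Longrightarrow> lam k (\<lambda>_. 0) = 0"
  unfolding lam_def lamz_def cgf_def mgf_def using P_PM by simp

text \<open>The tilt \<open>t\<close> maximises \<open>t \<cdot> q - lam k (t \<cdot> f) - (\<eta>/2) \<bar>t\<bar>\<^sup>2\<close>; the quadratic penalty makes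
  the maximiser interior to a fixed box and keeps the resulting mean within \<open>\<eta> \<bar>t\<bar>\<close> of \<open>q\<close>, so
  that neither smoothness nor strict convexity of the limit \<open>p\<close> is needed.\<close>

lemma tilting:
  assumes Q: "Q \<in> PM" and dom: "dual_le a Q" and a: "0 \<le> a"
    and f: "\<And>j. f j \<in> Cb" and e: "0 < (e::real)"
  shows "\<forall>\<^sub>F k in sequentially. \<exists>t g. g = (\<lambda>x. \<Sum>j<d::nat. t j * f j x) \<and>
    (\<forall>j<d. \<bar>(\<integral>y. tmean k (\<lambda>x. real k * g x) (f j) y \<partial>\<mu>) - (\<integral>x. f j x \<partial>Q)\<bar> < e) \<and>
    (\<Sum>j<d. t j * (\<integral>y. tmean k (\<lambda>x. real k * g x) (f j) y \<partial>\<mu>)) - lam k g \<le> a + e"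
proof -
  define q where "q = (\<lambda>j. \<integral>x. f j x \<partial>Q)"
  define g where "g = (\<lambda>(t::nat \<Rightarrow> real) x. \<Sum>j<d. t j * f j x)"
  define C where "C = 1 + (\<Sum>j<d. supn (f j))"
  \<comment> \<open>The maximiser t will satisfy
    \<open>\<eta> / 2 * (t j)\<^sup>2 \<le> a + e\<close>. With this value
    \<open>(\<eta> * t j)\<^sup>2\<close> is at most \<open>e\<^sup>2 / 2\<close>, and R below is
    chosen so that t stays strictly inside the box.\<close>
  define \<eta> where "\<eta> = e\<^sup>2 / (4 * (a + e))"
  define R where "R = sqrt (2 * (a + e) / \<eta>) + 1"
  have ae: "0 < a + e" using a e by simp
  have \<eta>: "0 < \<eta>" using ae e by (simp add: \<eta>_def)
  have R1: "1 \<le> R" using \<eta> ae by (simp add: R_def)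
  have C1: "1 \<le> C" by (simp add: C_def sum_nonneg supn_nonneg f)
  have fC: "\<bar>f j x\<bar> \<le> C" if "j < d" for j x
  proof -
    have "supn (f j) \<le> (\<Sum>j<d. supn (f j))" using that by (intro member_le_sum) (auto simp: supn_nonneg f)
    then show ?thesis using Cb_abs_le[OF f, of j x] by (simp add: C_def)
  qed
  have g_Cb: "g t \<in> Cb" for t unfolding g_def by (intro Cb_sum Cb_scale f)
  have g_int: "(\<integral>x. g t x \<partial>Q) = (\<Sum>j<d. t j * q j)" for t
    unfolding g_def q_def using Cb_integrable[OF Q f] by (subst Bochner_Integration.integral_sum) auto
  have g_close: "g t x \<le> g s x + C * (\<Sum>j<d. \<bar>s j - t j\<bar>)" for s t x
  proof -
    have "g t x - g s x = (\<Sum>j<d. (t j - s j) * f j x)"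
      by (simp add: g_def sum_subtractf[symmetric] algebra_simps)
    also have "\<dots> \<le> (\<Sum>j<d. \<bar>s j - t j\<bar> * C)"
    proof (rule sum_mono)
      fix j assume "j \<in> {..<d}"
      then have "\<bar>(t j - s j) * f j x\<bar> \<le> \<bar>s j - t j\<bar> * C"
        using fC[of j x] by (simp add: abs_mult abs_minus_commute mult_left_mono)
      then show "(t j - s j) * f j x \<le> \<bar>s j - t j\<bar> * C" by linarith
    qed
    also have "\<dots> = C * (\<Sum>j<d. \<bar>s j - t j\<bar>)" by (simp add: sum_distrib_left mult.commute)
    finally show ?thesis by simp
  qed
  define box where "box = {t :: nat \<Rightarrow> real. \<forall>j. t j \<in> (if j < d then {-R..R} else {0})}"
  have cbox: "compact box" unfolding box_def by (rule compact_Pi_UNIV) auto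
  have zbox: "(\<lambda>_. 0) \<in> box" using R1 by (auto simp: box_def)
  have coord: "continuous_on A (\<lambda>t :: nat \<Rightarrow> real. t j)" for A j
    by (rule continuous_on_subset[of UNIV]) auto
  \<comment> \<open>These sets yield a finite net T of the box, which does not depend on k.
    Convergence of \<open>lam k\<close> to p is then needed at finitely many functions only, and the
    Lipschitz bound \<open>lam_mono_add\<close> extends the estimate to the whole box.\<close>
  define U where "U = (\<lambda>t. {s :: nat \<Rightarrow> real. C * (\<Sum>j<d. \<bar>s j - t j\<bar>) < e / 4})"
  have oU: "open (U t)" for t
    unfolding U_def by (intro open_Collect_less continuous_intros coord)
  have "box \<subseteq> (\<Union>t\<in>box. U t)" using e by (auto simp: U_def)
  from compactE_image[OF cbox oU this]
  obtain T where T: "T \<subseteq> box" "finite T" "box \<subseteq> (\<Union>t\<in>T. U t)" by metis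
  have "\<forall>\<^sub>F k in sequentially. \<forall>t\<in>T. p (g t) - e / 4 < lam k (g t)"
    using T(2) e by (intro eventually_ball_finite ballI order_tendstoD(1)[OF lam_tendsto[OF g_Cb]]) auto
  then show ?thesis using eventually_ge_at_top[of 1]
  proof eventually_elim
    fix k :: nat assume kT: "\<forall>t\<in>T. p (g t) - e / 4 < lam k (g t)" and k: "1 \<le> k"
    have unif: "(\<Sum>j<d. s j * q j) - lam k (g s) \<le> a + e" if s: "s \<in> box" for s
    proof -
      obtain t where t: "t \<in> T" "s \<in> U t" using T(3) s by blast
      have cl: "C * (\<Sum>j<d. \<bar>s j - t j\<bar>) < e / 4" using t(2) by (simp add: U_def)
      have "lam k (g t) \<le> lam k (g s) + C * (\<Sum>j<d. \<bar>s j - t j\<bar>)"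
        by (rule lam_mono_add[OF k g_Cb g_Cb g_close])
      moreover have "(\<integral>x. g s x \<partial>Q) \<le> (\<integral>x. C * (\<Sum>j<d. \<bar>s j - t j\<bar>) + g t x \<partial>Q)"
        using g_close[of s _ t] by (intro integral_mono_PM[OF Q] g_Cb Cb_add Cb_const)
          (simp add: abs_minus_commute add.commute)
      moreover have "(\<integral>x. C * (\<Sum>j<d. \<bar>s j - t j\<bar>) + g t x \<partial>Q) = C * (\<Sum>j<d. \<bar>s j - t j\<bar>) + (\<integral>x. g t x \<partial>Q)"
        using Cb_integrable[OF Q g_Cb] Cb_integrable[OF Q Cb_const] Q
        by (subst Bochner_Integration.integral_add) auto
      moreover have "(\<integral>x. g t x \<partial>Q) \<le> p (g t) + a" using dom g_Cb by (simp add: dual_le_def)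
      moreover have "p (g t) - e / 4 < lam k (g t)" using kT t(1) by blast
      ultimately show ?thesis using cl e unfolding g_int[symmetric] by linarith
    qed
    define obj where "obj = (\<lambda>t. (\<Sum>j<d. t j * q j) - lam k (g t) - \<eta> / 2 * (\<Sum>j<d. (t j)\<^sup>2))"
    have lam_cont: "continuous_on box (\<lambda>t. lam k (g t))"
      unfolding continuous_on_def
    proof
      fix t assume t: "t \<in> box"
      have "((\<lambda>s. C * (\<Sum>j<d. \<bar>s j - t j\<bar>)) \<longlongrightarrow> C * (\<Sum>j<d. \<bar>t j - t j\<bar>)) (at t within box)"
        using coord[of box] t unfolding continuous_on_def by (intro tendsto_intros) auto
      then have "((\<lambda>s. C * (\<Sum>j<d. \<bar>s j - t j\<bar>)) \<longlongrightarrow> 0) (at t within box)" by simp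
      then have "((\<lambda>s. lam k (g s) - lam k (g t)) \<longlongrightarrow> 0) (at t within box)"
      proof (rule Lim_null_comparison[rotated])
        have "norm (lam k (g s) - lam k (g t)) \<le> C * (\<Sum>j<d. \<bar>s j - t j\<bar>)" for s
          using lam_mono_add[OF k g_Cb g_Cb g_close, of t s] lam_mono_add[OF k g_Cb g_Cb g_close, of s t]
          by (simp add: abs_le_iff abs_minus_commute)
        then show "\<forall>\<^sub>F s in at t within box. norm (lam k (g s) - lam k (g t)) \<le> C * (\<Sum>j<d. \<bar>s j - t j\<bar>)"
          by simp
      qed
      then show "((\<lambda>t. lam k (g t)) \<longlongrightarrow> lam k (g t)) (at t within box)" by (rule LIM_zero_cancel)
    qed
    have "continuous_on box obj"
      unfolding obj_def by (intro continuous_intros lam_cont coord)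
    then obtain t where t: "t \<in> box" "\<And>s. s \<in> box \<Longrightarrow> obj s \<le> obj t"
      using continuous_attains_sup[OF cbox] zbox by blast
    \<comment> \<open>Comparison with t = 0, where the objective vanishes, bounds the penalty at the
      maximiser.\<close>
    have "obj (\<lambda>_. 0) = 0" using lam_zero[OF k] by (simp add: obj_def g_def)
    then have obj0: "0 \<le> obj t" using t(2)[OF zbox] by simp
    then have sq: "\<eta> / 2 * (\<Sum>j<d. (t j)\<^sup>2) \<le> a + e" using unif[OF t(1)] by (simp add: obj_def)
    have sqj: "\<eta> / 2 * (t j)\<^sup>2 \<le> a + e" if "j < d" for j
    proof -
      have "(t j)\<^sup>2 \<le> (\<Sum>j<d. (t j)\<^sup>2)" using that by (intro member_le_sum) auto
      then have "\<eta> / 2 * (t j)\<^sup>2 \<le> \<eta> / 2 * (\<Sum>j<d. (t j)\<^sup>2)" using \<eta> by (intro mult_left_mono) auto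
      then show ?thesis using sq by linarith
    qed
    have tR: "\<bar>t j\<bar> < R" if "j < d" for j
    proof -
      have "(t j)\<^sup>2 \<le> 2 * (a + e) / \<eta>" using sqj[OF that] \<eta> by (simp add: field_simps)
      then have "\<bar>t j\<bar> \<le> sqrt (2 * (a + e) / \<eta>)" by (metis real_sqrt_abs real_sqrt_le_iff)
      then show ?thesis by (simp add: R_def)
    qed
    define y where "y = (\<lambda>j. \<integral>w. tmean k (\<lambda>x. real k * g t x) (f j) w \<partial>\<mu>)"
    have kg: "(\<lambda>x. real k * g t x) \<in> Cb" using g_Cb by auto
    have first_order: "q j - y j - \<eta> * t j = 0" if j: "j < d" for j
    proof (rule derivative_zero_of_quadratic_bound)
      \<comment> \<open>The first bound keeps the perturbed point in the box; the second keeps the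
        perturbation \<open>real k * s * f j\<close> within 1, as \<open>psi_add_le\<close>
        requires.\<close>
      show "0 < min (R - \<bar>t j\<bar>) (1 / (real k * C))" using tR[OF j] k C1 by simp
      fix s assume s: "\<bar>s\<bar> < min (R - \<bar>t j\<bar>) (1 / (real k * C))"
      define t' where "t' = (\<lambda>i. t i + (if i = j then s else 0))"
      have "\<bar>t j + s\<bar> \<le> R" using s by linarith
      moreover have "t i \<in> (if i < d then {-R..R} else {0})" for i using t(1) by (simp add: box_def)
      ultimately have "t' i \<in> (if i < d then {-R..R} else {0})" for i
        using j unfolding t'_def by (cases "i = j") (simp_all add: abs_le_interval_iff)
      then have "t' \<in> box" by (simp add: box_def)
      then have le: "obj t' \<le> obj t" by (rule t(2))
      have lin: "(\<Sum>i<d. t' i * q i) = (\<Sum>i<d. t i * q i) + s * q j"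
      proof -
        have "(\<Sum>i<d. t' i * q i) = (\<Sum>i<d. t i * q i + (if i = j then s * q i else 0))"
          by (intro sum.cong) (auto simp: t'_def algebra_simps)
        then show ?thesis using j by (simp add: sum.distrib)
      qed
      have quad: "(\<Sum>i<d. (t' i)\<^sup>2) = (\<Sum>i<d. (t i)\<^sup>2) + (2 * t j * s + s\<^sup>2)"
      proof -
        have "(\<Sum>i<d. (t' i)\<^sup>2) = (\<Sum>i<d. (t i)\<^sup>2 + (if i = j then 2 * t i * s + s\<^sup>2 else 0))"
          by (intro sum.cong) (auto simp: t'_def power2_eq_square algebra_simps)
        then show ?thesis using j by (simp add: sum.distrib)
      qed
      have gt': "g t' = (\<lambda>x. g t x + s * f j x)"
      proof
        fix x
        have "g t' x = (\<Sum>i<d. t i * f i x + (if i = j then s * f i x else 0))"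
          unfolding g_def by (intro sum.cong) (auto simp: t'_def algebra_simps)
        then show "g t' x = g t x + s * f j x" using j by (simp add: sum.distrib g_def)
      qed
      have "psi k (\<lambda>x. real k * g t x + (real k * s) * f j x)
          \<le> psi k (\<lambda>x. real k * g t x) + (\<integral>w. tmean k (\<lambda>x. real k * g t x) (\<lambda>x. (real k * s) * f j x) w \<partial>\<mu>)
            + (real k * \<bar>s\<bar> * C)\<^sup>2"
      proof (rule psi_add_le[OF k kg])
        show "(\<lambda>x. (real k * s) * f j x) \<in> Cb" using f by auto
        show "\<bar>(real k * s) * f j x\<bar> \<le> real k * \<bar>s\<bar> * C" for x
          using fC[OF j, of x] by (simp add: abs_mult mult_left_mono)
        have "\<bar>s\<bar> * (real k * C) \<le> 1" using s k C1 by (simp add: field_simps)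
        then show "real k * \<bar>s\<bar> * C \<le> 1" by (simp add: algebra_simps)
      qed
      also have "(\<integral>w. tmean k (\<lambda>x. real k * g t x) (\<lambda>x. (real k * s) * f j x) w \<partial>\<mu>) = real k * s * y j"
        unfolding y_def by (rule tmean_scale)
      finally have psi_le: "psi k (\<lambda>x. real k * g t x + (real k * s) * f j x)
          \<le> psi k (\<lambda>x. real k * g t x) + real k * s * y j + (real k * \<bar>s\<bar> * C)\<^sup>2" .
      have "lam k (g t') = psi k (\<lambda>x. real k * g t x + (real k * s) * f j x) / real k"
        unfolding lam_eq_psi gt' by (simp add: algebra_simps)
      also have "\<dots> \<le> (psi k (\<lambda>x. real k * g t x) + real k * s * y j + (real k * \<bar>s\<bar> * C)\<^sup>2) / real k"
        using psi_le by (rule divide_right_mono) simp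
      also have "\<dots> = lam k (g t) + s * y j + s\<^sup>2 * (real k * C\<^sup>2)"
        unfolding lam_eq_psi using k by (simp add: add_divide_distrib power_mult_distrib power2_eq_square)
      finally have "lam k (g t') \<le> lam k (g t) + s * y j + s\<^sup>2 * (real k * C\<^sup>2)" .
      then have "s * q j - s * y j - s\<^sup>2 * (real k * C\<^sup>2) - \<eta> / 2 * (2 * t j * s + s\<^sup>2) \<le> 0"
        using le unfolding obj_def lin quad by (simp add: distrib_left)
      then show "s * (q j - y j - \<eta> * t j) \<le> s\<^sup>2 * (real k * C\<^sup>2 + \<eta> / 2)"
        by (simp add: algebra_simps)
    qed
    have y_eq: "y j = q j - \<eta> * t j" if "j < d" for j using first_order[OF that] by simp
    have close: "\<bar>y j - q j\<bar> < e" if j: "j < d" for j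
    proof -
      have "(\<eta> * t j)\<^sup>2 = 2 * \<eta> * (\<eta> / 2 * (t j)\<^sup>2)" by (simp add: power2_eq_square)
      also have "\<dots> \<le> 2 * \<eta> * (a + e)" using sqj[OF j] \<eta> by (intro mult_left_mono) auto
      also have "\<dots> = e\<^sup>2 / 2" using ae by (simp add: \<eta>_def field_simps)
      also have "\<dots> < e\<^sup>2" using e by simp
      finally have "\<bar>\<eta> * t j\<bar> < e" using e by (intro power2_less_imp_less[of "\<bar>\<eta> * t j\<bar>" e]) auto
      then show ?thesis using y_eq[OF j] by simp
    qed
    \<comment> \<open>Stationarity replaces y j by \<open>q j - \<eta> * t j\<close>, and the extra
      term \<open>- \<eta> * (t j)\<^sup>2\<close> has the favourable sign.\<close>
    have "(\<Sum>j<d. t j * y j) = (\<Sum>j<d. t j * q j - \<eta> * (t j)\<^sup>2)"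
      by (intro sum.cong) (auto simp: y_eq power2_eq_square algebra_simps)
    also have "\<dots> = (\<Sum>j<d. t j * q j) - \<eta> * (\<Sum>j<d. (t j)\<^sup>2)"
      by (simp add: sum_subtractf sum_distrib_left)
    also have "\<dots> \<le> (\<Sum>j<d. t j * q j)" using \<eta> by (simp add: sum_nonneg)
    finally have "(\<Sum>j<d. t j * y j) - lam k (g t) \<le> a + e" using unif[OF t(1)] by linarith
    then show "\<exists>t g. g = (\<lambda>x. \<Sum>j<d. t j * f j x) \<and>
      (\<forall>j<d. \<bar>(\<integral>y. tmean k (\<lambda>x. real k * g x) (f j) y \<partial>\<mu>) - (\<integral>x. f j x \<partial>Q)\<bar> < e) \<and>
      (\<Sum>j<d. t j * (\<integral>y. tmean k (\<lambda>x. real k * g x) (f j) y \<partial>\<mu>)) - lam k g \<le> a + e"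
      using close unfolding y_def q_def by (intro exI[of _ t] exI[of _ "g t"]) (auto simp: g_def)
  qed
qed

section \<open>The lower bound\<close>

text \<open>A change of measure carried out on expectations, with no tilted product law. M is the
  exponential moment of the empirical sum of k g. On the event A that all empirical means are within
  e' of y its integrand is at most E0; off A it is dominated by Chebyshev terms whose total is at
  most M / 2. Hence \<open>prob A\<close> is at least M / (2 E0).\<close>

lemma lower_bound_tilted:
  assumes k: "k \<ge> 1" and f: "\<And>j. f j \<in> Cb" and g: "g = (\<lambda>x. \<Sum>j<d::nat. t j * f j x)"
    and y: "\<And>j. y j = (\<integral>w. tmean k (\<lambda>x. real k * g x) (f j) w \<partial>\<mu>)" and e: "0 < (e::real)"
    and Bs: "B \<in> sets (prob_algebra borel)"
    and B: "\<And>Q. Q \<in> PM \<Longrightarrow> (\<And>j. j < d \<Longrightarrow> \<bar>(\<integral>x. f j x \<partial>Q) - y j\<bar> < e) \<Longrightarrow> Q \<in> B"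
  shows "ereal (- ((\<Sum>j<d. t j * y j) - lam k g)) \<le> liminf (\<lambda>n. elog (emp_prob P z k n B) / ereal (real k * real n))"
proof (rule ereal_le_epsilon2)
  fix r0 :: real assume r0: "0 < r0"
  define r where "r = r0 / 3"
  have r: "0 < r" using r0 by (simp add: r_def)
  define T where "T = 1 + (\<Sum>j<d. \<bar>t j\<bar>)"
  have T1: "1 \<le> T" by (simp add: T_def sum_nonneg)
  \<comment> \<open>e' \<le> e keeps the event inside B; the second bound limits the variation of
    the exponent on the event to r per unit of k n.\<close>
  define e' where "e' = min e (r / T)"
  have e': "0 < e'" "e' \<le> e" "e' * (\<Sum>j<d. \<bar>t j\<bar>) \<le> r"
  proof -
    show "0 < e'" "e' \<le> e" using e r T1 by (auto simp: e'_def)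
    have "e' * (\<Sum>j<d. \<bar>t j\<bar>) \<le> (r / T) * T"
      using r T1 \<open>0 < e'\<close> by (intro mult_mono) (auto simp: e'_def T_def sum_nonneg)
    then show "e' * (\<Sum>j<d. \<bar>t j\<bar>) \<le> r" using T1 by simp
  qed
  define C where "C = 1 + (\<Sum>j<d. supn (f j))"
  have C1: "1 \<le> C" by (simp add: C_def sum_nonneg supn_nonneg f)
  have fC: "\<bar>f j x\<bar> \<le> C" if "j < d" for j x
  proof -
    have "supn (f j) \<le> (\<Sum>j<d. supn (f j))" using that by (intro member_le_sum) (auto simp: supn_nonneg f)
    then show ?thesis using Cb_abs_le[OF f, of j x] by (simp add: C_def)
  qed
  \<comment> \<open>\<open>s * C \<le> 1\<close> makes \<open>psi_add_le\<close> applicable, and the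
    second bound makes its error \<open>(s * C)\<^sup>2\<close> at most
    \<open>s * e' / 4\<close>.\<close>
  define s where "s = min (1 / C) (e' / (4 * C\<^sup>2))"
  have s: "0 < s" "s * C \<le> 1" "s * C\<^sup>2 \<le> e' / 4"
  proof -
    show "0 < s" using C1 e' by (simp add: s_def)
    have "s * C \<le> (1 / C) * C" using C1 unfolding s_def by (intro mult_right_mono) auto
    then show "s * C \<le> 1" using C1 by simp
    have "s * C\<^sup>2 \<le> (e' / (4 * C\<^sup>2)) * C\<^sup>2" unfolding s_def by (intro mult_right_mono) auto
    then show "s * C\<^sup>2 \<le> e' / 4" using C1 by simp
  qed
  define G where "G = (\<lambda>x. real k * g x)"
  have g_Cb: "g \<in> Cb" unfolding g by (intro Cb_sum Cb_scale f)
  have G_Cb: "G \<in> Cb" unfolding G_def using g_Cb by auto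
  define S where "S = {1, -1 :: real}"
  define h where "h = (\<lambda>j \<sigma> x. G x + (s * \<sigma>) * f j x)"
  have h_Cb: "h j \<sigma> \<in> Cb" for j \<sigma> unfolding h_def by (intro Cb_add Cb_scale G_Cb f)
  have psi_h: "psi k (h j \<sigma>) \<le> psi k G + s * \<sigma> * y j + s * e' / 4" if j: "j < d" and \<sigma>: "\<sigma> \<in> S" for j \<sigma>
  proof -
    have "psi k (h j \<sigma>) \<le> psi k G + (\<integral>w. tmean k G (\<lambda>x. (s * \<sigma>) * f j x) w \<partial>\<mu>) + (s * C)\<^sup>2"
      unfolding h_def
    proof (rule psi_add_le[OF k G_Cb])
      show "(\<lambda>x. (s * \<sigma>) * f j x) \<in> Cb" using f by auto
      show "\<bar>(s * \<sigma>) * f j x\<bar> \<le> s * C" for x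
        using fC[OF j, of x] \<sigma> s(1) by (auto simp: S_def abs_mult)
    qed (rule s(2))
    also have "(\<integral>w. tmean k G (\<lambda>x. (s * \<sigma>) * f j x) w \<partial>\<mu>) = s * \<sigma> * y j"
      unfolding y G_def[symmetric] by (rule tmean_scale)
    also have "(s * C)\<^sup>2 \<le> s * e' / 4"
      using mult_left_mono[OF s(3), of s] s(1) by (simp add: power2_eq_square algebra_simps)
    finally show ?thesis by simp
  qed
  define Y where "Y = (\<Sum>j<d. t j * y j)"
  \<comment> \<open>A deviation by e' gains \<open>s * e'\<close> in the exponent. Three quarters of
    it pay for the error in \<open>psi_h\<close> and for the two limits in \<open>ev1\<close> and
    \<open>ev2\<close>; by \<open>ev3\<close> the last quarter beats the number 2 d of
    terms.\<close>
  have ev1: "\<forall>\<^sub>F n in sequentially. \<forall>j\<in>{..<d}. \<forall>\<sigma>\<in>S. ln (expmom k n (h j \<sigma>)) / real n < psi k (h j \<sigma>) + s * e' / 4"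
    using s(1) e' by (intro eventually_ball_finite ballI order_tendstoD(2)[OF ln_expmom_tendsto[OF k h_Cb]])
      (auto simp: S_def)
  have ev2: "\<forall>\<^sub>F n in sequentially. psi k G - min (s * e' / 4) (real k * r / 2) < ln (expmom k n G) / real n"
    using s(1) e' r k by (intro order_tendstoD(1)[OF ln_expmom_tendsto[OF k G_Cb]]) auto
  have lin_at_top: "filterlim (\<lambda>n. exp (c * real n)) at_top sequentially" if "0 < c" for c
    using that by (intro filterlim_compose[OF exp_at_top] filterlim_tendsto_pos_mult_at_top[OF tendsto_const]
            filterlim_real_sequentially)
  have ev3: "\<forall>\<^sub>F n in sequentially. 4 * real d + 1 \<le> exp ((s * e' / 4) * real n)"
    using lin_at_top[of "s * e' / 4"] s(1) e' by (simp add: filterlim_at_top)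
  have ev4: "\<forall>\<^sub>F n in sequentially. 2 \<le> exp ((real k * r / 2) * real n)"
    using lin_at_top[of "real k * r / 2"] r k by (simp add: filterlim_at_top)
  have "\<forall>\<^sub>F n in sequentially. ereal (- (Y - lam k g) - r0) \<le> elog (emp_prob P z k n B) / ereal (real k * real n)"
    using ev1 ev2 ev3 ev4 eventually_ge_at_top[of 1]
  proof eventually_elim
    fix n :: nat
    assume n1: "\<forall>j\<in>{..<d}. \<forall>\<sigma>\<in>S. ln (expmom k n (h j \<sigma>)) / real n < psi k (h j \<sigma>) + s * e' / 4"
      and n2: "psi k G - min (s * e' / 4) (real k * r / 2) < ln (expmom k n G) / real n"
      and n3: "4 * real d + 1 \<le> exp ((s * e' / 4) * real n)"
      and n4: "2 \<le> exp ((real k * r / 2) * real n)" and n: "1 \<le> n"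
    interpret prob_space "prodm k n" by (rule prod_prob[OF k])
    have kn: "0 < real k * real n" using k n by simp
    define M where "M = expmom k n G"
    have M0: "0 < M" unfolding M_def by (rule expmom_pos[OF k G_Cb])
    define L where "L = (\<lambda>u (\<omega> :: nat \<Rightarrow> 'x). (\<Sum>i<n. u (\<omega> i)) :: real)"
    define E0 where "E0 = exp (real k * real n * (Y + r))"
    define A where "A = {\<omega> \<in> space (prodm k n). \<forall>j\<in>{..<d}. \<bar>L (f j) \<omega> / real n - y j\<bar> < e'}"
    have A_sets: "A \<in> sets (prodm k n)"
    proof -
      have m: "L (f j) \<in> borel_measurable (prodm k n)" for j
        unfolding L_def by (rule sum_coord_measurable[OF k f])
      have m': "(\<lambda>\<omega>. \<bar>L (f j) \<omega> / real n - y j\<bar>) \<in> borel_measurable (prodm k n)" for j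
        by (intro borel_measurable_abs borel_measurable_diff borel_measurable_divide m borel_measurable_const)
      show ?thesis
        unfolding A_def
        by (intro sets.sets_Collect_countable_Ball borel_measurable_less m' borel_measurable_const)
    qed
    define Tm where "Tm = (\<lambda>j \<sigma> \<omega>. exp (L (h j \<sigma>) \<omega>) * exp (- (s * real n * (\<sigma> * y j + e'))))"
    have Tm_int: "integrable (prodm k n) (Tm j \<sigma>)" for j \<sigma>
      unfolding Tm_def L_def by (intro integrable_mult_left exp_sum_integrable[OF k h_Cb])
    have W_int: "integrable (prodm k n) (\<lambda>\<omega>. exp (L G \<omega>))"
      unfolding L_def by (rule exp_sum_integrable[OF k G_Cb])
    have A_int: "integrable (prodm k n) (\<lambda>\<omega>. E0 * indicator A \<omega>)"
      using A_sets by (intro integrable_mult_right integrable_real_indicator) (auto simp: emeasure_eq_measure)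
    have pw: "exp (L G \<omega>) \<le> E0 * indicator A \<omega> + (\<Sum>j<d. \<Sum>\<sigma>\<in>S. Tm j \<sigma> \<omega>)" if \<omega>: "\<omega> \<in> space (prodm k n)" for \<omega>
    proof (cases "\<omega> \<in> A")
      case True
      have "L G \<omega> = real k * (\<Sum>j<d. t j * L (f j) \<omega>)"
      proof -
        have "(\<Sum>i<n. g (\<omega> i)) = (\<Sum>j<d. t j * L (f j) \<omega>)"
          unfolding g L_def by (subst sum.swap) (simp add: sum_distrib_left)
        then show ?thesis by (simp add: L_def G_def sum_distrib_left[symmetric])
      qed
      also have "(\<Sum>j<d. t j * L (f j) \<omega>) \<le> (\<Sum>j<d. real n * (t j * y j + e' * \<bar>t j\<bar>))"
      proof (rule sum_mono)
        fix j assume "j \<in> {..<d}"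
        then have cl: "\<bar>L (f j) \<omega> / real n - y j\<bar> < e'" using True by (simp add: A_def)
        have "t j * (L (f j) \<omega> / real n - y j) \<le> \<bar>t j\<bar> * \<bar>L (f j) \<omega> / real n - y j\<bar>"
          by (metis abs_ge_self abs_mult)
        also have "\<dots> \<le> \<bar>t j\<bar> * e'" using cl by (intro mult_left_mono) auto
        finally have "t j * (L (f j) \<omega> / real n) \<le> t j * y j + e' * \<bar>t j\<bar>" by (simp add: algebra_simps)
        then have "real n * (t j * (L (f j) \<omega> / real n)) \<le> real n * (t j * y j + e' * \<bar>t j\<bar>)"
          by (rule mult_left_mono) simp
        then show "t j * L (f j) \<omega> \<le> real n * (t j * y j + e' * \<bar>t j\<bar>)" using n by simp
      qed
      also have "\<dots> = real n * (Y + e' * (\<Sum>j<d. \<bar>t j\<bar>))"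
        by (simp add: Y_def sum.distrib sum_distrib_left[symmetric])
      also have "\<dots> \<le> real n * (Y + r)" using e'(3) by (intro mult_left_mono) auto
      finally have "L G \<omega> \<le> real k * (real n * (Y + r))" by (simp add: mult_left_mono)
      then have "exp (L G \<omega>) \<le> E0 * indicator A \<omega>" using True by (simp add: E0_def mult.assoc)
      moreover have "0 \<le> (\<Sum>j<d. \<Sum>\<sigma>\<in>S. Tm j \<sigma> \<omega>)" by (intro sum_nonneg) (simp add: Tm_def)
      ultimately show ?thesis by linarith
    next
      case False
      then obtain j where j: "j < d" "e' \<le> \<bar>L (f j) \<omega> / real n - y j\<bar>"
        using \<omega> by (auto simp: A_def not_less)
      \<comment> \<open>The sign of the deviation selects one of the two Chebyshev terms for
        j.\<close>
      define \<sigma> where "\<sigma> = (if 0 \<le> L (f j) \<omega> / real n - y j then 1 else -1 :: real)"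
      have \<sigma>: "\<sigma> \<in> S" "e' \<le> \<sigma> * (L (f j) \<omega> / real n - y j)" using j(2) by (auto simp: \<sigma>_def S_def)
      have "0 \<le> s * real n * (\<sigma> * (L (f j) \<omega> / real n - y j) - e')"
        using s(1) \<sigma>(2) by (intro mult_nonneg_nonneg) auto
      also have "\<dots> = s * \<sigma> * L (f j) \<omega> - s * real n * (\<sigma> * y j + e')"
        using n by (simp add: algebra_simps)
      finally have "exp (L G \<omega>) \<le> exp (L G \<omega> + s * \<sigma> * L (f j) \<omega> - s * real n * (\<sigma> * y j + e'))" by simp
      also have "\<dots> = Tm j \<sigma> \<omega>"
      proof -
        have "L (h j \<sigma>) \<omega> = L G \<omega> + s * \<sigma> * L (f j) \<omega>"
          by (simp add: L_def h_def sum.distrib sum_distrib_left)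
        then show ?thesis by (simp add: Tm_def exp_add[symmetric])
      qed
      also have "\<dots> \<le> (\<Sum>\<sigma>\<in>S. Tm j \<sigma> \<omega>)"
        using \<sigma>(1) by (intro member_le_sum) (auto simp: Tm_def S_def)
      also have "\<dots> \<le> (\<Sum>j<d. \<Sum>\<sigma>\<in>S. Tm j \<sigma> \<omega>)"
        using j(1) by (intro member_le_sum[of j "{..<d}" "\<lambda>j. \<Sum>\<sigma>\<in>S. Tm j \<sigma> \<omega>"] sum_nonneg) (auto simp: Tm_def)
      finally show ?thesis using False by simp
    qed
    have "M = (\<integral>\<omega>. exp (L G \<omega>) \<partial>prodm k n)" by (simp add: M_def expmom_def L_def)
    also have "\<dots> \<le> (\<integral>\<omega>. E0 * indicator A \<omega> + (\<Sum>j<d. \<Sum>\<sigma>\<in>S. Tm j \<sigma> \<omega>) \<partial>prodm k n)"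
      by (intro integral_mono W_int Bochner_Integration.integrable_add A_int
          Bochner_Integration.integrable_sum Tm_int pw)
    also have "\<dots> = E0 * prob A + (\<Sum>j<d. \<Sum>\<sigma>\<in>S. \<integral>\<omega>. Tm j \<sigma> \<omega> \<partial>prodm k n)"
      using A_sets A_int Tm_int
      by (simp add: Bochner_Integration.integral_add Bochner_Integration.integral_sum Bochner_Integration.integrable_sum)
    also have "(\<Sum>j<d. \<Sum>\<sigma>\<in>S. \<integral>\<omega>. Tm j \<sigma> \<omega> \<partial>prodm k n) \<le> (\<Sum>j<d. \<Sum>\<sigma>\<in>S. M * exp (- (s * e' / 4 * real n)))"
    proof (intro sum_mono)
      fix j \<sigma> assume j: "j \<in> {..<d}" and \<sigma>: "\<sigma> \<in> S"
      have "ln (expmom k n (h j \<sigma>)) / real n < psi k (h j \<sigma>) + s * e' / 4" using n1 j \<sigma> by blast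
      also have "\<dots> \<le> psi k G + s * \<sigma> * y j + s * e' / 2" using psi_h[of j \<sigma>] j \<sigma> by simp
      finally have "ln (expmom k n (h j \<sigma>)) \<le> real n * (psi k G + s * \<sigma> * y j + s * e' / 2)"
        using n by (simp add: field_simps)
      then have "expmom k n (h j \<sigma>) \<le> exp (real n * (psi k G + s * \<sigma> * y j + s * e' / 2))"
        using expmom_pos[OF k h_Cb, of n j \<sigma>] by (metis exp_le_cancel_iff exp_ln)
      then have "expmom k n (h j \<sigma>) * exp (- (s * real n * (\<sigma> * y j + e')))
          \<le> exp (real n * (psi k G + s * \<sigma> * y j + s * e' / 2)) * exp (- (s * real n * (\<sigma> * y j + e')))"
        by (rule mult_right_mono) simp
      also have "\<dots> = exp (real n * (psi k G - s * e' / 4)) * exp (- (s * e' / 4 * real n))"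
        by (simp add: exp_add[symmetric] algebra_simps)
      also have "\<dots> \<le> M * exp (- (s * e' / 4 * real n))"
      proof (rule mult_right_mono)
        have "psi k G - s * e' / 4 \<le> ln M / real n" using n2 by (simp add: M_def)
        then have "real n * (psi k G - s * e' / 4) \<le> ln M" using n by (simp add: field_simps)
        then show "exp (real n * (psi k G - s * e' / 4)) \<le> M" using M0 by (simp add: ln_ge_iff)
      qed simp
      finally show "(\<integral>\<omega>. Tm j \<sigma> \<omega> \<partial>prodm k n) \<le> M * exp (- (s * e' / 4 * real n))"
        by (simp add: Tm_def expmom_def L_def)
    qed
    also have "\<dots> = M * (2 * real d * exp (- (s * e' / 4 * real n)))" by (simp add: S_def)
    also have "\<dots> \<le> M * (1 / 2)"
    proof (rule mult_left_mono)
      have "4 * real d \<le> exp (s * e' / 4 * real n)" using n3 by simp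
      then have "4 * real d * exp (- (s * e' / 4 * real n)) \<le> exp (s * e' / 4 * real n) * exp (- (s * e' / 4 * real n))"
        by (rule mult_right_mono) simp
      then show "2 * real d * exp (- (s * e' / 4 * real n)) \<le> 1 / 2" by (simp add: exp_add[symmetric])
    qed (use M0 in simp)
    finally have PA: "M / 2 \<le> E0 * prob A" by simp
    have "A \<subseteq> (\<lambda>\<omega>. empirical n \<omega>) -` B \<inter> space (prodm k n)"
    proof
      fix \<omega> assume \<omega>: "\<omega> \<in> A"
      have "empirical n \<omega> \<in> B"
      proof (rule B[OF empirical_PM[OF n]])
        fix j assume j: "j < d"
        have "\<bar>(\<Sum>i<n. f j (\<omega> i)) / real n - y j\<bar> < e'" using \<omega> j by (simp add: A_def L_def)
        then show "\<bar>(\<integral>x. f j x \<partial>empirical n \<omega>) - y j\<bar> < e"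
          using e'(2) unfolding empirical_integral[OF n f] by linarith
      qed
      then show "\<omega> \<in> (\<lambda>\<omega>. empirical n \<omega>) -` B \<inter> space (prodm k n)" using \<omega> by (simp add: A_def)
    qed
    moreover have "(\<lambda>\<omega>. empirical n \<omega>) -` B \<inter> space (prodm k n) \<in> sets (prodm k n)"
      using measurable_sets[OF empirical_measurable[OF n P_PM[OF k]] Bs] .
    ultimately have "prob A \<le> emp_prob P z k n B"
      unfolding emp_prob_def Let_def by (rule finite_measure_mono)
    then have low: "M / 2 \<le> E0 * emp_prob P z k n B"
      using PA by (rule_tac order_trans[OF PA]) (simp add: E0_def)
    have "psi k G - real k * r / 2 \<le> ln M / real n" using n2 by (simp add: M_def)
    then have "real n * (psi k G - real k * r / 2) \<le> ln M" using n by (simp add: field_simps)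
    then have M_ge: "exp (real n * (psi k G - real k * r / 2)) \<le> M" using M0 by (simp add: ln_ge_iff)
    have psi_lam: "psi k G = real k * lam k g" using k by (simp add: lam_eq_psi G_def)
    \<comment> \<open>r0 = 3 r is spent as follows: r on the variation of the exponent on A, r / 2
      on the lower estimate of M, r / 2 on the factor 1 / 2, and r to spare.\<close>
    have exponents: "real k * real n * (- (Y - lam k g) - r0) + real k * real n * (Y + r)
        = real n * (real k * lam k g - real k * r / 2) + - (real k * r / 2 * real n) + - (real k * real n * r)"
      by (simp add: r_def algebra_simps)
    have "exp (real k * real n * (- (Y - lam k g) - r0)) * E0
        = exp (real n * (psi k G - real k * r / 2)) * exp (- (real k * r / 2 * real n)) * exp (- (real k * real n * r))"
    proof -
      have "exp (real k * real n * (- (Y - lam k g) - r0)) * E0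
          = exp (real k * real n * (- (Y - lam k g) - r0) + real k * real n * (Y + r))"
        unfolding E0_def by (rule exp_add[symmetric])
      then show ?thesis unfolding exponents psi_lam by (simp only: exp_add)
    qed
    also have "\<dots> \<le> exp (real n * (psi k G - real k * r / 2)) * (1 / 2) * 1"
    proof (intro mult_mono)
      have "exp (- (real k * r / 2 * real n)) = 1 / exp (real k * r / 2 * real n)" by (simp only: exp_minus inverse_eq_divide)
      also have "\<dots> \<le> 1 / 2" using n4 by (intro divide_left_mono) auto
      finally show "exp (- (real k * r / 2 * real n)) \<le> 1 / 2" .
    qed (use r in auto)
    also have "\<dots> \<le> M / 2" using M_ge by simp
    also have "\<dots> \<le> emp_prob P z k n B * E0" using low by (simp add: mult.commute)
    finally have "exp (real k * real n * (- (Y - lam k g) - r0)) \<le> emp_prob P z k n B"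
      by (simp add: E0_def)
    then show "ereal (- (Y - lam k g) - r0) \<le> elog (emp_prob P z k n B) / ereal (real k * real n)"
      by (rule elog_divide_ge[OF _ kn])
  qed
  then have "ereal (- (Y - lam k g) - r0) \<le> liminf (\<lambda>n. elog (emp_prob P z k n B) / ereal (real k * real n))"
    by (rule Liminf_bounded)
  then have "ereal (- (Y - lam k g) - r0) + ereal r0
      \<le> liminf (\<lambda>n. elog (emp_prob P z k n B) / ereal (real k * real n)) + ereal r0"
    by (rule add_right_mono)
  then show "ereal (- ((\<Sum>j<d. t j * y j) - lam k g))
      \<le> liminf (\<lambda>n. elog (emp_prob P z k n B) / ereal (real k * real n)) + ereal r0"
    by (simp add: Y_def)
qed

lemma lower_bound:
  assumes Bs: "B \<in> sets (prob_algebra borel)" and Q: "Q \<in> narrow_topology interior_of B"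
    and dom: "dual_le a Q" and a: "0 \<le> a"
  shows "ereal (- a) \<le> liminf (\<lambda>k. liminf (\<lambda>n. elog (emp_prob P z k n B) / ereal (real k * real n)))"
proof (rule ereal_le_epsilon2)
  fix r :: real assume r: "0 < r"
  have QPM: "Q \<in> PM" using Q interior_of_subset_topspace[of narrow_topology B] by auto
  obtain F e where F: "finite F" "F \<subseteq> Cb" "0 < e"
    "\<And>R. R \<in> PM \<Longrightarrow> (\<And>f. f \<in> F \<Longrightarrow> \<bar>(\<integral>x. f x \<partial>R) - (\<integral>x. f x \<partial>Q)\<bar> < e) \<Longrightarrow> R \<in> narrow_topology interior_of B"
    using narrow_nbhd[OF openin_interior_of Q] by metis
  obtain fs where fs: "set fs = F" using finite_list[OF F(1)] by blast
  \<comment> \<open>Padded with zeros, since \<open>tilting\<close> and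
    \<open>lower_bound_tilted\<close> index the test functions by all naturals.\<close>
  define f where "f = (\<lambda>j. if j < length fs then fs ! j else (\<lambda>_. 0))"
  have f: "f j \<in> Cb" for j using F(2) fs by (auto simp: f_def)
  \<comment> \<open>Half of e brings the tilted means near those of Q; the other half is left for
    the empirical means around the tilted ones.\<close>
  define e' where "e' = min (e / 2) r"
  have e': "0 < e'" using F(3) r by (simp add: e'_def)
  have "\<forall>\<^sub>F k in sequentially. ereal (- (a + r)) \<le> liminf (\<lambda>n. elog (emp_prob P z k n B) / ereal (real k * real n))"
    using tilting[where f = f and d = "length fs", OF QPM dom a f e'] eventually_ge_at_top[of 1]
  proof eventually_elim
    fix k :: nat
    assume "\<exists>t g. g = (\<lambda>x. \<Sum>j<length fs. t j * f j x) \<and>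
        (\<forall>j<length fs. \<bar>(\<integral>y. tmean k (\<lambda>x. real k * g x) (f j) y \<partial>\<mu>) - (\<integral>x. f j x \<partial>Q)\<bar> < e') \<and>
        (\<Sum>j<length fs. t j * (\<integral>y. tmean k (\<lambda>x. real k * g x) (f j) y \<partial>\<mu>)) - lam k g \<le> a + e'"
      and k: "1 \<le> k"
    then obtain t g where tg: "g = (\<lambda>x. \<Sum>j<length fs. t j * f j x)"
        "\<And>j. j < length fs \<Longrightarrow> \<bar>(\<integral>y. tmean k (\<lambda>x. real k * g x) (f j) y \<partial>\<mu>) - (\<integral>x. f j x \<partial>Q)\<bar> < e'"
        "(\<Sum>j<length fs. t j * (\<integral>y. tmean k (\<lambda>x. real k * g x) (f j) y \<partial>\<mu>)) - lam k g \<le> a + e'"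
      by blast
    have "ereal (- (a + r)) \<le> ereal (- ((\<Sum>j<length fs. t j * (\<integral>y. tmean k (\<lambda>x. real k * g x) (f j) y \<partial>\<mu>)) - lam k g))"
      using tg(3) by (simp add: e'_def)
    also have "\<dots> \<le> liminf (\<lambda>n. elog (emp_prob P z k n B) / ereal (real k * real n))"
    proof (rule lower_bound_tilted[OF k f tg(1) refl _ Bs])
      show "0 < e / 2" using F(3) by simp
      fix R :: "'x measure" assume R: "R \<in> PM"
        "\<And>j. j < length fs \<Longrightarrow> \<bar>(\<integral>x. f j x \<partial>R) - (\<integral>y. tmean k (\<lambda>x. real k * g x) (f j) y \<partial>\<mu>)\<bar> < e / 2"
      have "R \<in> narrow_topology interior_of B"
      proof (rule F(4)[OF R(1)])
        fix u assume "u \<in> F"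
        then obtain j where j: "j < length fs" "u = f j" using fs by (auto simp: f_def in_set_conv_nth)
        show "\<bar>(\<integral>x. u x \<partial>R) - (\<integral>x. u x \<partial>Q)\<bar> < e"
          using tg(2)[OF j(1)] R(2)[OF j(1)] unfolding j(2) e'_def by linarith
      qed
      then show "R \<in> B" by (rule subsetD[OF interior_of_subset])
    qed
    finally show "ereal (- (a + r)) \<le> liminf (\<lambda>n. elog (emp_prob P z k n B) / ereal (real k * real n))" .
  qed
  then have "ereal (- (a + r)) \<le> liminf (\<lambda>k. liminf (\<lambda>n. elog (emp_prob P z k n B) / ereal (real k * real n)))"
    by (rule Liminf_bounded)
  then have "ereal (- (a + r)) + ereal r
      \<le> liminf (\<lambda>k. liminf (\<lambda>n. elog (emp_prob P z k n B) / ereal (real k * real n))) + ereal r"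
    by (rule add_right_mono)
  then show "ereal (- a)
      \<le> liminf (\<lambda>k. liminf (\<lambda>n. elog (emp_prob P z k n B) / ereal (real k * real n))) + ereal r"
    by simp
qed

end

section \<open>Near minimisers of a Hilbert norm converge almost everywhere\<close>

text \<open>The squared norm of a weighted l2 space; the weights make it finite on sequences bounded
  by 1.\<close>

definition sqs :: "(nat \<Rightarrow> real) \<Rightarrow> real" where
  "sqs w = (\<Sum>i. (1 / 2) ^ i * (w i)\<^sup>2)"

lemma sqs_summable:
  assumes "\<And>i. \<bar>w i\<bar> \<le> 1" shows "summable (\<lambda>i. (1 / 2) ^ i * (w i)\<^sup>2 :: real)"
proof (rule summable_comparison_test'[of "\<lambda>i. (1 / 2 :: real) ^ i"])
  show "summable (\<lambda>i. (1 / 2 :: real) ^ i)" by (rule summable_geometric) simp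
  fix i :: nat
  have "(w i)\<^sup>2 \<le> 1" using assms[of i] by (simp add: abs_square_le_1)
  then show "norm ((1 / 2) ^ i * (w i)\<^sup>2) \<le> (1 / 2 :: real) ^ i"
    by (simp add: mult_left_le)
qed

lemma sqs_nonneg: "(\<And>i. \<bar>w i\<bar> \<le> 1) \<Longrightarrow> 0 \<le> sqs w"
  unfolding sqs_def by (intro suminf_nonneg sqs_summable) auto

lemma sqs_le_2: assumes "\<And>i. \<bar>w i\<bar> \<le> 1" shows "sqs w \<le> 2"
proof -
  have s: "summable (\<lambda>i. (1 / 2 :: real) ^ i)" by (rule summable_geometric) simp
  have "sqs w \<le> (\<Sum>i. (1 / 2 :: real) ^ i)"
    unfolding sqs_def
  proof (rule suminf_le[OF _ sqs_summable[OF assms] s])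
    fix i
    have "(w i)\<^sup>2 \<le> 1" using assms[of i] by (simp add: abs_square_le_1)
    then show "(1 / 2) ^ i * (w i)\<^sup>2 \<le> (1 / 2 :: real) ^ i" by (simp add: mult_left_le)
  qed
  also have "\<dots> = 2" by (subst suminf_geometric) auto
  finally show ?thesis .
qed

lemma sqs_term_le:
  assumes "\<And>i. \<bar>w i\<bar> \<le> 1" shows "(1 / 2) ^ i * (w i)\<^sup>2 \<le> sqs w"
proof -
  have "sum (\<lambda>i. (1 / 2) ^ i * (w i)\<^sup>2) {i} \<le> sqs w"
    unfolding sqs_def by (rule sum_le_suminf[OF sqs_summable[OF assms]]) auto
  then show ?thesis by simp
qed

lemma sqs_parallelogram:
  assumes u: "\<And>i. \<bar>u i\<bar> \<le> 1" and v: "\<And>i. \<bar>v i\<bar> \<le> 1"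
  shows "sqs (\<lambda>i. (u i + v i) / 2) + sqs (\<lambda>i. (u i - v i) / 2) = (sqs u + sqs v) / 2"
proof -
  have p: "\<bar>(u i + v i) / 2\<bar> \<le> 1" and m: "\<bar>(u i - v i) / 2\<bar> \<le> 1" for i
    using u[of i] v[of i] by (auto simp: abs_le_iff)
  have "sqs (\<lambda>i. (u i + v i) / 2) + sqs (\<lambda>i. (u i - v i) / 2)
      = (\<Sum>i. (1 / 2) ^ i * ((u i + v i) / 2)\<^sup>2 + (1 / 2) ^ i * ((u i - v i) / 2)\<^sup>2)"
    unfolding sqs_def by (rule suminf_add[OF sqs_summable[OF p] sqs_summable[OF m]])
  also have "\<dots> = (\<Sum>i. ((1 / 2) ^ i * (u i)\<^sup>2 + (1 / 2) ^ i * (v i)\<^sup>2) / 2)"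
    by (rule suminf_cong) (simp add: power2_eq_square field_simps)
  also have "\<dots> = (\<Sum>i. (1 / 2) ^ i * (u i)\<^sup>2 + (1 / 2) ^ i * (v i)\<^sup>2) / 2"
    by (rule suminf_divide[OF summable_add[OF sqs_summable[OF u] sqs_summable[OF v]]])
  also have "(\<Sum>i. (1 / 2) ^ i * (u i)\<^sup>2 + (1 / 2) ^ i * (v i)\<^sup>2) = sqs u + sqs v"
    unfolding sqs_def by (rule suminf_add[symmetric, OF sqs_summable[OF u] sqs_summable[OF v]])
  finally show ?thesis .
qed

text \<open>The factor 4^j bounds the increments by sqrt S times 2^(-j), which is summable.\<close>

lemma convergent_of_geometric_squares:
  fixes x :: "nat \<Rightarrow> real"
  assumes "\<And>j. 4 ^ j * (x j - x (Suc j))\<^sup>2 \<le> S"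
  shows "convergent x"
proof -
  have S: "0 \<le> S" using assms[of 0] by (simp add: order_trans[OF zero_le_power2])
  have "summable (\<lambda>j. x (Suc j) - x j)"
  proof (rule summable_comparison_test'[of "\<lambda>j. sqrt S * (1 / 2) ^ j"])
    show "summable (\<lambda>j. sqrt S * (1 / 2) ^ j)"
      by (intro summable_mult summable_geometric) simp
    fix j :: nat
    have "(2 ^ j * \<bar>x (Suc j) - x j\<bar>)\<^sup>2 = 4 ^ j * (x j - x (Suc j))\<^sup>2"
      by (simp add: power_mult_distrib power2_commute power_mult[symmetric] mult.commute[of j] power_mult)
    also have "\<dots> \<le> S" by (rule assms)
    finally have "2 ^ j * \<bar>x (Suc j) - x j\<bar> \<le> sqrt S" by (rule real_le_rsqrt)
    then show "norm (x (Suc j) - x j) \<le> sqrt S * (1 / 2) ^ j"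
      by (simp add: power_one_over field_simps)
  qed
  then have "convergent (\<lambda>n. \<Sum>j<n. x (Suc j) - x j)" by (simp add: summable_iff_convergent)
  then have "convergent (\<lambda>n. (x n - x 0) + x 0)"
    unfolding sum_lessThan_telescope by (intro convergent_add convergent_const)
  then show ?thesis by simp
qed

text \<open>By the parallelogram law near minimisers of the norm over decreasing convex sets form a Cauchy
  sequence; this replaces a weak compactness argument.\<close>

lemma near_minimisers_converge:
  fixes Qs :: "nat \<Rightarrow> ('z::topological_space \<Rightarrow> nat \<Rightarrow> real) set"
  assumes mu: "\<mu> \<in> PM" and ne: "\<And>m. Qs m \<noteq> {}" and dec: "\<And>l m. l \<le> m \<Longrightarrow> Qs m \<subseteq> Qs l"
    and mid: "\<And>m u v. u \<in> Qs m \<Longrightarrow> v \<in> Qs m \<Longrightarrow> (\<lambda>y i. (u y i + v y i) / 2) \<in> Qs m"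
    and meas: "\<And>m u i. u \<in> Qs m \<Longrightarrow> (\<lambda>y. u y i) \<in> borel_measurable borel"
    and bd: "\<And>m u y i. u \<in> Qs m \<Longrightarrow> \<bar>u y i\<bar> \<le> (1::real)"
  shows "\<exists>u. (\<forall>j. u j \<in> Qs j) \<and> (AE y in \<mu>. \<forall>i. convergent (\<lambda>j. u j y i))"
proof -
  interpret prob_space \<mu> by (rule PM_prob) fact
  have sq_meas: "(\<lambda>y. sqs (w y)) \<in> borel_measurable borel" if "\<And>i. (\<lambda>y. w y i) \<in> borel_measurable borel"
    for w :: "'z \<Rightarrow> nat \<Rightarrow> real"
    unfolding sqs_def using that by (intro borel_measurable_suminf borel_measurable_times borel_measurable_power) auto
  have sq_int: "integrable \<mu> (\<lambda>y. sqs (w y))"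
    if "\<And>i. (\<lambda>y. w y i) \<in> borel_measurable borel" "\<And>y i. \<bar>w y i\<bar> \<le> 1" for w :: "'z \<Rightarrow> nat \<Rightarrow> real"
    using that sqs_nonneg[of "w _"] sqs_le_2[of "w _"]
    by (intro bounded_integrable_PM[OF mu sq_meas, of _ 2]) (auto simp: abs_of_nonneg)
  define N where "N = (\<lambda>w. \<integral>y. sqs (w y) \<partial>\<mu>)"
  have N0: "0 \<le> N u" if "u \<in> Qs m" for u m
    unfolding N_def using bd[OF that] by (intro Bochner_Integration.integral_nonneg sqs_nonneg)
  have N2: "N u \<le> 2" if "u \<in> Qs m" for u m
    unfolding N_def
  proof (rule integral_le_const_PM[OF mu sq_meas])
    show "\<bar>sqs (u y)\<bar> \<le> 2" "sqs (u y) \<le> 2" for y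
      using bd[OF that] sqs_nonneg[of "u y"] sqs_le_2[of "u y"] by (auto simp: abs_of_nonneg)
  qed (rule meas[OF that])
  define v where "v = (\<lambda>m. INF u\<in>Qs m. N u)"
  have bdd: "bdd_below (N ` Qs m)" for m using N0 by (intro bdd_belowI2) auto
  have v_le: "v m \<le> N u" if "u \<in> Qs m" for m u
    unfolding v_def by (rule cINF_lower[OF bdd that])
  have v_mono: "v l \<le> v m" if "l \<le> m" for l m
    unfolding v_def by (rule cINF_superset_mono[OF ne bdd dec[OF that]]) simp
  have v_le2: "v m \<le> 2" for m
  proof -
    obtain u where "u \<in> Qs m" using ne by blast
    then show ?thesis using v_le[of u m] N2[of u m] by linarith
  qed
  have v_bdd: "bdd_above (range v)" using v_le2 by (intro bdd_aboveI2) auto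
  define V where "V = (SUP m. v m)"
  have vV: "v m \<le> V" for m unfolding V_def by (rule cSUP_upper[OF _ v_bdd]) simp
  \<comment> \<open>The rate 8^(-j) is what makes the integrals of \<open>4 ^ j * D j\<close>
    summable below.\<close>
  have "\<exists>R. \<forall>l\<ge>R. V - v l \<le> (1 / 8) ^ j" for j :: nat
  proof -
    have "V - (1 / 8) ^ j < V" by simp
    then obtain R where "V - (1 / 8) ^ j < v R"
      unfolding V_def by (subst (asm) less_cSUP_iff[OF _ v_bdd]) auto
    then show ?thesis using v_mono by (intro exI[of _ R]) (smt (verit))
  qed
  then obtain R where R: "\<And>j l. R j \<le> l \<Longrightarrow> V - v l \<le> (1 / 8) ^ j" by metis
  \<comment> \<open>Monotone in j and at least R j; the summand j gives \<open>j \<le> r j\<close>,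
    so that \<open>u j\<close> lies in \<open>Qs j\<close>.\<close>
  define r where "r = (\<lambda>j. j + (\<Sum>i\<le>j. R i))"
  have rR: "R j \<le> r j" for j
    unfolding r_def by (intro trans_le_add2 member_le_sum) auto
  have r_mono: "r j \<le> r (Suc j)" "j \<le> r j" for j by (auto simp: r_def)
  have "\<exists>u. u \<in> Qs (r j) \<and> N u \<le> v (r j) + (1 / 8) ^ j" for j
  proof -
    have "v (r j) < v (r j) + (1 / 8) ^ j" by simp
    then obtain u where "u \<in> Qs (r j)" "N u < v (r j) + (1 / 8) ^ j"
      unfolding v_def by (subst (asm) cINF_less_iff[OF ne bdd]) auto
    then show ?thesis by (intro exI[of _ u]) auto
  qed
  then obtain u where u: "\<And>j. u j \<in> Qs (r j)" "\<And>j. N (u j) \<le> v (r j) + (1 / 8) ^ j" by metis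
  define D where "D = (\<lambda>j y. sqs (\<lambda>i. (u j y i - u (Suc j) y i) / 2))"
  have um: "(\<lambda>y. u j y i) \<in> borel_measurable borel" for j i using meas[OF u(1)] .
  have ub: "\<bar>u j y i\<bar> \<le> 1" for j y i using bd[OF u(1)] .
  have db: "\<bar>(u j y i - u (Suc j) y i) / 2\<bar> \<le> 1" and mb: "\<bar>(u j y i + u (Suc j) y i) / 2\<bar> \<le> 1" for j y i
    using ub[of j y i] ub[of "Suc j" y i] by (auto simp: abs_le_iff)
  have dm: "(\<lambda>y. (u j y i - u (Suc j) y i) / 2) \<in> borel_measurable borel"
    and mm: "(\<lambda>y. (u j y i + u (Suc j) y i) / 2) \<in> borel_measurable borel" for j i
    by (intro borel_measurable_divide borel_measurable_diff borel_measurable_add um borel_measurable_const)+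
  have D_meas: "D j \<in> borel_measurable borel" for j unfolding D_def by (rule sq_meas[OF dm])
  have D_int: "integrable \<mu> (D j)" for j unfolding D_def by (rule sq_int[OF dm db])
  have D_nonneg: "0 \<le> D j y" for j y unfolding D_def by (rule sqs_nonneg[OF db])
  have D_small: "(\<integral>y. D j y \<partial>\<mu>) \<le> 2 * (1 / 8) ^ j" for j
  proof -
    let ?w = "\<lambda>y i. (u j y i + u (Suc j) y i) / 2"
    \<comment> \<open>The midpoint again lies in \<open>Qs (r j)\<close>, so its norm is at least
      \<open>v (r j)\<close>; the parallelogram law then turns near minimality into a bound for
      D.\<close>
    have w: "?w \<in> Qs (r j)"
      using u(1)[of "Suc j"] dec[OF r_mono(1)[of j]] by (intro mid u) blast
    have "N ?w + (\<integral>y. D j y \<partial>\<mu>) = (\<integral>y. sqs (?w y) + D j y \<partial>\<mu>)"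
      unfolding N_def using sq_int[OF mm mb] D_int by (rule Bochner_Integration.integral_add[symmetric])
    also have "\<dots> = (\<integral>y. (sqs (u j y) + sqs (u (Suc j) y)) / 2 \<partial>\<mu>)"
    proof -
      have "sqs (?w y) + D j y = (sqs (u j y) + sqs (u (Suc j) y)) / 2" for y
        unfolding D_def by (rule sqs_parallelogram[OF ub ub])
      then show ?thesis by (simp only:)
    qed
    also have "\<dots> = (N (u j) + N (u (Suc j))) / 2"
      unfolding N_def using sq_int[OF um ub] by simp
    finally have "(\<integral>y. D j y \<partial>\<mu>) = (N (u j) + N (u (Suc j))) / 2 - N ?w" by linarith
    also have "\<dots> \<le> ((v (r j) + (1 / 8) ^ j) + (v (r (Suc j)) + (1 / 8) ^ Suc j)) / 2 - v (r j)"
      using add_mono[OF u(2)[of j] u(2)[of "Suc j"]] v_le[OF w] by (intro diff_mono divide_right_mono) simp_all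
    also have "\<dots> \<le> ((v (r j) + (1 / 8) ^ j) + (V + (1 / 8) ^ j)) / 2 - v (r j)"
    proof (intro diff_mono divide_right_mono add_mono order_refl vV)
      show "(1 / 8 :: real) ^ Suc j \<le> (1 / 8) ^ j" by simp
    qed simp
    also have "\<dots> = (V - v (r j)) / 2 + (1 / 8) ^ j" by (simp add: field_simps)
    also have "\<dots> \<le> (2 * (1 / 8) ^ j) / 2 + (1 / 8) ^ j"
      using R[OF rR[of j]] by (intro add_right_mono divide_right_mono order_trans[OF R[OF rR[of j]]]) simp_all
    also have "\<dots> = 2 * (1 / 8) ^ j" by simp
    finally show ?thesis .
  qed
  have D_meas': "(\<lambda>y. ennreal (4 ^ j * D j y)) \<in> borel_measurable \<mu>" for j
    using D_meas[of j] by (simp add: PM_measurable[OF mu])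
  have "(\<integral>\<^sup>+y. (\<Sum>j. ennreal (4 ^ j * D j y)) \<partial>\<mu>) = (\<Sum>j. \<integral>\<^sup>+y. ennreal (4 ^ j * D j y) \<partial>\<mu>)"
    by (rule nn_integral_suminf[OF D_meas'])
  also have "\<dots> \<le> (\<Sum>j. ennreal (2 * (1 / 2) ^ j))"
  proof (intro suminf_le allI summableI)
    fix j
    have "(\<integral>\<^sup>+y. ennreal (4 ^ j * D j y) \<partial>\<mu>) = ennreal (\<integral>y. 4 ^ j * D j y \<partial>\<mu>)"
      using D_int[of j] D_nonneg[of j] by (intro nn_integral_eq_integral) auto
    also have "(\<integral>y. 4 ^ j * D j y \<partial>\<mu>) = 4 ^ j * (\<integral>y. D j y \<partial>\<mu>)" by simp
    also have "\<dots> \<le> 4 ^ j * (2 * (1 / 8) ^ j)" by (intro mult_left_mono D_small) simp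
    also have "\<dots> = 2 * (1 / 2) ^ j" by (simp add: power_mult_distrib[symmetric])
    finally show "(\<integral>\<^sup>+y. ennreal (4 ^ j * D j y) \<partial>\<mu>) \<le> ennreal (2 * (1 / 2) ^ j)" by (simp add: ennreal_leI)
  qed
  also have "\<dots> = ennreal (\<Sum>j. 2 * (1 / 2) ^ j)"
    by (intro suminf_ennreal2 summable_mult summable_geometric) auto
  finally have fin: "(\<integral>\<^sup>+y. (\<Sum>j. ennreal (4 ^ j * D j y)) \<partial>\<mu>) \<noteq> \<infinity>"
    using ennreal_less_top le_less_trans by (metis infinity_ennreal_def less_irrefl)
  have "AE y in \<mu>. (\<Sum>j. ennreal (4 ^ j * D j y)) \<noteq> \<infinity>"
    by (rule nn_integral_noteq_infinite[OF _ fin]) (intro borel_measurable_suminf_order D_meas')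
  then have "AE y in \<mu>. \<forall>i. convergent (\<lambda>j. u j y i)"
  proof eventually_elim
    fix y assume "(\<Sum>j. ennreal (4 ^ j * D j y)) \<noteq> \<infinity>"
    then obtain S where S: "(\<Sum>j. ennreal (4 ^ j * D j y)) = ennreal S" "0 \<le> S"
      by (cases "\<Sum>j. ennreal (4 ^ j * D j y)") auto
    have DS: "4 ^ j * D j y \<le> S" for j
    proof -
      have "sum (\<lambda>j. ennreal (4 ^ j * D j y)) {j} \<le> (\<Sum>j. ennreal (4 ^ j * D j y))"
        by (rule sum_le_suminf) auto
      then show ?thesis using S by simp
    qed
    show "\<forall>i. convergent (\<lambda>j. u j y i)"
    proof
      fix i
      show "convergent (\<lambda>j. u j y i)"
      proof (rule convergent_of_geometric_squares[where S = "4 * 2 ^ i * S"])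
        fix j
        have "(1 / 2) ^ i * ((u j y i - u (Suc j) y i) / 2)\<^sup>2 \<le> D j y"
          unfolding D_def by (rule sqs_term_le[OF db])
        then have "(u j y i - u (Suc j) y i)\<^sup>2 \<le> 4 * 2 ^ i * D j y"
          by (simp add: power_divide power_one_over field_simps)
        then have "4 ^ j * (u j y i - u (Suc j) y i)\<^sup>2 \<le> 4 ^ j * (4 * 2 ^ i * D j y)"
          by (rule mult_left_mono) simp
        also have "\<dots> = 4 * 2 ^ i * (4 ^ j * D j y)" by simp
        also have "\<dots> \<le> 4 * 2 ^ i * S" by (intro mult_left_mono DS) simp
        finally show "4 ^ j * (u j y i - u (Suc j) y i)\<^sup>2 \<le> 4 * 2 ^ i * S" .
      qed
    qed
  qed
  moreover have "u j \<in> Qs j" for j using u(1)[of j] dec[OF r_mono(2)[of j]] by blast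
  ultimately show ?thesis by blast
qed

section \<open>Duality and existence of optimal kernels\<close>

lemma abs_average_diff_le:
  fixes s t q e :: real
  assumes "\<bar>s - q\<bar> \<le> e" "\<bar>t - q\<bar> \<le> e" shows "\<bar>(s + t) / 2 - q\<bar> \<le> e"
proof -
  have "\<bar>(s - q) + (t - q)\<bar> \<le> e * 2" using assms by linarith
  moreover have eq: "(s + t) / 2 - q = ((s - q) + (t - q)) / 2" by (simp add: field_simps)
  ultimately show ?thesis unfolding eq abs_divide by simp
qed

lemma ennreal_integral_le:
  assumes "integrable M g" shows "ennreal (\<integral>x. g x \<partial>M) \<le> (\<integral>\<^sup>+x. ennreal (g x) \<partial>M)"
proof -
  have "(\<integral>x. g x \<partial>M) \<le> (\<integral>x. max 0 (g x) \<partial>M)"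
    using assms by (intro integral_mono integrable_max) auto
  then have "ennreal (\<integral>x. g x \<partial>M) \<le> ennreal (\<integral>x. max 0 (g x) \<partial>M)" by (rule ennreal_leI)
  also have "\<dots> = (\<integral>\<^sup>+x. ennreal (max 0 (g x)) \<partial>M)"
    using assms by (intro nn_integral_eq_integral[symmetric] integrable_max) auto
  also have "\<dots> = (\<integral>\<^sup>+x. ennreal (g x) \<partial>M)"
    by (intro nn_integral_cong) (simp add: max_def ennreal_neg)
  finally show ?thesis .
qed

section \<open>Mixtures of kernels\<close>

lemma kernel_PM: "\<mu> \<in> PM \<Longrightarrow> K \<in> measurable \<mu> (prob_algebra borel) \<Longrightarrow> K y \<in> PM"
  using measurable_space[of K \<mu> "prob_algebra borel" y] by (simp add: PM_space PM_def)

lemma bind_PM: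
  assumes mu: "\<mu> \<in> PM" and K: "K \<in> measurable \<mu> (prob_algebra borel)" shows "bind \<mu> K \<in> PM"
proof -
  interpret prob_space \<mu> by (rule PM_prob) fact
  have "prob_space (bind \<mu> K)"
    using kernel_PM[OF mu K] measurable_prob_algebraD[OF K]
    by (intro prob_space_bind[of K borel] AE_I2) (simp_all add: PM_prob)
  moreover have "sets (bind \<mu> K) = sets borel"
    using kernel_PM[OF mu K] not_empty by (intro sets_bind) (simp_all add: PM_sets)
  ultimately show ?thesis by (simp add: PM_iff)
qed

text \<open>\<open>nn_integral_bind\<close> handles nonnegative integrands; adding the constant
  \<open>supn f\<close> reduces to that case.\<close>

lemma integral_bind_PM:
  fixes f :: "'x::topological_space \<Rightarrow> real"
  assumes mu: "\<mu> \<in> PM" and K: "K \<in> measurable \<mu> (prob_algebra borel)" and f: "f \<in> Cb"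
  shows "(\<integral>x. f x \<partial>bind \<mu> K) = (\<integral>y. (\<integral>x. f x \<partial>K y) \<partial>\<mu>)"
proof -
  note B = bind_PM[OF mu K]
  have KPM: "K y \<in> PM" for y by (rule kernel_PM[OF mu K])
  have I_meas: "(\<lambda>y. \<integral>x. h x \<partial>K y) \<in> borel_measurable borel" if "h \<in> Cb" for h :: "'x \<Rightarrow> real"
    using measurable_integral_prob_algebra[OF K that] by (simp add: PM_measurable[OF mu])
  have I_int: "integrable \<mu> (\<lambda>y. \<integral>x. h x \<partial>K y)" if "h \<in> Cb" for h :: "'x \<Rightarrow> real"
    by (rule bounded_integrable_PM[OF mu I_meas[OF that] Cb_integral_abs_le[OF KPM that]])
  have nonneg_case: "(\<integral>x. h x \<partial>bind \<mu> K) = (\<integral>y. (\<integral>x. h x \<partial>K y) \<partial>\<mu>)"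
    if h: "h \<in> Cb" "\<And>x. 0 \<le> h x" for h :: "'x \<Rightarrow> real"
  proof -
    have in_nonneg: "0 \<le> (\<integral>x. h x \<partial>K y)" for y using h(2) by (intro Bochner_Integration.integral_nonneg) auto
    have "ennreal (\<integral>x. h x \<partial>bind \<mu> K) = (\<integral>\<^sup>+x. ennreal (h x) \<partial>bind \<mu> K)"
      using Cb_integrable[OF B h(1)] h(2) by (intro nn_integral_eq_integral[symmetric]) auto
    also have "\<dots> = (\<integral>\<^sup>+y. \<integral>\<^sup>+x. ennreal (h x) \<partial>K y \<partial>\<mu>)"
      using Cb_measurable[OF h(1)] measurable_prob_algebraD[OF K] by (intro nn_integral_bind[of _ borel]) auto
    also have "\<dots> = (\<integral>\<^sup>+y. ennreal (\<integral>x. h x \<partial>K y) \<partial>\<mu>)"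
      using Cb_integrable[OF KPM h(1)] h(2) by (intro nn_integral_cong nn_integral_eq_integral) auto
    also have "\<dots> = ennreal (\<integral>y. (\<integral>x. h x \<partial>K y) \<partial>\<mu>)"
      using I_int[OF h(1)] in_nonneg by (intro nn_integral_eq_integral) auto
    finally show ?thesis
      using h(2) in_nonneg by (simp add: Bochner_Integration.integral_nonneg)
  qed
  define c where "c = supn f"
  have fc: "(\<lambda>x. f x + c) \<in> Cb" using f by auto
  have "0 \<le> f x + c" for x using Cb_abs_le[OF f, of x] by (auto simp: c_def abs_le_iff)
  from nonneg_case[OF fc this]
  have "(\<integral>x. f x + c \<partial>bind \<mu> K) = (\<integral>y. (\<integral>x. f x + c \<partial>K y) \<partial>\<mu>)" .
  moreover have "(\<integral>x. f x + c \<partial>bind \<mu> K) = (\<integral>x. f x \<partial>bind \<mu> K) + c"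
    using Cb_integrable[OF B f] Cb_integrable[OF B Cb_const[of c]] integral_const_PM[OF B, of c]
    by (simp add: Bochner_Integration.integral_add B)
  moreover have "(\<integral>x. f x + c \<partial>K y) = (\<integral>x. f x \<partial>K y) + c" for y
    using Cb_integrable[OF KPM f] Cb_integrable[OF KPM Cb_const[of c]] integral_const_PM[OF KPM]
    by (simp add: Bochner_Integration.integral_add KPM)
  moreover have "(\<integral>y. (\<integral>x. f x \<partial>K y) + c \<partial>\<mu>) = (\<integral>y. (\<integral>x. f x \<partial>K y) \<partial>\<mu>) + c"
    using I_int[OF f] Cb_integrable[OF mu Cb_const[of c]] integral_const_PM[OF mu, of c]
    by (simp add: Bochner_Integration.integral_add mu)
  ultimately show ?thesis by simp
qed

section \<open>Weak duality, approximate kernels and strong duality\<close>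

context kn_system
begin

text \<open>Weak duality: the inequality \<open>integral_le_cost\<close> on each fibre, integrated
  over y.\<close>

lemma dual_le_of_kernel:
  assumes K: "K \<in> kernels_for \<mu> Q" and cost: "kcost \<mu> J K \<le> ennreal a" and a: "0 \<le> a"
  shows "dual_le a Q"
  unfolding dual_le_def
proof
  fix h :: "'x \<Rightarrow> real" assume h: "h \<in> Cb"
  have Km: "K \<in> measurable \<mu> (prob_algebra borel)" and Q: "bind \<mu> K = Q"
    using K by (auto simp: kernels_for_def)
  have KPM: "K y \<in> PM" for y by (rule kernel_PM[OF mu Km])
  have I_meas: "(\<lambda>y. \<integral>x. h x \<partial>K y) \<in> borel_measurable borel"
    using measurable_integral_prob_algebra[OF Km h] by (simp add: PM_measurable[OF mu])
  have I_int: "integrable \<mu> (\<lambda>y. \<integral>x. h x \<partial>K y)"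
    by (rule bounded_integrable_PM[OF mu I_meas Cb_integral_abs_le[OF KPM h]])
  have "(\<integral>x. h x \<partial>Q) - p h = (\<integral>y. (\<integral>x. h x \<partial>K y) - vsup (J y) h \<partial>\<mu>)"
    unfolding Q[symmetric] integral_bind_PM[OF mu Km h] p_def
    using I_int vsup_integrable[OF h] by simp
  then have "ennreal ((\<integral>x. h x \<partial>Q) - p h) \<le> (\<integral>\<^sup>+y. ennreal ((\<integral>x. h x \<partial>K y) - vsup (J y) h) \<partial>\<mu>)"
    using ennreal_integral_le[of \<mu> "\<lambda>y. (\<integral>x. h x \<partial>K y) - vsup (J y) h"] I_int vsup_integrable[OF h] by simp
  also have "\<dots> \<le> kcost \<mu> J K"
    unfolding kcost_def by (intro nn_integral_mono rate_fn.integral_le_cost[OF rate_fn_J KPM h])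
  also have "\<dots> \<le> ennreal a" by (rule cost)
  finally have "(\<integral>x. h x \<partial>Q) - p h \<le> a" using a by (simp add: ennreal_le_iff)
  then show "(\<integral>x. h x \<partial>Q) \<le> p h + a" by simp
qed

text \<open>\<open>\<Lambda> y\<close> stands for integration against the kernel at \<open>y\<close>, and \<open>c y\<close> for its cost. The
  tilted laws need not be concentrated on the set where \<open>J y\<close> is finite, so the cost is controlled
  through the prelimit functionals \<open>lamz k\<close> instead of \<open>J\<close>. Working with functionals rather than
  measures makes convex combinations trivial.\<close>

definition approx :: "'x measure \<Rightarrow> real \<Rightarrow> nat \<Rightarrow> ('z \<Rightarrow> ('x \<Rightarrow> real) \<Rightarrow> real) \<Rightarrow> ('z \<Rightarrow> real) \<Rightarrow> bool" where
  "approx Q a m \<Lambda> c \<longleftrightarrow> (\<forall>y. linear_on_Cb (\<Lambda> y)) \<and> (\<forall>y. \<forall>h\<in>Cb. \<bar>\<Lambda> y h\<bar> \<le> supn h) \<and>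
    (\<forall>h\<in>Cb. (\<lambda>y. \<Lambda> y h) \<in> borel_measurable borel) \<and>
    c \<in> borel_measurable borel \<and> (\<forall>y. 0 \<le> c y) \<and> integrable \<mu> c \<and> (\<integral>y. c y \<partial>\<mu>) \<le> a + 1 / real (Suc m) \<and>
    (\<forall>y. \<forall>h\<in>Cb. \<forall>r. (\<forall>k\<ge>Suc m. lamz k h y \<le> r) \<longrightarrow> \<Lambda> y h \<le> c y + r) \<and>
    (\<forall>i<m. \<bar>(\<integral>y. \<Lambda> y (detf i) \<partial>\<mu>) - (\<integral>x. detf i x \<partial>Q)\<bar> \<le> 1 / real (Suc m))"

lemma approxD:
  assumes "approx Q a m \<Lambda> c"
  shows "linear_on_Cb (\<Lambda> y)" "h \<in> Cb \<Longrightarrow> \<bar>\<Lambda> y h\<bar> \<le> supn h" "h \<in> Cb \<Longrightarrow> (\<lambda>y. \<Lambda> y h) \<in> borel_measurable borel"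
    "c \<in> borel_measurable borel" "0 \<le> c y" "integrable \<mu> c" "(\<integral>y. c y \<partial>\<mu>) \<le> a + 1 / real (Suc m)"
    "h \<in> Cb \<Longrightarrow> (\<And>k. k \<ge> Suc m \<Longrightarrow> lamz k h y \<le> r) \<Longrightarrow> \<Lambda> y h \<le> c y + r"
    "i < m \<Longrightarrow> \<bar>(\<integral>y. \<Lambda> y (detf i) \<partial>\<mu>) - (\<integral>x. detf i x \<partial>Q)\<bar> \<le> 1 / real (Suc m)"
  using assms unfolding approx_def by blast+

lemma approx_mono:
  assumes "approx Q a m \<Lambda> c" "l \<le> m" shows "approx Q a l \<Lambda> c"
proof -
  have "1 / real (Suc m) \<le> 1 / real (Suc l)" using assms(2) by (simp add: frac_le)
  note le = this
  show ?thesis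
    unfolding approx_def
  proof (intro conjI allI ballI impI)
    show "(\<integral>y. c y \<partial>\<mu>) \<le> a + 1 / real (Suc l)" using approxD(7)[OF assms(1)] le by linarith
    show "\<bar>(\<integral>y. \<Lambda> y (detf i) \<partial>\<mu>) - (\<integral>x. detf i x \<partial>Q)\<bar> \<le> 1 / real (Suc l)" if "i < l" for i
      using approxD(9)[OF assms(1), of i] le that assms(2) by linarith
    show "\<Lambda> y h \<le> c y + r" if "h \<in> Cb" "\<forall>k\<ge>Suc l. lamz k h y \<le> r" for y h r
      using approxD(8)[OF assms(1) that(1)] that(2) assms(2) by simp
  qed (use approxD[OF assms(1)] in auto)
qed

text \<open>Two approximants may stem from tilts with different k, and their average need not be a
  tilt. The cost condition survives because it speaks of common upper bounds r of all
  \<open>lamz k h y\<close> with k > m.\<close>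

lemma approx_mid:
  assumes "approx Q a m \<Lambda> c" "approx Q a m \<Lambda>' c'"
  shows "approx Q a m (\<lambda>y h. (\<Lambda> y h + \<Lambda>' y h) / 2) (\<lambda>y. (c y + c' y) / 2)"
proof -
  note A = approxD[OF assms(1)] and A' = approxD[OF assms(2)]
  have int: "integrable \<mu> (\<lambda>y. \<Lambda> y h)" "integrable \<mu> (\<lambda>y. \<Lambda>' y h)" if "h \<in> Cb" for h
    using A(2,3)[OF that] A'(2,3)[OF that] by (auto intro: bounded_integrable_PM[OF mu])
  show ?thesis
    unfolding approx_def
  proof (intro conjI allI ballI impI)
    show "linear_on_Cb (\<lambda>h. (\<Lambda> y h + \<Lambda>' y h) / 2)" for y
      unfolding linear_on_Cb_def
      using linear_on_CbD[OF A(1)[of y]] linear_on_CbD[OF A'(1)[of y]]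
      by (auto simp: field_simps)
    show "\<bar>(\<Lambda> y h + \<Lambda>' y h) / 2\<bar> \<le> supn h" if "h \<in> Cb" for y h
      using A(2)[OF that, of y] A'(2)[OF that, of y] by (auto simp: abs_le_iff)
    show "(\<lambda>y. (\<Lambda> y h + \<Lambda>' y h) / 2) \<in> borel_measurable borel" if "h \<in> Cb" for h
      by (intro borel_measurable_divide borel_measurable_add A(3) A'(3) that borel_measurable_const)
    show "(\<lambda>y. (c y + c' y) / 2) \<in> borel_measurable borel"
      by (intro borel_measurable_divide borel_measurable_add A(4) A'(4) borel_measurable_const)
    show "0 \<le> (c y + c' y) / 2" for y using A(5)[of y] A'(5)[of y] by simp
    show "integrable \<mu> (\<lambda>y. (c y + c' y) / 2)" using A(6) A'(6) by simp
    show "(\<integral>y. (c y + c' y) / 2 \<partial>\<mu>) \<le> a + 1 / real (Suc m)"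
      using A(6,7) A'(6,7) by simp
    show "(\<Lambda> y h + \<Lambda>' y h) / 2 \<le> (c y + c' y) / 2 + r"
      if "h \<in> Cb" "\<forall>k\<ge>Suc m. lamz k h y \<le> r" for y h r
    proof -
      have "\<Lambda> y h \<le> c y + r" "\<Lambda>' y h \<le> c' y + r"
        using that by (auto intro!: A(8) A'(8))
      then have "\<Lambda> y h + \<Lambda>' y h \<le> (c y + c' y) + r * 2" by simp
      then have "(\<Lambda> y h + \<Lambda>' y h) / 2 \<le> ((c y + c' y) + r * 2) / 2" by (rule divide_right_mono) simp
      then show ?thesis by (simp add: add_divide_distrib)
    qed
    show "\<bar>(\<integral>y. (\<Lambda> y (detf i) + \<Lambda>' y (detf i)) / 2 \<partial>\<mu>) - (\<integral>x. detf i x \<partial>Q)\<bar> \<le> 1 / real (Suc m)"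
      if "i < m" for i
    proof -
      have "(\<integral>y. (\<Lambda> y (detf i) + \<Lambda>' y (detf i)) / 2 \<partial>\<mu>)
          = ((\<integral>y. \<Lambda> y (detf i) \<partial>\<mu>) + (\<integral>y. \<Lambda>' y (detf i) \<partial>\<mu>)) / 2"
        using int[OF detf_Cb[of i]] by simp
      then show ?thesis using abs_average_diff_le[OF A(9)[OF that] A'(9)[OF that]] by simp
    qed
  qed
qed

text \<open>The fibre at y is the tilt of \<open>P k y\<close> by k g, with g the same for all y,
  which makes the means continuous in y. The cost condition on the fibres is
  \<open>tilt_mean_le\<close> applied to k h.\<close>

lemma approx_ex:
  assumes Q: "Q \<in> PM" and dom: "dual_le a Q" and a: "0 \<le> a"
  shows "\<exists>\<Lambda> c. approx Q a m \<Lambda> c"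
proof -
  have e: "0 < 1 / real (Suc m)" by simp
  have "\<forall>\<^sub>F k in sequentially. Suc m \<le> k" by (rule eventually_ge_at_top)
  then have "\<forall>\<^sub>F k in sequentially. \<exists>\<Lambda> c. approx Q a m \<Lambda> c"
    using tilting[where f = detf and d = m, OF Q dom a detf_Cb e]
  proof eventually_elim
    fix k :: nat
    assume k': "Suc m \<le> k" and ex: "\<exists>t g. g = (\<lambda>x. \<Sum>j<m. t j * detf j x) \<and>
        (\<forall>j<m. \<bar>(\<integral>y. tmean k (\<lambda>x. real k * g x) (detf j) y \<partial>\<mu>) - (\<integral>x. detf j x \<partial>Q)\<bar> < 1 / real (Suc m)) \<and>
        (\<Sum>j<m. t j * (\<integral>y. tmean k (\<lambda>x. real k * g x) (detf j) y \<partial>\<mu>)) - lam k g \<le> a + 1 / real (Suc m)"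
    then have k: "1 \<le> k" by simp
    from ex obtain t g where g: "g = (\<lambda>x. \<Sum>j<m. t j * detf j x)"
        and mean: "\<And>j. j < m \<Longrightarrow> \<bar>(\<integral>y. tmean k (\<lambda>x. real k * g x) (detf j) y \<partial>\<mu>) - (\<integral>x. detf j x \<partial>Q)\<bar> < 1 / real (Suc m)"
        and cost: "(\<Sum>j<m. t j * (\<integral>y. tmean k (\<lambda>x. real k * g x) (detf j) y \<partial>\<mu>)) - lam k g \<le> a + 1 / real (Suc m)"
      by blast
    have g_Cb: "g \<in> Cb" unfolding g by (intro Cb_sum Cb_scale detf_Cb)
    define G where "G = (\<lambda>x. real k * g x)"
    have G_Cb: "G \<in> Cb" unfolding G_def by (rule Cb_scale[OF g_Cb])
    define \<Lambda> where "\<Lambda> = (\<lambda>y h. tmean k G h y)"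
    \<comment> \<open>The relative entropy of the tilted law with respect to \<open>P k y\<close>,
      divided by k.\<close>
    define c where "c = (\<lambda>y. tmean k G g y - lamz k g y)"
    have T: "tilt (P k y) G \<in> PM" for y by (rule tilt_PM[OF P_PM[OF k] G_Cb])
    have c_Cb: "c \<in> Cb" unfolding c_def by (intro Cb_diff tmean_Cb[OF k G_Cb g_Cb] lamz_Cb[OF k g_Cb])
    have le: "\<Lambda> y h \<le> c y + lamz k h y" if h: "h \<in> Cb" for y h
    proof -
      have "(\<integral>x. real k * h x \<partial>tilt (P k y) G)
          \<le> ((\<integral>x. G x \<partial>tilt (P k y) G) - ln (mgf (P k y) G)) + ln (mgf (P k y) (\<lambda>x. real k * h x))"
        by (rule tilt_mean_le[OF P_PM[OF k] G_Cb Cb_scale[OF h]])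
      then have "real k * \<Lambda> y h \<le> real k * (c y + lamz k h y)"
        using k by (simp add: \<Lambda>_def tmean_def c_def lamz_def cgf_def G_def algebra_simps)
      then show ?thesis using k by simp
    qed
    have "approx Q a m \<Lambda> c"
      unfolding approx_def
    proof (intro conjI allI ballI impI)
      show "linear_on_Cb (\<Lambda> y)" for y unfolding \<Lambda>_def tmean_def by (rule linear_on_Cb_integral[OF T])
      show "\<bar>\<Lambda> y h\<bar> \<le> supn h" if "h \<in> Cb" for y h
        unfolding \<Lambda>_def tmean_def by (rule Cb_integral_abs_le[OF T that])
      show "(\<lambda>y. \<Lambda> y h) \<in> borel_measurable borel" if "h \<in> Cb" for h
        unfolding \<Lambda>_def using Cb_measurable[OF tmean_Cb[OF k G_Cb that]] by simp
      show "c \<in> borel_measurable borel" by (rule Cb_measurable[OF c_Cb])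
      show "integrable \<mu> c" by (rule Cb_integrable[OF mu c_Cb])
      show "0 \<le> c y" for y
      proof -
        have "lamz k (\<lambda>_. 0) y = 0" using P_PM[OF k] by (simp add: lamz_def cgf_def mgf_def)
        moreover have "\<Lambda> y (\<lambda>_. 0) = 0" by (simp add: \<Lambda>_def tmean_def)
        ultimately show ?thesis using le[of "\<lambda>_. 0" y] by simp
      qed
      show "\<Lambda> y h \<le> c y + r" if "h \<in> Cb" "\<forall>k\<ge>Suc m. lamz k h y \<le> r" for y h r
      proof -
        have "lamz k h y \<le> r" using that(2) k' by blast
        then show ?thesis using le[OF that(1), of y] by linarith
      qed
      show "\<bar>(\<integral>y. \<Lambda> y (detf i) \<partial>\<mu>) - (\<integral>x. detf i x \<partial>Q)\<bar> \<le> 1 / real (Suc m)" if "i < m" for i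
        using mean[OF that] by (simp add: \<Lambda>_def G_def)
      have tm: "tmean k G g y = (\<Sum>j<m. t j * tmean k G (detf j) y)" for y
        unfolding tmean_def g using Cb_integrable[OF T detf_Cb]
        by (subst Bochner_Integration.integral_sum) auto
      have "(\<integral>y. tmean k G g y \<partial>\<mu>) = (\<Sum>j<m. t j * (\<integral>y. tmean k G (detf j) y \<partial>\<mu>))"
        unfolding tm using Cb_integrable[OF mu tmean_Cb[OF k G_Cb detf_Cb]]
        by (subst Bochner_Integration.integral_sum) auto
      moreover have "(\<integral>y. c y \<partial>\<mu>) = (\<integral>y. tmean k G g y \<partial>\<mu>) - lam k g"
        unfolding c_def lam_def using Cb_integrable[OF mu tmean_Cb[OF k G_Cb g_Cb]] Cb_integrable[OF mu lamz_Cb[OF k g_Cb]]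
        by (rule Bochner_Integration.integral_diff)
      ultimately show "(\<integral>y. c y \<partial>\<mu>) \<le> a + 1 / real (Suc m)" using cost by (simp add: G_def)
    qed
    then show "\<exists>\<Lambda> c. approx Q a m \<Lambda> c" by blast
  qed
  then show ?thesis by (simp add: eventually_sequentially) blast
qed

lemma supn_detf_le: "supn (detf i :: 'x \<Rightarrow> real) \<le> 1"
proof (rule supn_le)
  show "\<bar>detf i x\<bar> \<le> 1" for x :: 'x using detf_bounds[of i x] by simp
qed

text \<open>The subsequence extracted here depends on \<open>y\<close>, but the means of the functions \<^const>\<open>detf\<close> under the limit
  do not, which makes the limit kernel measurable.\<close>

lemma fibre_limit:
  assumes app: "\<And>j. approx Q a j (\<Lambda> j) (c j)"
    and conv_y: "\<And>i. convergent (\<lambda>j. \<Lambda> j y (detf i))"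
    and L: "liminf (\<lambda>j. ennreal (c j y)) < \<infinity>"
  shows "\<exists>R\<in>PM. (\<forall>i. (\<integral>x. detf i x \<partial>R) = lim (\<lambda>j. \<Lambda> j y (detf i))) \<and>
    (\<integral>\<^sup>+x. J y x \<partial>R) \<le> liminf (\<lambda>j. ennreal (c j y))"
proof -
  obtain c0 where c0: "liminf (\<lambda>j. ennreal (c j y)) = ennreal c0" "0 \<le> c0"
    using L by (cases "liminf (\<lambda>j. ennreal (c j y))") auto
  \<comment> \<open>Were the cost at all indices beyond n larger than this, the limit inferior would
    exceed c0. The resulting index map tends to infinity but need not be monotone.\<close>
  have "\<exists>j\<ge>n. c j y \<le> c0 + 1 / real (Suc n)" for n
  proof (rule ccontr)
    assume "\<not> ?thesis"
    then have "\<And>j. n \<le> j \<Longrightarrow> c0 + 1 / real (Suc n) \<le> c j y" by (meson le_cases)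
    then have "\<forall>\<^sub>F j in sequentially. ennreal (c0 + 1 / real (Suc n)) \<le> ennreal (c j y)"
      unfolding eventually_sequentially by (intro exI[of _ n] allI impI ennreal_leI) simp
    then have "ennreal (c0 + 1 / real (Suc n)) \<le> ennreal c0" unfolding c0(1)[symmetric] by (rule Liminf_bounded)
    then have "1 / real (Suc n) \<le> 0" using c0(2) by (simp add: ennreal_le_iff del: of_nat_Suc)
    then show False by simp
  qed
  then obtain \<sigma> where \<sigma>: "\<And>n. n \<le> \<sigma> n" "\<And>n. c (\<sigma> n) y \<le> c0 + 1 / real (Suc n)" by metis
  obtain \<Theta> where \<Theta>: "linear_on_Cb \<Theta>"
    "\<And>f r. f \<in> Cb \<Longrightarrow> \<forall>\<^sub>F n in sequentially. \<Lambda> (\<sigma> n) y f \<le> r \<Longrightarrow> \<Theta> f \<le> r"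
    by (rule cluster_functional[of "\<lambda>n. \<Lambda> (\<sigma> n) y"]) (use approxD(1,2)[OF app] in blast)+
  have sigma_top: "filterlim \<sigma> sequentially sequentially"
    using \<sigma>(1) by (intro filterlim_at_top_mono[OF filterlim_ident]) auto
  have \<Theta>_lim: "\<Theta> (detf i) = lim (\<lambda>j. \<Lambda> j y (detf i))" for i
  proof -
    define l where "l = lim (\<lambda>j. \<Lambda> j y (detf i))"
    have "(\<lambda>j. \<Lambda> j y (detf i)) \<longlonglongrightarrow> l" unfolding l_def using conv_y[of i] by (simp add: convergent_LIMSEQ_iff)
    then have lim: "(\<lambda>n. \<Lambda> (\<sigma> n) y (detf i)) \<longlonglongrightarrow> l" by (rule filterlim_compose[OF _ sigma_top])
    have "\<Theta> (detf i) \<le> l + e" if "0 < e" for e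
      using order_tendstoD(2)[OF lim, of "l + e"] that
      by (intro \<Theta>(2)) (auto elim!: eventually_mono)
    then have 1: "\<Theta> (detf i) \<le> l" by (rule field_le_epsilon)
    \<comment> \<open>The lower bound for \<open>\<Theta> (detf i)\<close> is obtained as an upper
      bound for the negative, the only kind that \<open>cluster_functional\<close>
      transfers.\<close>
    have "\<Theta> (\<lambda>x. - detf i x) \<le> - l + e" if "0 < e" for e
    proof (rule \<Theta>(2)[OF Cb_minus[OF detf_Cb]])
      have "\<forall>\<^sub>F n in sequentially. l - e < \<Lambda> (\<sigma> n) y (detf i)"
        using order_tendstoD(1)[OF lim, of "l - e"] that by simp
      then show "\<forall>\<^sub>F n in sequentially. \<Lambda> (\<sigma> n) y (\<lambda>x. - detf i x) \<le> - l + e"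
        by eventually_elim (simp add: linear_on_Cb_minus[OF approxD(1)[OF app] detf_Cb])
    qed
    then have "\<Theta> (\<lambda>x. - detf i x) \<le> - l" by (rule field_le_epsilon)
    then show ?thesis using 1 linear_on_Cb_minus[OF \<Theta>(1) detf_Cb, of i] by (simp add: l_def)
  qed
  have \<Theta>_dom: "\<Theta> h \<le> vsup (J y) h + c0" if h: "h \<in> Cb" for h
  proof (rule field_le_epsilon)
    fix e :: real assume e: "0 < e"
    then have "\<forall>\<^sub>F k in sequentially. lamz k h y < vsup (J y) h + e / 2"
      by (intro order_tendstoD(2)[OF lamz_tendsto[OF h]]) simp
    then obtain N where N: "\<And>k. N \<le> k \<Longrightarrow> lamz k h y \<le> vsup (J y) h + e / 2"
      unfolding eventually_sequentially by (meson less_imp_le)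
    obtain N' where N': "1 / real (Suc N') < e / 2" using nat_approx_posE[of "e / 2"] e by auto
    show "\<Theta> h \<le> vsup (J y) h + c0 + e"
    proof (rule \<Theta>(2)[OF h])
      show "\<forall>\<^sub>F n in sequentially. \<Lambda> (\<sigma> n) y h \<le> vsup (J y) h + c0 + e"
        using eventually_ge_at_top[of "max N N'"]
      proof eventually_elim
        fix n assume n: "max N N' \<le> n"
        have "\<Lambda> (\<sigma> n) y h \<le> c (\<sigma> n) y + (vsup (J y) h + e / 2)"
        proof (rule approxD(8)[OF app h])
          fix k assume "Suc (\<sigma> n) \<le> k"
          then show "lamz k h y \<le> vsup (J y) h + e / 2" using \<sigma>(1)[of n] n by (intro N) simp
        qed
        moreover have "1 / real (Suc n) \<le> 1 / real (Suc N')" using n by (simp add: frac_le)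
        ultimately show "\<Lambda> (\<sigma> n) y h \<le> vsup (J y) h + c0 + e"
          using \<sigma>(2)[of n] N' by linarith
      qed
    qed
  qed
  from dominated_functional_representation[OF \<Theta>(1) dini_vsup \<Theta>_dom]
  obtain R where R: "R \<in> PM" "\<And>f. f \<in> Cb \<Longrightarrow> \<Theta> f = (\<integral>x. f x \<partial>R)" by blast
  have "(\<integral>\<^sup>+x. J y x \<partial>R) \<le> ennreal c0"
    using rate_fn.cost_le_of_dominated[OF rate_fn_J R(1), of c0 y] R(2) \<Theta>_dom by (simp add: add.commute)
  then show ?thesis
    using R \<Theta>_lim unfolding c0(1) by (intro bexI[of _ R]) auto
qed

text \<open>Strong duality with attainment. Near minimisers converge in all means of
  \<open>detf\<close> for almost every y, \<open>fibre_limit\<close> turns the limits into measures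
  of controlled cost, and \<open>PM_eqI\<close> identifies their mixture as Q.\<close>

theorem kernel_of_dual_le:
  assumes Q: "Q \<in> PM" and dom: "dual_le a Q" and a: "0 \<le> a"
  shows "\<exists>K\<in>kernels_for \<mu> Q. kcost \<mu> J K \<le> ennreal a"
proof -
  interpret prob_space \<mu> using mu by (rule PM_prob)
  define Qs where "Qs = (\<lambda>m. {u. \<exists>\<Lambda> c. approx Q a m \<Lambda> c \<and> u = (\<lambda>y i. \<Lambda> y (detf i))})"
  have "\<exists>u. (\<forall>j. u j \<in> Qs j) \<and> (AE y in \<mu>. \<forall>i. convergent (\<lambda>j. u j y i))"
  proof (rule near_minimisers_converge[OF mu])
    show "Qs m \<noteq> {}" for m using approx_ex[OF Q dom a, of m] by (auto simp: Qs_def)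
    show "Qs m \<subseteq> Qs l" if "l \<le> m" for l m using approx_mono that by (fastforce simp: Qs_def)
    show "(\<lambda>y i. (u y i + v y i) / 2) \<in> Qs m" if uv: "u \<in> Qs m" "v \<in> Qs m" for m u v
    proof -
      obtain \<Lambda> c where 1: "approx Q a m \<Lambda> c" "u = (\<lambda>y i. \<Lambda> y (detf i))" using uv(1) by (auto simp: Qs_def)
      obtain \<Lambda>' c' where 2: "approx Q a m \<Lambda>' c'" "v = (\<lambda>y i. \<Lambda>' y (detf i))" using uv(2) by (auto simp: Qs_def)
      show ?thesis
        unfolding Qs_def using approx_mid[OF 1(1) 2(1)] 1(2) 2(2) by blast
    qed
    show "(\<lambda>y. u y i) \<in> borel_measurable borel" if "u \<in> Qs m" for m u i
      using that approxD(3)[OF _ detf_Cb] by (auto simp: Qs_def)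
    show "\<bar>u y i\<bar> \<le> 1" if "u \<in> Qs m" for m u y i
    proof -
      obtain \<Lambda> c where 1: "approx Q a m \<Lambda> c" "u = (\<lambda>y i. \<Lambda> y (detf i))" using \<open>u \<in> Qs m\<close> by (auto simp: Qs_def)
      have "\<bar>\<Lambda> y (detf i)\<bar> \<le> 1"
        using approxD(2)[OF 1(1) detf_Cb, of y i] supn_detf_le[of i] by linarith
      then show ?thesis using 1(2) by simp
    qed
  qed
  then obtain u where u: "\<And>j. u j \<in> Qs j" "AE y in \<mu>. \<forall>i. convergent (\<lambda>j. u j y i)" by blast
  have "\<exists>\<Lambda> c. approx Q a j \<Lambda> c \<and> u j = (\<lambda>y i. \<Lambda> y (detf i))" for j using u(1)[of j] by (simp add: Qs_def)
  then obtain \<Lambda> c where app: "\<And>j. approx Q a j (\<Lambda> j) (c j)" and u_eq: "\<And>j. u j = (\<lambda>y i. \<Lambda> j y (detf i))"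
    by metis
  \<comment> \<open>The costs \<open>c j\<close> need not converge; Fatou's lemma applies to their
    limit inferior.\<close>
  define Cl where "Cl = (\<lambda>y. liminf (\<lambda>j. ennreal (c j y)))"
  have c_meas: "(\<lambda>y. ennreal (c j y)) \<in> borel_measurable \<mu>" for j
    using approxD(4)[OF app, of j] by (simp add: PM_measurable[OF mu])
  have Cl_int: "(\<integral>\<^sup>+y. Cl y \<partial>\<mu>) \<le> ennreal a"
  proof -
    have "(\<integral>\<^sup>+y. Cl y \<partial>\<mu>) \<le> liminf (\<lambda>j. \<integral>\<^sup>+y. ennreal (c j y) \<partial>\<mu>)"
      unfolding Cl_def by (rule nn_integral_liminf[OF c_meas])
    also have "\<dots> \<le> liminf (\<lambda>j. ennreal (a + 1 / real (Suc j)))"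
    proof (rule Liminf_mono, rule always_eventually, rule allI)
      fix j
      have "(\<integral>\<^sup>+y. ennreal (c j y) \<partial>\<mu>) = ennreal (\<integral>y. c j y \<partial>\<mu>)"
        using approxD(5,6)[OF app, of j] by (intro nn_integral_eq_integral) auto
      then show "(\<integral>\<^sup>+y. ennreal (c j y) \<partial>\<mu>) \<le> ennreal (a + 1 / real (Suc j))"
        using approxD(7)[OF app, of j] by (simp add: ennreal_leI)
    qed
    also have "\<dots> = ennreal a"
    proof (rule lim_imp_Liminf)
      have "(\<lambda>j. a + 1 / real (Suc j)) \<longlonglongrightarrow> a + 0"
        by (intro tendsto_add tendsto_const LIMSEQ_Suc[OF lim_1_over_n])
      then show "(\<lambda>j. ennreal (a + 1 / real (Suc j))) \<longlonglongrightarrow> ennreal a" by (intro tendsto_ennrealI) simp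
    qed simp
    finally show ?thesis .
  qed
  have "AE y in \<mu>. Cl y \<noteq> \<infinity>"
  proof (rule nn_integral_noteq_infinite)
    show "Cl \<in> borel_measurable \<mu>" unfolding Cl_def using c_meas by measurable
    show "(\<integral>\<^sup>+y. Cl y \<partial>\<mu>) \<noteq> \<infinity>" using Cl_int by (auto simp: top_unique)
  qed
  with u(2) have "AE y in \<mu>. (\<forall>i. convergent (\<lambda>j. \<Lambda> j y (detf i))) \<and> Cl y < \<infinity>"
    by eventually_elim (simp add: u_eq less_top)
  then obtain N where N: "{y \<in> space \<mu>. \<not> ((\<forall>i. convergent (\<lambda>j. \<Lambda> j y (detf i))) \<and> Cl y < \<infinity>)} \<subseteq> N"
      "emeasure \<mu> N = 0" "N \<in> sets \<mu>"
    by (rule AE_E)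
  have good: "\<exists>R\<in>PM. (\<forall>i. (\<integral>x. detf i x \<partial>R) = lim (\<lambda>j. \<Lambda> j y (detf i))) \<and> (\<integral>\<^sup>+x. J y x \<partial>R) \<le> Cl y" if "y \<notin> N" for y
  proof -
    have *: "(\<forall>i. convergent (\<lambda>j. \<Lambda> j y (detf i))) \<and> Cl y < \<infinity>" using N(1) that PM_space[OF mu] by blast
    show ?thesis
      unfolding Cl_def using * by (intro fibre_limit[OF app]) (auto simp: Cl_def)
  qed
  \<comment> \<open>On the null set N the value Q is just some probability measure. Off N the choice
    is made separately for each y, and measurability is recovered from the means of
    \<open>detf\<close>, which are limits of measurable functions.\<close>
  define K where "K = (\<lambda>y. if y \<in> N then Q else SOME R. R \<in> PM \<and>
    (\<forall>i. (\<integral>x. detf i x \<partial>R) = lim (\<lambda>j. \<Lambda> j y (detf i))) \<and> (\<integral>\<^sup>+x. J y x \<partial>R) \<le> Cl y)"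
  have K: "K y \<in> PM" "\<And>i. (\<integral>x. detf i x \<partial>K y) = lim (\<lambda>j. \<Lambda> j y (detf i))" "(\<integral>\<^sup>+x. J y x \<partial>K y) \<le> Cl y"
    if "y \<notin> N" for y
  proof -
    have "\<exists>R. R \<in> PM \<and> (\<forall>i. (\<integral>x. detf i x \<partial>R) = lim (\<lambda>j. \<Lambda> j y (detf i))) \<and> (\<integral>\<^sup>+x. J y x \<partial>R) \<le> Cl y"
      using good[OF that] by blast
    from someI_ex[OF this]
    show "K y \<in> PM" "\<And>i. (\<integral>x. detf i x \<partial>K y) = lim (\<lambda>j. \<Lambda> j y (detf i))" "(\<integral>\<^sup>+x. J y x \<partial>K y) \<le> Cl y"
      using that by (simp_all add: K_def)
  qed
  have KN: "K y = Q" if "y \<in> N" for y using that by (simp add: K_def)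
  have KPM: "K y \<in> PM" for y using K(1)[of y] KN[of y] Q by (cases "y \<in> N") auto
  have L_meas: "(\<lambda>y. \<Lambda> j y (detf i)) \<in> borel_measurable \<mu>" for i j
    using approxD(3)[OF app detf_Cb, of j i] by (simp add: PM_measurable[OF mu])
  have Km: "K \<in> measurable \<mu> (prob_algebra borel)"
  proof (rule measurable_prob_algebraI_detf)
    fix i
    have "(\<lambda>y. \<integral>x. detf i x \<partial>K y) = (\<lambda>y. if y \<in> N then \<integral>x. detf i x \<partial>Q else lim (\<lambda>j. \<Lambda> j y (detf i)))"
      using K(2) KN by (auto simp: fun_eq_iff)
    moreover have "(\<lambda>y. if y \<in> N then \<integral>x. detf i x \<partial>Q else lim (\<lambda>j. \<Lambda> j y (detf i))) \<in> borel_measurable \<mu>"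
      by (rule measurable_If_set) (use N(3) borel_measurable_lim_metric[OF L_meas] in auto)
    ultimately show "(\<lambda>y. \<integral>x. detf i x \<partial>K y) \<in> borel_measurable \<mu>" by simp
  qed (rule KPM)
  have AE_N: "AE y in \<mu>. y \<notin> N"
    by (rule AE_I'[of N]) (use N(2,3) in \<open>auto simp: null_sets_def\<close>)
  have "bind \<mu> K = Q"
  proof (rule PM_eqI[OF bind_PM[OF mu Km] Q])
    fix i
    have "(\<lambda>j. \<integral>y. \<Lambda> j y (detf i) \<partial>\<mu>) \<longlonglongrightarrow> (\<integral>y. (\<integral>x. detf i x \<partial>K y) \<partial>\<mu>)"
    proof (rule integral_dominated_convergence[where w = "\<lambda>_. 1"])
      show "(\<lambda>y. \<integral>x. detf i x \<partial>K y) \<in> borel_measurable \<mu>"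
        by (rule measurable_integral_prob_algebra[OF Km detf_Cb])
      show "AE y in \<mu>. (\<lambda>j. \<Lambda> j y (detf i)) \<longlonglongrightarrow> (\<integral>x. detf i x \<partial>K y)"
        using AE_N u(2)
        by eventually_elim (simp add: K(2) u_eq convergent_LIMSEQ_iff)
      show "AE y in \<mu>. norm (\<Lambda> j y (detf i)) \<le> 1" for j
      proof (rule AE_I2)
        fix y
        have "\<bar>\<Lambda> j y (detf i)\<bar> \<le> supn (detf i :: 'x \<Rightarrow> real)" by (rule approxD(2)[OF app detf_Cb])
        then show "norm (\<Lambda> j y (detf i)) \<le> 1" using supn_detf_le[of i] by simp
      qed
    qed (use L_meas in auto)
    moreover have "(\<lambda>j. \<integral>y. \<Lambda> j y (detf i) \<partial>\<mu>) \<longlonglongrightarrow> (\<integral>x. detf i x \<partial>Q)"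
    proof (rule LIM_zero_cancel, rule Lim_null_comparison)
      show "\<forall>\<^sub>F j in sequentially. norm ((\<integral>y. \<Lambda> j y (detf i) \<partial>\<mu>) - (\<integral>x. detf i x \<partial>Q)) \<le> 1 / real (Suc j)"
        using eventually_gt_at_top[of i] by eventually_elim (use approxD(9)[OF app] in simp)
      show "(\<lambda>j. 1 / real (Suc j)) \<longlonglongrightarrow> 0" by (rule LIMSEQ_Suc[OF lim_1_over_n])
    qed
    ultimately show "(\<integral>x. detf i x \<partial>bind \<mu> K) = (\<integral>x. detf i x \<partial>Q)"
      unfolding integral_bind_PM[OF mu Km detf_Cb] by (rule LIMSEQ_unique)
  qed
  moreover have "kcost \<mu> J K \<le> ennreal a"
  proof -
    have "kcost \<mu> J K \<le> (\<integral>\<^sup>+y. Cl y \<partial>\<mu>)"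
      unfolding kcost_def using AE_N by (intro nn_integral_mono_AE) (auto elim!: eventually_mono intro: K(3))
    also have "\<dots> \<le> ennreal a" by (rule Cl_int)
    finally show ?thesis .
  qed
  ultimately show ?thesis using Km by (intro bexI[of _ K]) (auto simp: kernels_for_def)
qed

end

section \<open>The large deviation principle, the dual formula and optimal kernels\<close>

context kn_system
begin

text \<open>Passing from kernels to the dual side, the infimum is not yet known to be attained,
  hence the detour through a + e.\<close>

lemma rateI_le_iff:
  assumes Q: "Q \<in> PM" and a: "0 \<le> a"
  shows "rateI \<mu> J Q \<le> ennreal a \<longleftrightarrow> dual_le a Q"
proof
  assume "dual_le a Q"
  from kernel_of_dual_le[OF Q this a] show "rateI \<mu> J Q \<le> ennreal a"
    unfolding rateI_def by (auto intro: INF_lower2)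
next
  assume le: "rateI \<mu> J Q \<le> ennreal a"
  have "dual_le (a + e) Q" if e: "0 < e" for e
  proof -
    have "ennreal a < ennreal (a + e)" using a e by (simp add: ennreal_less_iff)
    with le have "(INF K\<in>kernels_for \<mu> Q. kcost \<mu> J K) < ennreal (a + e)"
      unfolding rateI_def by (rule le_less_trans)
    then obtain K where "K \<in> kernels_for \<mu> Q" "kcost \<mu> J K < ennreal (a + e)"
      by (auto simp: INF_less_iff)
    then show ?thesis using a e by (intro dual_le_of_kernel) auto
  qed
  note dual_eps = this
  show "dual_le a Q"
    unfolding dual_le_def
  proof (intro ballI, rule field_le_epsilon)
    fix h :: "'x \<Rightarrow> real" and e :: real assume h: "h \<in> Cb" and e: "0 < e"
    have "(\<integral>x. h x \<partial>Q) \<le> p h + (a + e)"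
      using dual_eps[OF e] h unfolding dual_le_def by blast
    then show "(\<integral>x. h x \<partial>Q) \<le> p h + a + e" by simp
  qed
qed

lemma p_zero: "p (\<lambda>_. 0) \<le> 0"
  using dini_p by (auto simp: dini_functional_def)

lemma good_rate_rateI: "good_rate_on narrow_topology (rateI \<mu> J)"
  unfolding good_rate_on_def
proof
  fix a :: real
  \<comment> \<open>\<open>ennreal\<close> truncates negative levels to 0.\<close>
  have "ennreal a = ennreal (max 0 a)" by (simp add: max_def ennreal_neg)
  then have "{Q \<in> topspace narrow_topology. rateI \<mu> J Q \<le> ennreal a} = {Q \<in> PM. dual_le (max 0 a) Q}"
    using rateI_le_iff[of _ "max 0 a"] by auto
  then show "compactin narrow_topology {Q \<in> topspace narrow_topology. rateI \<mu> J Q \<le> ennreal a}"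
    using compactin_dominated_PM[OF dini_p, of "max 0 a"] by (simp add: dual_le_def)
qed

lemma kn_upper:
  assumes B: "B \<in> sets (prob_algebra borel)"
  shows "limsup (\<lambda>k. limsup (\<lambda>n. elog (emp_prob P z k n B) / ereal (real k * real n)))
    \<le> - enn2ereal (INF Q\<in>narrow_topology closure_of B. rateI \<mu> J Q)" (is "?X \<le> - ?Y")
proof (rule ccontr)
  assume "\<not> ?X \<le> - ?Y"
  then have "- ?Y < ?X" by (simp only: not_le)
  then have "- ?X < ?Y" by (simp only: ereal_uminus_less_reorder[of ?X ?Y])
  then obtain a where a: "- ?X < ereal a" "ereal a < ?Y" using ereal_dense2 by blast
  have BPM: "B \<subseteq> PM" using sets.sets_into_space[OF B] by (simp add: PM_def)
  have "?X \<le> ereal (- a)"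
  proof (rule upper_bound[OF BPM])
    fix Q assume Q: "Q \<in> narrow_topology closure_of B"
    then have QPM: "Q \<in> PM" using subsetD[OF closure_of_subset_topspace Q] by simp
    show "\<exists>h\<in>Cb. p h + a < (\<integral>x. h x \<partial>Q)"
    proof (cases "0 \<le> a")
      case True
      have "(INF Q\<in>narrow_topology closure_of B. rateI \<mu> J Q) \<le> rateI \<mu> J Q"
        using Q by (rule INF_lower)
      then have "?Y \<le> enn2ereal (rateI \<mu> J Q)" by (simp add: less_eq_ennreal.rep_eq)
      with a(2) have "ereal a < enn2ereal (rateI \<mu> J Q)" by (rule less_le_trans)
      then have "\<not> rateI \<mu> J Q \<le> ennreal a"
        using True by (simp add: less_eq_ennreal.rep_eq enn2ereal_ennreal not_le)
      then show ?thesis using rateI_le_iff[OF QPM True] by (auto simp: dual_le_def not_le)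
    next
      case False
      \<comment> \<open>For negative a the zero function separates, since p of it is at most
        0.\<close>
      then show ?thesis using p_zero by (intro bexI[of _ "\<lambda>_. 0"]) auto
    qed
  qed
  then have "ereal a \<le> - ?X" using ereal_minus_le_minus[of "ereal (- a)" ?X] by simp
  then show False using a(1) by simp
qed

lemma kn_lower:
  assumes B: "B \<in> sets (prob_algebra borel)"
  shows "- enn2ereal (INF Q\<in>narrow_topology interior_of B. rateI \<mu> J Q)
    \<le> liminf (\<lambda>k. liminf (\<lambda>n. elog (emp_prob P z k n B) / ereal (real k * real n)))" (is "- ?Y \<le> ?X")
proof (rule ccontr)
  assume "\<not> - ?Y \<le> ?X"
  then have "?X < - ?Y" by (simp only: not_le)
  then have "?Y < - ?X" by (simp only: ereal_less_uminus_reorder[of ?Y ?X])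
  then obtain a where a: "?Y < ereal a" "ereal a < - ?X" using ereal_dense2 by blast
  have a0: "0 \<le> a"
    using a(1) enn2ereal_nonneg[of "INF Q\<in>narrow_topology interior_of B. rateI \<mu> J Q"]
    by (metis ereal_less_eq(5) less_imp_le order_trans)
  have "(INF Q\<in>narrow_topology interior_of B. rateI \<mu> J Q) < ennreal a"
    using a(1) a0 by (simp add: less_ennreal.rep_eq enn2ereal_ennreal)
  then obtain Q where Q: "Q \<in> narrow_topology interior_of B" "rateI \<mu> J Q < ennreal a"
    by (auto simp: INF_less_iff)
  have QPM: "Q \<in> PM" using subsetD[OF interior_of_subset_topspace Q(1)] by simp
  have "dual_le a Q" using less_imp_le[OF Q(2)] unfolding rateI_le_iff[OF QPM a0] .
  from lower_bound[OF B Q(1) this a0] have "ereal (- a) \<le> ?X" .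
  then have "- ?X \<le> ereal a" using ereal_minus_le_minus[of ?X "ereal (- a)"] by simp
  then show False using a(2) by simp
qed

lemma kn_LDP_rateI: "kn_LDP narrow_topology (sets (prob_algebra borel)) (emp_prob P z) (rateI \<mu> J)"
  unfolding kn_LDP_def using good_rate_rateI kn_upper kn_lower by blast

text \<open>Both sides are compared through their real upper bounds, which in both cases are the a
  with \<open>dual_le a Q\<close>; this also covers the value infinity.\<close>

lemma rateI_dual:
  assumes Q: "Q \<in> PM"
  shows "enn2ereal (rateI \<mu> J Q) = (SUP f\<in>Cb. ereal ((\<integral>y. Sop J f y \<partial>\<mu>) - (\<integral>x. f x \<partial>Q)))"
proof -
  have term_eq: "(\<integral>y. Sop J f y \<partial>\<mu>) - (\<integral>x. f x \<partial>Q) = (\<integral>x. - f x \<partial>Q) - p (\<lambda>x. - f x)" if "f \<in> Cb" for f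
  proof -
    have "Sop J f = (\<lambda>y. - vsup (J y) (\<lambda>x. - f x))"
      by (rule ext) (rule Sop_eq_vsup[of J, OF rate_fn_J that])
    then show ?thesis by (simp add: p_def)
  qed
  have bound_iff: "(\<forall>f\<in>Cb. (\<integral>y. Sop J f y \<partial>\<mu>) - (\<integral>x. f x \<partial>Q) \<le> a) \<longleftrightarrow> dual_le a Q" for a
  proof
    assume *: "\<forall>f\<in>Cb. (\<integral>y. Sop J f y \<partial>\<mu>) - (\<integral>x. f x \<partial>Q) \<le> a"
    show "dual_le a Q"
      unfolding dual_le_def
    proof
      fix h :: "'x \<Rightarrow> real" assume h: "h \<in> Cb"
      show "(\<integral>x. h x \<partial>Q) \<le> p h + a"
        using bspec[OF * Cb_minus[OF h]] term_eq[OF Cb_minus[OF h]] by simp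
    qed
  next
    assume *: "dual_le a Q"
    show "\<forall>f\<in>Cb. (\<integral>y. Sop J f y \<partial>\<mu>) - (\<integral>x. f x \<partial>Q) \<le> a"
    proof
      fix f :: "'x \<Rightarrow> real" assume f: "f \<in> Cb"
      then have "(\<integral>x. - f x \<partial>Q) \<le> p (\<lambda>x. - f x) + a" using * Cb_minus[OF f] unfolding dual_le_def by blast
      then show "(\<integral>y. Sop J f y \<partial>\<mu>) - (\<integral>x. f x \<partial>Q) \<le> a" using term_eq[OF f] by linarith
    qed
  qed
  have SUP_iff: "(SUP f\<in>Cb. ereal ((\<integral>y. Sop J f y \<partial>\<mu>) - (\<integral>x. f x \<partial>Q))) \<le> ereal a \<longleftrightarrow> dual_le a Q" for a
    unfolding bound_iff[symmetric] by (simp add: SUP_le_iff)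
  have dual_nonneg: "0 \<le> a" if "dual_le a Q" for a
  proof -
    have "(\<integral>x. 0 \<partial>Q) \<le> p (\<lambda>_. 0) + a" using that unfolding dual_le_def by blast
    then show ?thesis using p_zero by simp
  qed
  have rate_iff: "enn2ereal (rateI \<mu> J Q) \<le> ereal a \<longleftrightarrow> dual_le a Q" for a
  proof (cases "0 \<le> a")
    case True
    then show ?thesis
      using rateI_le_iff[OF Q True] by (simp add: less_eq_ennreal.rep_eq enn2ereal_ennreal)
  next
    case False
    then have "\<not> enn2ereal (rateI \<mu> J Q) \<le> ereal a"
      using enn2ereal_nonneg[of "rateI \<mu> J Q"] by (metis ereal_less_eq(5) order_trans)
    then show ?thesis using False dual_nonneg by blast
  qed
  show ?thesis
    by (rule antisym; rule ereal_le_real) (simp_all only: SUP_iff rate_iff)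
qed

lemma rateI_attained:
  assumes Q: "Q \<in> PM" and fin: "rateI \<mu> J Q < \<infinity>"
  shows "\<exists>K\<in>kernels_for \<mu> Q. kcost \<mu> J K = rateI \<mu> J Q"
proof -
  obtain a where a: "rateI \<mu> J Q = ennreal a" "0 \<le> a" using fin by (cases "rateI \<mu> J Q") auto
  then have "dual_le a Q" using rateI_le_iff[OF Q a(2)] by simp
  from kernel_of_dual_le[OF Q this a(2)] obtain K where K: "K \<in> kernels_for \<mu> Q" "kcost \<mu> J K \<le> ennreal a"
    by blast
  moreover have "rateI \<mu> J Q \<le> kcost \<mu> J K" unfolding rateI_def using K(1) by (rule INF_lower)
  ultimately show ?thesis using a by (intro bexI[of _ K]) auto
qed

section \<open>Conditional laws given a continuous statistic\<close>

text \<open>Joint measurability comes from the representation of J by countably many functions that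
  are measurable in y and continuous in x.\<close>

lemma J_measurable_graph:
  assumes "\<beta> \<in> borel_measurable M" "\<xi> \<in> borel_measurable M"
  shows "(\<lambda>w. J (\<beta> w) (\<xi> w)) \<in> borel_measurable M"
proof -
  have "(\<lambda>w. SUP i. ennreal (hfam i (\<xi> w) - vsup (J (\<beta> w)) (hfam i))) \<in> borel_measurable M"
  proof (rule borel_measurable_SUP)
    fix i
    have "(\<lambda>w. hfam i (\<xi> w)) \<in> borel_measurable M"
      by (rule measurable_compose[OF assms(2) Cb_measurable[OF hfam_Cb]])
    moreover have "(\<lambda>w. vsup (J (\<beta> w)) (hfam i)) \<in> borel_measurable M"
      by (rule measurable_compose[OF assms(1) vsup_measurable[OF hfam_Cb]])
    ultimately show "(\<lambda>w. ennreal (hfam i (\<xi> w) - vsup (J (\<beta> w)) (hfam i))) \<in> borel_measurable M"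
      by simp
  qed simp
  then show ?thesis by (simp add: rate_fn.J_eq_SUP_hfam[OF rate_fn_J, symmetric])
qed

lemma P_kernel: "k \<ge> 1 \<Longrightarrow> P k \<in> measurable \<mu> (prob_algebra borel)"
proof (rule measurable_prob_algebraI_detf)
  fix i assume k: "k \<ge> 1"
  show "(\<lambda>y. \<integral>x. detf i x \<partial>P k y) \<in> borel_measurable \<mu>"
    using borel_measurable_continuous_onI[OF P_cont[OF k detf_Cb, of i]] by (simp add: PM_measurable[OF mu])
qed (rule P_PM)

context
  fixes \<beta> :: "'x \<Rightarrow> 'z"
  assumes cont: "continuous_on UNIV \<beta>"
    and cond: "\<And>k A C. k \<ge> 1 \<Longrightarrow> A \<in> sets borel \<Longrightarrow> C \<in> sets borel \<Longrightarrow>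
      emeasure (bind \<mu> (P k)) (A \<inter> \<beta> -` C) = (\<integral>\<^sup>+y\<in>C. emeasure (P k y) A \<partial>\<mu>)"
begin

lemma beta_measurable: "\<beta> \<in> borel_measurable borel"
  by (rule borel_measurable_continuous_onI[OF cont])

lemma beta_vimage: "C \<in> sets borel \<Longrightarrow> \<beta> -` C \<in> sets borel"
  using measurable_sets[OF beta_measurable, of C] by simp

text \<open>For almost every y in a basis set, the law \<open>P k y\<close> gives no mass to the
  preimage of its complement; with countably many basis sets and k, one null set serves all. If
  \<beta> x differs from y, then x has a neighbourhood that has mass 0 for all k \<ge> 1, against
  the lower bound of the LDP unless J y x is infinite.\<close>

lemma AE_J_infinite: "AE y in \<mu>. \<forall>x. \<beta> x \<noteq> y \<longrightarrow> J y x = \<infinity>"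
proof -
  obtain Bs :: "'z set set" where Bs: "countable Bs" "topological_basis Bs"
    using ex_countable_basis by blast
  have null: "AE y in \<mu>. y \<in> V \<longrightarrow> emeasure (P k y) (\<beta> -` (- V)) = 0" if V: "V \<in> Bs" and k: "k \<ge> 1" for V k
  proof -
    have Vb: "V \<in> sets borel" "- V \<in> sets borel" using topological_basis_open[OF Bs(2) V] by auto
    have meas: "(\<lambda>y. emeasure (P k y) (\<beta> -` (- V)) * indicator V y) \<in> borel_measurable \<mu>"
    proof (intro borel_measurable_times_ennreal borel_measurable_indicator)
      show "(\<lambda>y. emeasure (P k y) (\<beta> -` (- V))) \<in> borel_measurable \<mu>"
        by (rule measurable_emeasure_kernel[OF measurable_prob_algebraD[OF P_kernel[OF k]] beta_vimage[OF Vb(2)]])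
      show "V \<in> sets \<mu>" using Vb(1) by (simp add: PM_sets[OF mu])
    qed
    \<comment> \<open>With this choice of sets the left side of \<open>cond\<close> is the measure
      of the empty set.\<close>
    have "\<beta> -` (- V) \<inter> \<beta> -` V = {}" by auto
    then have "(\<integral>\<^sup>+y. emeasure (P k y) (\<beta> -` (- V)) * indicator V y \<partial>\<mu>) = 0"
      using cond[OF k beta_vimage[OF Vb(2)] Vb(1)] by simp
    then have "AE y in \<mu>. emeasure (P k y) (\<beta> -` (- V)) * indicator V y = 0"
      using nn_integral_0_iff_AE[OF meas] by simp
    then show ?thesis by eventually_elim (auto simp: indicator_def)
  qed
  have "AE y in \<mu>. \<forall>V\<in>Bs. \<forall>k\<in>{1..}. y \<in> V \<longrightarrow> emeasure (P k y) (\<beta> -` (- V)) = 0"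
    unfolding AE_ball_countable[OF Bs(1)] AE_ball_countable[OF countableI_type]
    using null by simp
  then show ?thesis
  proof eventually_elim
    fix y assume y: "\<forall>V\<in>Bs. \<forall>k\<in>{1..}. y \<in> V \<longrightarrow> emeasure (P k y) (\<beta> -` (- V)) = 0"
    show "\<forall>x. \<beta> x \<noteq> y \<longrightarrow> J y x = \<infinity>"
    proof (intro allI impI, rule ccontr)
      fix x assume x: "\<beta> x \<noteq> y" and "J y x \<noteq> \<infinity>"
      then have Jx: "J y x < \<infinity>" by (simp add: less_top)
      obtain W V0 where W: "open W" "open V0" "\<beta> x \<in> W" "y \<in> V0" "W \<inter> V0 = {}"
        using hausdorff[OF x] by blast
      obtain V where V: "V \<in> Bs" "y \<in> V" "V \<subseteq> V0"
        using topological_basisE[OF Bs(2) W(2,4)] by blast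
      have U: "open (\<beta> -` W)" "x \<in> \<beta> -` W" using open_vimage[OF W(1) cont] W(3) by auto
      have "\<forall>\<^sub>F k in sequentially. exp (- real k * (enn2real (J y x) + 1)) \<le> measure (P k y) (\<beta> -` W)"
        by (rule k_LDP_open_bound[OF ldp U Jx]) simp
      then obtain k where k: "k \<ge> 1" "exp (- real k * (enn2real (J y x) + 1)) \<le> measure (P k y) (\<beta> -` W)"
        unfolding eventually_sequentially by (metis max.cobounded1 max.cobounded2)
      have "emeasure (P k y) (\<beta> -` (- V)) = 0" using y V k(1) by auto
      moreover have "\<beta> -` W \<subseteq> \<beta> -` (- V)" using W(5) V(3) by auto
      moreover have "\<beta> -` (- V) \<in> sets (P k y)"
        using beta_vimage[of "- V"] topological_basis_open[OF Bs(2) V(1)] by (simp add: PM_sets[OF P_PM[OF k(1)]])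
      ultimately have "emeasure (P k y) (\<beta> -` W) = 0" using emeasure_mono by (metis le_zero_eq)
      then have "measure (P k y) (\<beta> -` W) = 0" by (simp add: measure_def)
      then show False using k(2) by (simp add: not_le[symmetric])
    qed
  qed
qed

text \<open>An optimal kernel has finite cost on almost every fibre, so by
  \<open>AE_J_infinite\<close> its value at y is carried by the set where \<beta> equals y. This
  gives both the image of Q and the formula for the cost.\<close>

lemma rateI_finite_conditional:
  assumes Q: "Q \<in> PM" and fin: "rateI \<mu> J Q < \<infinity>"
  shows "distr Q borel \<beta> = \<mu>" "rateI \<mu> J Q = (\<integral>\<^sup>+x. J (\<beta> x) x \<partial>Q)"
proof -
  obtain K where K: "K \<in> kernels_for \<mu> Q" "kcost \<mu> J K = rateI \<mu> J Q"
    using rateI_attained[OF Q fin] by blast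
  have Km: "K \<in> measurable \<mu> (prob_algebra borel)" and KQ: "bind \<mu> K = Q"
    using K(1) by (auto simp: kernels_for_def)
  note Ks = measurable_prob_algebraD[OF Km]
  have KPM: "K y \<in> PM" for y by (rule kernel_PM[OF mu Km])
  have J_meas: "J y \<in> borel_measurable (K y)" for y
    using J_measurable_graph[of "\<lambda>_. y" borel "\<lambda>x. x"] by (simp add: PM_measurable[OF KPM])
  have "(\<lambda>y. \<integral>\<^sup>+x. J y x \<partial>K y) \<in> borel_measurable \<mu>"
  proof (rule nn_integral_measurable_subprob_algebra2[OF _ Ks])
    have "(\<lambda>w. J (fst w) (snd w)) \<in> borel_measurable (\<mu> \<Otimes>\<^sub>M borel)"
    proof (rule J_measurable_graph)
      show "fst \<in> borel_measurable (\<mu> \<Otimes>\<^sub>M borel)"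
        using measurable_fst[of \<mu> "borel :: 'x measure"] measurable_cong_sets[OF refl PM_sets[OF mu]] by blast
    qed simp
    then show "(\<lambda>(y, x). J y x) \<in> borel_measurable (\<mu> \<Otimes>\<^sub>M borel)" by (simp add: split_beta')
  qed
  moreover have "(\<integral>\<^sup>+y. \<integral>\<^sup>+x. J y x \<partial>K y \<partial>\<mu>) \<noteq> \<infinity>" using K(2) fin by (simp add: kcost_def)
  ultimately have "AE y in \<mu>. (\<integral>\<^sup>+x. J y x \<partial>K y) \<noteq> \<infinity>" by (rule nn_integral_noteq_infinite)
  with AE_J_infinite have AEb: "AE y in \<mu>. AE x in K y. \<beta> x = y"
  proof eventually_elim
    fix y assume y: "\<forall>x. \<beta> x \<noteq> y \<longrightarrow> J y x = \<infinity>" "(\<integral>\<^sup>+x. J y x \<partial>K y) \<noteq> \<infinity>"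
    from nn_integral_noteq_infinite[OF J_meas y(2)]
    show "AE x in K y. \<beta> x = y" by eventually_elim (use y(1) in blast)
  qed
  show "distr Q borel \<beta> = \<mu>"
  proof (rule measure_eqI)
    show "sets (distr Q borel \<beta>) = sets \<mu>" by (simp add: PM_sets[OF mu])
    fix C assume "C \<in> sets (distr Q borel \<beta>)"
    then have C: "C \<in> sets borel" by simp
    have bQ: "\<beta> \<in> borel_measurable Q" using beta_measurable by (simp add: measurable_cong_sets[OF PM_sets[OF Q] refl])
    have "emeasure (distr Q borel \<beta>) C = emeasure Q (\<beta> -` C)"
      using C bQ by (simp add: emeasure_distr PM_space[OF Q])
    also have "\<dots> = (\<integral>\<^sup>+y. emeasure (K y) (\<beta> -` C) \<partial>\<mu>)"
      unfolding KQ[symmetric] using PM_space[OF mu] by (intro emeasure_bind[OF _ Ks beta_vimage[OF C]]) simp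
    also have "\<dots> = (\<integral>\<^sup>+y. indicator C y \<partial>\<mu>)"
    proof (rule nn_integral_cong_AE, use AEb in eventually_elim)
      fix y assume y: "AE x in K y. \<beta> x = y"
      interpret Ky: prob_space "K y" using KPM by (rule PM_prob)
      have "emeasure (K y) (\<beta> -` C) = (\<integral>\<^sup>+x. indicator (\<beta> -` C) x \<partial>K y)"
        using beta_vimage[OF C] by (simp add: PM_sets[OF KPM])
      also have "\<dots> = (\<integral>\<^sup>+x. indicator C y \<partial>K y)"
        using y by (intro nn_integral_cong_AE) (auto elim!: eventually_mono simp: indicator_def)
      also have "\<dots> = indicator C y" by (simp add: Ky.emeasure_space_1)
      finally show "emeasure (K y) (\<beta> -` C) = indicator C y" .
    qed
    also have "\<dots> = emeasure \<mu> C" using C by (simp add: PM_sets[OF mu])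
    finally show "emeasure (distr Q borel \<beta>) C = emeasure \<mu> C" .
  qed
  have "kcost \<mu> J K = (\<integral>\<^sup>+y. \<integral>\<^sup>+x. J (\<beta> x) x \<partial>K y \<partial>\<mu>)"
    unfolding kcost_def
  proof (rule nn_integral_cong_AE, use AEb in eventually_elim)
    fix y assume "AE x in K y. \<beta> x = y"
    then show "(\<integral>\<^sup>+x. J y x \<partial>K y) = (\<integral>\<^sup>+x. J (\<beta> x) x \<partial>K y)"
      by (intro nn_integral_cong_AE) (auto elim!: eventually_mono)
  qed
  also have "\<dots> = (\<integral>\<^sup>+x. J (\<beta> x) x \<partial>Q)"
    unfolding KQ[symmetric] using J_measurable_graph[OF beta_measurable, of "\<lambda>x. x"]
    by (intro nn_integral_bind[symmetric, OF _ Ks]) simp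
  finally show "rateI \<mu> J Q = (\<integral>\<^sup>+x. J (\<beta> x) x \<partial>Q)" using K(2) by simp
qed

text \<open>The pointwise inequality \<open>le_J\<close> on the fibre of \<beta> x is integrated
  directly against Q. Since \<beta> maps Q to \<mu>, the integral of
  \<open>vsup (J (\<beta> x)) h\<close> is \<open>p h\<close>, which yields
  \<open>dual_le\<close>.\<close>

lemma rateI_le_conditional:
  assumes Q: "Q \<in> PM" and d: "distr Q borel \<beta> = \<mu>"
  shows "rateI \<mu> J Q \<le> (\<integral>\<^sup>+x. J (\<beta> x) x \<partial>Q)"
proof (cases "\<integral>\<^sup>+x. J (\<beta> x) x \<partial>Q")
  case (real a)
  have bQ: "\<beta> \<in> borel_measurable Q" using beta_measurable by (simp add: measurable_cong_sets[OF PM_sets[OF Q] refl])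
  have "dual_le a Q"
    unfolding dual_le_def
  proof
    fix h :: "'x \<Rightarrow> real" assume h: "h \<in> Cb"
    have p_eq: "p h = (\<integral>x. vsup (J (\<beta> x)) h \<partial>Q)"
      using integral_distr[OF bQ vsup_measurable[OF h]] unfolding d p_def .
    have v_int: "integrable Q (\<lambda>x. vsup (J (\<beta> x)) h)"
      by (rule bounded_integrable_PM[OF Q measurable_compose[OF beta_measurable vsup_measurable[OF h]] vsup_abs_le[OF h]])
    have "ennreal ((\<integral>x. h x \<partial>Q) - p h) = ennreal (\<integral>x. h x - vsup (J (\<beta> x)) h \<partial>Q)"
      unfolding p_eq using v_int Cb_integrable[OF Q h] by simp
    also have "\<dots> \<le> (\<integral>\<^sup>+x. ennreal (h x - vsup (J (\<beta> x)) h) \<partial>Q)"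
      using v_int Cb_integrable[OF Q h] by (intro ennreal_integral_le) simp
    also have "\<dots> \<le> (\<integral>\<^sup>+x. J (\<beta> x) x \<partial>Q)"
      by (intro nn_integral_mono rate_fn.le_J[OF rate_fn_J h])
    finally have "(\<integral>x. h x \<partial>Q) - p h \<le> a" using real by (simp add: ennreal_le_iff)
    then show "(\<integral>x. h x \<partial>Q) \<le> p h + a" by simp
  qed
  then show ?thesis using rateI_le_iff[OF Q real(1)] real(2) by simp
qed simp

lemma rateI_conditional:
  assumes Q: "Q \<in> PM"
  shows "rateI \<mu> J Q = (if distr Q borel \<beta> = \<mu> then (\<integral>\<^sup>+x. J (\<beta> x) x \<partial>Q) else \<infinity>)"
proof (cases "rateI \<mu> J Q < \<infinity>")
  case True
  then show ?thesis using rateI_finite_conditional[OF Q] by simp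
next
  case False
  then have "rateI \<mu> J Q = \<infinity>" by (simp add: not_less top_unique)
  then show ?thesis using rateI_le_conditional[OF Q] by (simp add: top_unique)
qed

end

end

theorem mainTheorem14:
  fixes z :: "nat \<Rightarrow> nat \<Rightarrow> 'z::polish_space"
    and \<mu> :: "'z measure"
    and P :: "nat \<Rightarrow> 'z \<Rightarrow> 'x::polish_space measure"
    and J :: "'z \<Rightarrow> 'x \<Rightarrow> ennreal"
  assumes mu: "\<mu> \<in> PM"
    and conv: "\<And>f. f \<in> Cb \<Longrightarrow>
                 (\<lambda>n. (\<Sum>i<n. f (z n i)) / real n) \<longlonglongrightarrow> (\<integral>y. f y \<partial>\<mu>)"
    and fel: "\<And>k. k \<ge> 1 \<Longrightarrow> feller (P k)"
    and ldp: "\<And>y. k_LDP (\<lambda>k. P k y) (J y)"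
  shows
    "kn_LDP narrow_topology (sets (prob_algebra borel)) (emp_prob P z) (rateI \<mu> J)
     \<and> (\<forall>Q \<in> PM. enn2ereal (rateI \<mu> J Q) =
          (SUP f \<in> Cb. ereal ((\<integral>y. Sop J f y \<partial>\<mu>) - (\<integral>x. f x \<partial>Q))))
     \<and> (\<forall>Q \<in> PM. rateI \<mu> J Q < \<infinity> \<longrightarrow>
          (\<exists>K \<in> kernels_for \<mu> Q. kcost \<mu> J K = rateI \<mu> J Q))
     \<and> (\<forall>\<beta> :: 'x \<Rightarrow> 'z. continuous_on UNIV \<beta> \<longrightarrow>
          (\<forall>k \<ge> 1. \<forall>A \<in> sets borel. \<forall>C \<in> sets borel.
              emeasure (bind \<mu> (P k)) (A \<inter> \<beta> -` C) = (\<integral>\<^sup>+y\<in>C. emeasure (P k y) A \<partial>\<mu>)) \<longrightarrow>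
          (\<forall>Q \<in> PM. rateI \<mu> J Q =
              (if distr Q borel \<beta> = \<mu> then (\<integral>\<^sup>+x. J (\<beta> x) x \<partial>Q) else \<infinity>)))"
proof -
  interpret kn_system z \<mu> P J
    using mu conv fel ldp by unfold_locales
  show ?thesis
    using kn_LDP_rateI rateI_dual rateI_attained rateI_conditional by blast
qed

end
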